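(* Let $n,p$ be positive integers with $p\le n$, let $A\in\mathbb{R}^{2n\times 2n}$ be symmetric positive definite with symplectic eigenvalues $0<d_1\le d_2\le\dots\le d_n$, and let $\beta>0$. Then the penalty problem $$\text{(TPM)}\qquad \min_{X\in\mathbb{R}^{2n\times 2p}} f_\beta(X):=\tfrac12\operatorname{tr}(X^\top AX)+\tfrac{\beta}{4}\|X^\top J_nX-J_p\|_F^2$$ is equivalent to the constrained problem $$\text{(COP)}\qquad \min_{X\in\mathbb{R}^{2n\times 2p}} \tfrac12\operatorname{tr}(X^\top AX)\quad\text{s.t. } X^\top J_nX=J_p$$ if and only if $\beta>d_p$. Specifically, when $\beta>d_p$, any global minimizer $X$ of (TPM) has the form $$X=\bar S\left(I_{2p}-\frac{\bar D}{\beta}\right)^{1/2}T^\top,$$ where $\bar S\in\mathrm{Sp}(2p,2n)$ satisfies $\bar S^\top A\bar S=\bar D=\mathrm{Diag}(d_1,\dots,d_p,d_1,\dots,d_p)$ and $T\in\mathrm{OrSp}(2p)$.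
   Context: For a positive integer $k$, $J_k=\begin{bmatrix}0&I_k\\-I_k&0\end{bmatrix}\in\mathbb{R}^{2k\times 2k}$. $\mathrm{Sp}(2p,2n)=\{X\in\mathbb{R}^{2n\times 2p}: X^\top J_nX=J_p\}$, and $\mathrm{Sp}(2n)=\mathrm{Sp}(2n,2n)$. $\mathrm{OrSp}(2p)$ is the set of $2p\times 2p$ real matrices that are both symplectic (i.e. in $\mathrm{Sp}(2p)$) and orthogonal. By Williamson's theorem, for symmetric positive definite $A\in\mathbb{R}^{2n\times 2n}$ there is $S\in\mathrm{Sp}(2n)$ with $S^\top AS=\mathrm{Diag}(d_1,\dots,d_n,d_1,\dots,d_n)$, $d_j>0$; the $d_j$ are uniquely determined up to order and are the symplectic eigenvalues of $A$. The columns $S_i,S_{i+n}$ form a symplectic eigenvector pair for $d_i$: $A[S_i,S_{i+n}]=d_iJ_n[S_i,S_{i+n}]J_1^\top$. Definition of equivalence: (TPM) is equivalent to (COP) if their global minimizers span (by their columns) identical $2p$-dimensional eigenspaces corresponding to the $p$ smallest symplectic eigenvalues of $A$, i.e. spans of $p$ symplectic eigenvector pairs (columns of a matrix in $\mathrm{Sp}(2p,2n)$) for $d_1,\dots,d_p$. If $d_p=d_{p+1}$, so that such an eigenspace is not unique, this is read as: the collection of column spaces of global minimizers is the same for the two problems. *)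

theory Defs
  imports "Jordan_Normal_Form.VS_Connect"
begin

(* Matrices and vectors are 0-indexed. *)

definition mat_trace :: "real mat \<Rightarrow> real" where
  "mat_trace M = (\<Sum>i<dim_row M. M $$ (i, i))"

definition frobenius_norm :: "real mat \<Rightarrow> real" where
  "frobenius_norm M = sqrt (\<Sum>i<dim_row M. \<Sum>j<dim_col M. (M $$ (i, j))\<^sup>2)"

definition positive_semidefinite :: "nat \<Rightarrow> real mat \<Rightarrow> bool" where
  "positive_semidefinite m M \<longleftrightarrow>
     M \<in> carrier_mat m m \<and> M\<^sup>T = M \<and> (\<forall>v\<in>carrier_vec m. 0 \<le> v \<bullet> (M *\<^sub>v v))"

definition positive_definite :: "nat \<Rightarrow> real mat \<Rightarrow> bool" where
  "positive_definite m M \<longleftrightarrow>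
     M \<in> carrier_mat m m \<and> M\<^sup>T = M \<and>
     (\<forall>v\<in>carrier_vec m. v \<noteq> 0\<^sub>v m \<longrightarrow> 0 < v \<bullet> (M *\<^sub>v v))"

(* The principal square root; meaningful only for positive semidefinite M,
   where such an R exists and is unique. *)
definition psd_sqrt :: "real mat \<Rightarrow> real mat" where
  "psd_sqrt M = (THE R. positive_semidefinite (dim_row M) R \<and> R * R = M)"

definition symp_J :: "nat \<Rightarrow> real mat" where
  "symp_J k = four_block_mat (0\<^sub>m k k) (1\<^sub>m k) (- 1\<^sub>m k) (0\<^sub>m k k)"

(* symp_set p n is Sp(2p,2n), a set of 2n-by-2p matrices. *)
definition symp_set :: "nat \<Rightarrow> nat \<Rightarrow> real mat set" where
  "symp_set p n = {X \<in> carrier_mat (2 * n) (2 * p). X\<^sup>T * symp_J n * X = symp_J p}"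

definition or_symp_set :: "nat \<Rightarrow> real mat set" where
  "or_symp_set p = {T \<in> symp_set p p. T\<^sup>T * T = 1\<^sub>m (2 * p)}"

(* Diag(d_1,...,d_k,d_1,...,d_k); the sequence d is 1-indexed. *)
definition double_diag :: "nat \<Rightarrow> (nat \<Rightarrow> real) \<Rightarrow> real mat" where
  "double_diag k d = mat_diag (2 * k) (\<lambda>i. if i < k then d (i + 1) else d (i - k + 1))"

(* d_1,...,d_n is a listing, with multiplicity, of the symplectic eigenvalues of A.
   By Williamson's theorem one exists for positive definite A, unique up to order. *)
definition symplectic_eigenvalues :: "nat \<Rightarrow> real mat \<Rightarrow> (nat \<Rightarrow> real) \<Rightarrow> bool" where
  "symplectic_eigenvalues n A d \<longleftrightarrow>
     (\<forall>j\<in>{1..n}. 0 < d j) \<and> (\<exists>S\<in>symp_set n n. S\<^sup>T * A * S = double_diag n d)"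

definition column_space :: "real mat \<Rightarrow> real vec set" where
  "column_space X = vec_space.col_space (dim_row X) X"

(* [S_i, S_{i+p}] with i counted from 1, to match the indexing of d. *)
definition col_pair :: "nat \<Rightarrow> real mat \<Rightarrow> nat \<Rightarrow> real mat" where
  "col_pair p S i = mat_of_cols (dim_row S) [col S (i - 1), col S (i - 1 + p)]"

(* The 2p-dimensional spans of p symplectic eigenvector pairs for d_1,...,d_p.
   A single space if d_p < d_{p+1} or p = n, several spaces if d_p = d_{p+1}. *)
definition symplectic_eigenspaces ::
    "nat \<Rightarrow> nat \<Rightarrow> real mat \<Rightarrow> (nat \<Rightarrow> real) \<Rightarrow> real vec set set" where
  "symplectic_eigenspaces n p A d =
     {column_space S | S. S \<in> symp_set p n \<and>
        (\<forall>i\<in>{1..p}. A * col_pair p S i = d i \<cdot>\<^sub>m (symp_J n * col_pair p S i * (symp_J 1)\<^sup>T))}"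

definition cop_objective :: "real mat \<Rightarrow> real mat \<Rightarrow> real" where
  "cop_objective A X = 1 / 2 * mat_trace (X\<^sup>T * A * X)"

definition tpm_objective :: "nat \<Rightarrow> nat \<Rightarrow> real mat \<Rightarrow> real \<Rightarrow> real mat \<Rightarrow> real" where
  "tpm_objective n p A \<beta> X =
     1 / 2 * mat_trace (X\<^sup>T * A * X) +
     \<beta> / 4 * (frobenius_norm (X\<^sup>T * symp_J n * X - symp_J p))\<^sup>2"

definition cop_minimizer :: "nat \<Rightarrow> nat \<Rightarrow> real mat \<Rightarrow> real mat \<Rightarrow> bool" where
  "cop_minimizer n p A X \<longleftrightarrow>
     is_arg_min (cop_objective A)
       (\<lambda>X. X \<in> carrier_mat (2 * n) (2 * p) \<and> X\<^sup>T * symp_J n * X = symp_J p) X"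

definition tpm_minimizer :: "nat \<Rightarrow> nat \<Rightarrow> real mat \<Rightarrow> real \<Rightarrow> real mat \<Rightarrow> bool" where
  "tpm_minimizer n p A \<beta> X \<longleftrightarrow>
     is_arg_min (tpm_objective n p A \<beta>) (\<lambda>X. X \<in> carrier_mat (2 * n) (2 * p)) X"

(* Column spaces are compared as collections, since for d_p = d_{p+1} different
   global minimizers may span different eigenspaces. *)
definition tpm_cop_equivalent ::
    "nat \<Rightarrow> nat \<Rightarrow> real mat \<Rightarrow> (nat \<Rightarrow> real) \<Rightarrow> real \<Rightarrow> bool" where
  "tpm_cop_equivalent n p A d \<beta> \<longleftrightarrow>
     column_space ` Collect (tpm_minimizer n p A \<beta>) = column_space ` Collect (cop_minimizer n p A) \<and>
     column_space ` Collect (tpm_minimizer n p A \<beta>) \<subseteq> symplectic_eigenspaces n p A d"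

end

theory Submission
  imports Defs
begin

text \<open>
  Both problems are solved by finding all critical points that can be global minimisers. Write \<open>J\<close> for
  the symplectic form in either dimension.

  A global minimiser \<open>X\<close> of the penalty problem exists because the objective is continuous and
  dominates a positive definite quadratic form. Its first-order condition is
  \<open>A X = \<beta> J X (M - J)\<close> with \<open>M = X\<^sup>T J X\<close> (\<open>tpm_minimizer_critical\<close>). Hence
  \<open>X\<^sup>T A X = \<beta> M (M - J)\<close>, and the symmetry of the left-hand side forces the skew-symmetric matrix \<open>M\<close>
  to commute with \<open>J\<close>. Thus \<open>M = J H\<close> with \<open>H\<close> symmetric and commuting with \<open>J\<close>. Such an \<open>H\<close>
  is diagonalised by an orthogonal symplectic \<open>T\<close> (\<open>symp_J_commuting_diagonalisation\<close>), since its
  eigenvectors come in pairs \<open>t, J t\<close>. The columns of \<open>X T\<close> are then symplectic eigenvector pairs of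
  \<open>A\<close> for \<open>c\<^sub>i = \<beta> (1 - h\<^sub>i)\<close>, on which the symplectic form takes the values \<open>h\<^sub>i\<close> instead of \<open>1\<close>, and
  the objective is \<open>\<beta> / 2\<close> times the sum of the \<open>1 - h\<^sub>i\<^sup>2\<close>.

  The pairs with \<open>h\<^sub>i > 0\<close> become orthogonal in the coordinates of a Williamson basis, where each of them
  occupies only coordinates with diagonal entry \<open>c\<^sub>i\<close>. Counting dimensions with Bessel's inequality gives
  \<open>d\<^sub>i \<le> c\<^sub>i\<close> when the \<open>c\<^sub>i\<close> are listed in increasing order (\<open>eigenpairs_interlace\<close>). So
  \<open>h\<^sub>i \<le> max 0 (1 - d\<^sub>i / \<beta>)\<close> for a minimiser (\<open>tpm_minimizer_weights\<close>). If \<open>\<beta> > d\<^sub>p\<close>, these bounds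
  are positive and are attained simultaneously by rescaled columns of the Williamson basis, hence by every
  minimiser: \<open>h\<^sub>i = 1 - d\<^sub>i / \<beta>\<close> and \<open>c\<^sub>i = d\<^sub>i\<close> (\<open>tpm_minimizer_form\<close>). Rescaling the columns to \<open>h = 1\<close>
  gives the stated form of \<open>X\<close>. If \<open>\<beta> \<le> d\<^sub>p\<close>, then \<open>h\<^sub>p = 0\<close>, and the column space of a minimiser
  contains no symplectic basis of \<open>p\<close> pairs, so the problems are not equivalent
  (\<open>tpm_column_space_not_eigenspace\<close>).

  The constrained problem is treated as the limit \<open>\<beta> \<rightarrow> \<infinity>\<close>. Feasible points carry no penalty, so the
  minimal values of the penalty problems bound the constrained objective below by the sum of the \<open>d\<^sub>i\<close>
  (\<open>cop_minimum\<close>). With \<open>\<beta> = 1 / s\<^sup>2\<close> for a step of length \<open>s\<close> the same bound shows that the objective is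
  stationary along tangent directions at a minimiser (\<open>cop_minimizer_stationary\<close>). This yields a symmetric
  multiplier, to which the diagonalisation and the interlacing apply again, now with \<open>h = 1\<close>
  (\<open>cop_minimizer_form\<close>). The column spaces of the minimisers of both problems are then exactly the
  symplectic eigenspaces.
\<close>

section \<open>The trace inner product of real matrices\<close>

definition mat_inner :: "real mat \<Rightarrow> real mat \<Rightarrow> real" where
  "mat_inner A B = (\<Sum>i<dim_row A. \<Sum>j<dim_col A. A $$ (i, j) * B $$ (i, j))"

lemma mult_index_sum:
  assumes "i < dim_row A" and "j < dim_col B" and "dim_col A = dim_row B"
  shows "(A * B) $$ (i, j) = (\<Sum>k<dim_row B. A $$ (i, k) * B $$ (k, j))"
  using assms by (simp add: scalar_prod_def atLeast0LessThan)

lemma mult_assoc_dim: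
  "dim_col A = dim_row B \<Longrightarrow> dim_col B = dim_row C \<Longrightarrow> (A * B) * C = A * (B * (C :: real mat))"
  by (rule assoc_mult_mat[of _ "dim_row A" "dim_row B" _ "dim_row C" _ "dim_col C"]) auto

lemma transpose_mult_dim: "dim_col A = dim_row B \<Longrightarrow> (A * B)\<^sup>T = B\<^sup>T * (A\<^sup>T :: real mat)"
  by (rule transpose_mult[of _ "dim_row A" "dim_row B" _ "dim_col B"]) auto

lemma mult_minus_dim:
  "dim_col A = dim_row B \<Longrightarrow> dim_row B = dim_row C \<Longrightarrow> dim_col B = dim_col C \<Longrightarrow>
    A * (B - C) = A * B - A * (C :: real mat)"
  by (rule mult_minus_distrib_mat[of _ "dim_row A" "dim_row B" _ "dim_col B"]) auto

lemma minus_mult_dim: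
  "dim_row A = dim_row B \<Longrightarrow> dim_col A = dim_col B \<Longrightarrow> dim_col A = dim_row C \<Longrightarrow>
    (A - B) * C = A * C - B * (C :: real mat)"
  by (rule minus_mult_distrib_mat[of _ "dim_row A" "dim_row C" _ _ "dim_col C"]) auto

lemma mult_add_dim:
  "dim_col A = dim_row B \<Longrightarrow> dim_row B = dim_row C \<Longrightarrow> dim_col B = dim_col C \<Longrightarrow>
    A * (B + C) = A * B + A * (C :: real mat)"
  by (rule mult_add_distrib_mat[of _ "dim_row A" "dim_row B" _ "dim_col B"]) auto

lemma add_mult_dim:
  "dim_row A = dim_row B \<Longrightarrow> dim_col A = dim_col B \<Longrightarrow> dim_col A = dim_row C \<Longrightarrow>
    (A + B) * C = A * C + B * (C :: real mat)"
  by (rule add_mult_distrib_mat[of _ "dim_row A" "dim_row C" _ _ "dim_col C"]) auto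

lemma smult_mult_dim: "dim_col A = dim_row B \<Longrightarrow> (k \<cdot>\<^sub>m A) * B = k \<cdot>\<^sub>m (A * (B :: real mat))"
  by (rule mult_smult_assoc_mat[of _ "dim_row A" "dim_row B" _ "dim_col B"]) auto

lemma mult_smult_dim: "dim_col A = dim_row B \<Longrightarrow> A * (k \<cdot>\<^sub>m B) = k \<cdot>\<^sub>m (A * (B :: real mat))"
  by (rule mult_smult_distrib[of _ "dim_row A" "dim_row B" _ "dim_col B"]) auto

lemma transpose_add_dim:
  "dim_row A = dim_row B \<Longrightarrow> dim_col A = dim_col B \<Longrightarrow> (A + B)\<^sup>T = A\<^sup>T + (B\<^sup>T :: real mat)"
  by (rule transpose_add[of _ "dim_row A" "dim_col A"]) auto

lemma transpose_minus_dim: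
  "dim_row A = dim_row B \<Longrightarrow> dim_col A = dim_col B \<Longrightarrow> (A - B)\<^sup>T = A\<^sup>T - (B\<^sup>T :: real mat)"
  by (rule transpose_minus[of _ "dim_row A" "dim_col A"]) auto

lemma transpose_smult_real: "(k \<cdot>\<^sub>m A)\<^sup>T = k \<cdot>\<^sub>m (A\<^sup>T :: real mat)"
  by (rule eq_matI) auto

lemma uminus_uminus_real_mat: "- (- A) = (A :: real mat)"
  by (rule eq_matI) auto

text \<open>Rules of matrix algebra whose side conditions are equations between dimensions, so that the
  simplifier can discharge them; \<open>mat_ring\<close> multiplies out, \<open>mat_dist\<close> moves transposes inwards and
  associates products to the right.\<close>

lemmas mat_dist = mult_assoc_dim transpose_mult_dim transpose_add_dim transpose_minus_dim
  transpose_smult_real transpose_uminus uminus_mult_left_mat uminus_mult_right_mat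
  uminus_uminus_real_mat smult_mult_dim mult_smult_dim

lemmas mat_ring = mat_dist mult_minus_dim minus_mult_dim mult_add_dim add_mult_dim

lemma mat_inner_commute:
  "dim_row A = dim_row B \<Longrightarrow> dim_col A = dim_col B \<Longrightarrow> mat_inner A B = mat_inner B A"
  by (simp add: mat_inner_def mult.commute)

lemma mat_inner_add_left:
  "dim_row A = dim_row B \<Longrightarrow> dim_col A = dim_col B \<Longrightarrow>
    mat_inner (A + B) C = mat_inner A C + mat_inner B C"
  by (simp add: mat_inner_def distrib_right sum.distrib)

lemma mat_inner_add_right:
  "dim_row A = dim_row B \<Longrightarrow> dim_col A = dim_col B \<Longrightarrow> dim_row A = dim_row C \<Longrightarrow> dim_col A = dim_col C \<Longrightarrow>
    mat_inner A (B + C) = mat_inner A B + mat_inner A C"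
  by (simp add: mat_inner_def distrib_left sum.distrib)

lemma mat_inner_minus_right:
  "dim_row A = dim_row B \<Longrightarrow> dim_col A = dim_col B \<Longrightarrow> dim_row A = dim_row C \<Longrightarrow> dim_col A = dim_col C \<Longrightarrow>
    mat_inner A (B - C) = mat_inner A B - mat_inner A C"
  by (simp add: mat_inner_def right_diff_distrib sum_subtractf)

lemma mat_inner_smult_left: "mat_inner (k \<cdot>\<^sub>m A) B = k * mat_inner A B"
  by (simp add: mat_inner_def sum_distrib_left mult.assoc)

lemma mat_inner_smult_right:
  "dim_row A = dim_row B \<Longrightarrow> dim_col A = dim_col B \<Longrightarrow> mat_inner A (k \<cdot>\<^sub>m B) = k * mat_inner A B"
  by (simp add: mat_inner_def sum_distrib_left mult.left_commute)

lemma mat_inner_uminus_right: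
  "dim_row A = dim_row B \<Longrightarrow> dim_col A = dim_col B \<Longrightarrow> mat_inner A (- B) = - mat_inner A B"
  by (simp add: mat_inner_def sum_negf)

lemma mat_inner_uminus_left: "mat_inner (- A) B = - mat_inner A B"
  by (simp add: mat_inner_def sum_negf)

lemmas mat_inner_linear = mat_inner_add_left mat_inner_add_right mat_inner_minus_right
  mat_inner_smult_left mat_inner_smult_right mat_inner_uminus_right mat_inner_uminus_left

lemma mat_inner_transpose:
  "dim_row A = dim_row B \<Longrightarrow> dim_col A = dim_col B \<Longrightarrow> mat_inner A\<^sup>T B\<^sup>T = mat_inner A B"
  unfolding mat_inner_def by (subst sum.swap) simp

text \<open>Left and right multiplication have the transposed multiplications as adjoints.\<close>

lemma mat_inner_mult_left:
  assumes "dim_col A = dim_row B" and "dim_row C = dim_row A" and "dim_col C = dim_col B"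
  shows "mat_inner (A * B) C = mat_inner B (A\<^sup>T * C)"
proof -
  have "mat_inner (A * B) C =
      (\<Sum>i<dim_row A. \<Sum>j<dim_col B. \<Sum>k<dim_row B. A $$ (i, k) * B $$ (k, j) * C $$ (i, j))"
    using assms by (simp add: mat_inner_def mult_index_sum sum_distrib_right del: index_mult_mat(1))
  also have "\<dots> = (\<Sum>j<dim_col B. \<Sum>i<dim_row A. \<Sum>k<dim_row B. A $$ (i, k) * B $$ (k, j) * C $$ (i, j))"
    by (rule sum.swap)
  also have "\<dots> = (\<Sum>j<dim_col B. \<Sum>k<dim_row B. \<Sum>i<dim_row A. A $$ (i, k) * B $$ (k, j) * C $$ (i, j))"
    by (rule sum.cong[OF refl], rule sum.swap)
  also have "\<dots> = (\<Sum>k<dim_row B. \<Sum>j<dim_col B. \<Sum>i<dim_row A. A $$ (i, k) * B $$ (k, j) * C $$ (i, j))"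
    by (rule sum.swap)
  also have "\<dots> = mat_inner B (A\<^sup>T * C)"
    using assms
    by (simp add: mat_inner_def mult_index_sum sum_distrib_left mult_ac del: index_mult_mat(1))
  finally show ?thesis .
qed

lemma mat_inner_mult_right:
  assumes "dim_col A = dim_row B" and "dim_row C = dim_row A" and "dim_col C = dim_col B"
  shows "mat_inner (A * B) C = mat_inner A (C * B\<^sup>T)"
proof -
  have "mat_inner (A * B) C = mat_inner (B\<^sup>T * A\<^sup>T) C\<^sup>T"
    using assms by (simp add: mat_inner_transpose flip: transpose_mult_dim)
  also have "\<dots> = mat_inner A\<^sup>T (B * C\<^sup>T)"
    using assms by (simp add: mat_inner_mult_left)
  also have "B * C\<^sup>T = (C * B\<^sup>T)\<^sup>T"
    using assms by (simp add: mat_dist)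
  finally show ?thesis
    using assms by (simp add: mat_inner_transpose)
qed

lemma mat_inner_self_eq_0:
  assumes "mat_inner A A = 0"
  shows "A = 0\<^sub>m (dim_row A) (dim_col A)"
proof (rule eq_matI)
  fix i j assume ij: "i < dim_row (0\<^sub>m (dim_row A) (dim_col A))" "j < dim_col (0\<^sub>m (dim_row A) (dim_col A))"
  have "(\<Sum>j<dim_col A. A $$ (i, j) * A $$ (i, j)) = 0"
    using assms ij unfolding mat_inner_def
    by (subst (asm) sum_nonneg_eq_0_iff) (auto simp: sum_nonneg)
  then have "A $$ (i, j) * A $$ (i, j) = 0"
    using ij by (subst (asm) sum_nonneg_eq_0_iff) auto
  then show "A $$ (i, j) = 0\<^sub>m (dim_row A) (dim_col A) $$ (i, j)"
    using ij by simp
qed simp_all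

lemma mat_trace_transpose_mult:
  "dim_row A = dim_row B \<Longrightarrow> dim_col A = dim_col B \<Longrightarrow> mat_trace (A\<^sup>T * B) = mat_inner A B"
  unfolding mat_trace_def mat_inner_def
  by (subst sum.swap) (simp add: mult_index_sum del: index_mult_mat(1))

lemma frobenius_norm_square: "(frobenius_norm A)\<^sup>2 = mat_inner A A"
  unfolding frobenius_norm_def mat_inner_def
  by (subst real_sqrt_pow2) (auto simp: power2_eq_square intro!: sum_nonneg)

lemma cop_objective_inner:
  assumes "A \<in> carrier_mat m m" and "X \<in> carrier_mat m q"
  shows "cop_objective A X = 1 / 2 * mat_inner X (A * X)"
  using assms by (simp add: cop_objective_def mult_assoc_dim mat_trace_transpose_mult)

lemma tpm_objective_inner:
  assumes "A \<in> carrier_mat (2 * n) (2 * n)" and "X \<in> carrier_mat (2 * n) (2 * p)"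
  shows "tpm_objective n p A \<beta> X = 1 / 2 * mat_inner X (A * X) +
    \<beta> / 4 * mat_inner (X\<^sup>T * symp_J n * X - symp_J p) (X\<^sup>T * symp_J n * X - symp_J p)"
  using assms
  by (simp add: tpm_objective_def frobenius_norm_square mult_assoc_dim mat_trace_transpose_mult)


section \<open>The symplectic form and doubled diagonal matrices\<close>

lemma symp_J_dim [simp]: "dim_row (symp_J k) = 2 * k" "dim_col (symp_J k) = 2 * k"
  by (simp_all add: symp_J_def)

lemma symp_J_carrier [simp]: "symp_J k \<in> carrier_mat (2 * k) (2 * k)"
  by (rule carrier_matI) simp_all

lemma symp_J_index:
  "i < 2 * k \<Longrightarrow> j < 2 * k \<Longrightarrow>
    symp_J k $$ (i, j) = (if j = i + k then 1 else if i = j + k then -1 else 0)"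
  by (auto simp: symp_J_def)

lemma symp_J_transpose: "(symp_J k)\<^sup>T = - symp_J k"
  by (rule eq_matI) (auto simp: symp_J_index)

text \<open>\<open>J\<close> pairs coordinate \<open>i\<close> with coordinate \<open>conj_index k i\<close>: left multiplication by \<open>J\<close>
  permutes the rows of a matrix accordingly, up to the signs \<open>conj_sign\<close>.\<close>

definition conj_index :: "nat \<Rightarrow> nat \<Rightarrow> nat" where
  "conj_index k i = (if i < k then i + k else i - k)"

definition conj_sign :: "nat \<Rightarrow> nat \<Rightarrow> real" where
  "conj_sign k i = (if i < k then 1 else -1)"

lemma symp_J_mult_index:
  assumes "dim_row B = 2 * k" and "i < 2 * k" and "j < dim_col B"
  shows "(symp_J k * B) $$ (i, j) = conj_sign k i * B $$ (conj_index k i, j)"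
proof -
  have "(symp_J k * B) $$ (i, j) = (\<Sum>l<2 * k. symp_J k $$ (i, l) * B $$ (l, j))"
    using assms by (simp add: mult_index_sum del: index_mult_mat(1))
  also have "\<dots> = (\<Sum>l<2 * k. if l = conj_index k i then conj_sign k i * B $$ (l, j) else 0)"
    using assms by (intro sum.cong) (auto simp: symp_J_index conj_index_def conj_sign_def)
  also have "\<dots> = conj_sign k i * B $$ (conj_index k i, j)"
    using assms by (auto simp: conj_index_def)
  finally show ?thesis .
qed

lemma mult_symp_J_index:
  assumes "dim_col B = 2 * k" and "i < dim_row B" and "j < 2 * k"
  shows "(B * symp_J k) $$ (i, j) = - conj_sign k j * B $$ (i, conj_index k j)"
proof -
  have "(B * symp_J k) $$ (i, j) = ((B * symp_J k)\<^sup>T) $$ (j, i)"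
    using assms by simp
  also have "(B * symp_J k)\<^sup>T = - (symp_J k * B\<^sup>T)"
    using assms by (simp add: mat_dist symp_J_transpose)
  finally show ?thesis
    using assms by (simp add: symp_J_mult_index conj_index_def del: index_mult_mat(1))
qed

lemma symp_J_square: "symp_J k * symp_J k = - 1\<^sub>m (2 * k)"
  by (rule eq_matI)
    (auto simp: symp_J_mult_index symp_J_index conj_index_def conj_sign_def simp del: index_mult_mat(1))

lemma symp_J_symp_J_mult: "dim_row B = 2 * k \<Longrightarrow> symp_J k * (symp_J k * B) = - B"
  by (simp add: symp_J_square flip: mult_assoc_dim)

text \<open>The diagonal of \<open>double_diag k c\<close>, with rows and columns counted from zero.\<close>

definition dbl :: "nat \<Rightarrow> (nat \<Rightarrow> real) \<Rightarrow> nat \<Rightarrow> real" where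
  "dbl k c i = (if i < k then c (i + 1) else c (i - k + 1))"

lemma double_diag_dim [simp]: "dim_row (double_diag k c) = 2 * k" "dim_col (double_diag k c) = 2 * k"
  by (simp_all add: double_diag_def mat_diag_def)

lemma double_diag_carrier [simp]: "double_diag k c \<in> carrier_mat (2 * k) (2 * k)"
  by (rule carrier_matI) simp_all

lemma double_diag_index:
  "i < 2 * k \<Longrightarrow> j < 2 * k \<Longrightarrow> double_diag k c $$ (i, j) = (if i = j then dbl k c j else 0)"
  by (simp add: double_diag_def mat_diag_def dbl_def)

lemma double_diag_mult_index:
  assumes "dim_row B = 2 * k" and "i < 2 * k" and "j < dim_col B"
  shows "(double_diag k c * B) $$ (i, j) = dbl k c i * B $$ (i, j)"
  unfolding double_diag_def
  by (subst mat_diag_mult_left[where nr = "dim_col B"]) (use assms in \<open>auto simp: dbl_def\<close>)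

lemma mult_double_diag_index:
  assumes "dim_col B = 2 * k" and "i < dim_row B" and "j < 2 * k"
  shows "(B * double_diag k c) $$ (i, j) = B $$ (i, j) * dbl k c j"
  unfolding double_diag_def
  by (subst mat_diag_mult_right[where nr = "dim_row B"]) (use assms in \<open>auto simp: dbl_def\<close>)

lemma double_diag_mult: "double_diag k c * double_diag k h = double_diag k (\<lambda>i. c i * h i)"
  by (rule eq_matI)
    (auto simp: double_diag_mult_index double_diag_index dbl_def simp del: index_mult_mat(1))

lemma double_diag_transpose: "(double_diag k c)\<^sup>T = double_diag k c"
  by (rule eq_matI) (auto simp: double_diag_index)

lemma double_diag_one: "double_diag k (\<lambda>_. 1) = 1\<^sub>m (2 * k)"
  by (rule eq_matI) (auto simp: double_diag_index dbl_def)

lemma double_diag_diff: "double_diag k c - double_diag k h = double_diag k (\<lambda>i. c i - h i)"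
  by (rule eq_matI) (auto simp: double_diag_index dbl_def)

lemma double_diag_smult: "a \<cdot>\<^sub>m double_diag k c = double_diag k (\<lambda>i. a * c i)"
  by (rule eq_matI) (auto simp: double_diag_index dbl_def)

lemma double_diag_cong: "(\<And>i. i \<in> {1..k} \<Longrightarrow> c i = h i) \<Longrightarrow> double_diag k c = double_diag k h"
  by (rule eq_matI) (auto simp: double_diag_index dbl_def)

lemma double_diag_symp_J: "double_diag k c * symp_J k = symp_J k * double_diag k c"
  by (rule eq_matI)
    (auto simp: double_diag_mult_index mult_double_diag_index symp_J_index dbl_def
      simp del: index_mult_mat(1))

lemma double_diag_symp_J_mult:
  "dim_row B = 2 * k \<Longrightarrow> double_diag k c * (symp_J k * B) = symp_J k * (double_diag k c * B)"
  by (simp add: double_diag_symp_J flip: mult_assoc_dim) 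

lemma dbl_mult: "dbl k (\<lambda>i. c i * h i) i = dbl k c i * dbl k h i"
  by (simp add: dbl_def)

lemma sum_dbl: "(\<Sum>i<2 * k. dbl k c i) = 2 * (\<Sum>i=1..k. c i)"
proof -
  have "(\<Sum>i<2 * k. dbl k c i) = (\<Sum>i<k + k. dbl k c i)"
    by (simp add: mult_2)
  also have "\<dots> = (\<Sum>i<k. dbl k c i) + (\<Sum>i<k. dbl k c (i + k))"
    by (simp add: lessThan_atLeast0 sum.atLeastLessThan_concat[of 0 k "k + k", symmetric]
        sum.shift_bounds_nat_ivl[of _ 0 k k, simplified])
  also have "\<dots> = 2 * (\<Sum>i<k. c (i + 1))"
    by (simp add: dbl_def)
  also have "(\<Sum>i<k. c (i + 1)) = (\<Sum>i=1..k. c i)"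
    by (simp add: sum.atLeast1_atMost_eq)
  finally show ?thesis .
qed

lemma mat_inner_double_diag:
  "mat_inner (double_diag k c) (double_diag k h) = 2 * (\<Sum>i=1..k. c i * h i)"
proof -
  have "mat_inner (double_diag k c) (double_diag k h) = (\<Sum>i<2 * k. dbl k (\<lambda>i. c i * h i) i)"
    by (simp add: mat_inner_def double_diag_index dbl_mult if_distrib if_distribR cong: if_cong)
  then show ?thesis
    by (simp add: sum_dbl)
qed

section \<open>Attainment of minima in finitely many real coordinates\<close>

text \<open>Bolzano-Weierstrass in finitely many coordinates, passing to a monotone subsequence for one
  coordinate after the other.\<close>

lemma bounded_coordinates_subseq:
  fixes x :: "nat \<Rightarrow> 'i \<Rightarrow> real"
  assumes "finite I" and "\<And>i k. i \<in> I \<Longrightarrow> \<bar>x k i\<bar> \<le> B"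
  shows "\<exists>\<phi> l. strict_mono (\<phi> :: nat \<Rightarrow> nat) \<and> (\<forall>i\<in>I. (\<lambda>k. x (\<phi> k) i) \<longlonglongrightarrow> l i)"
  using assms
proof (induction I rule: finite_induct)
  case empty
  show ?case
    by (intro exI[of _ id]) (auto simp: strict_mono_def)
next
  case (insert a F)
  then obtain \<phi> l where \<phi>: "strict_mono (\<phi> :: nat \<Rightarrow> nat)"
    and l: "\<forall>i\<in>F. (\<lambda>k. x (\<phi> k) i) \<longlonglongrightarrow> l i"
    by (metis insertCI)
  obtain \<psi> where \<psi>: "strict_mono (\<psi> :: nat \<Rightarrow> nat)" and mono: "monoseq (\<lambda>k. x (\<phi> (\<psi> k)) a)"
    using seq_monosub[of "\<lambda>k. x (\<phi> k) a"] by auto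
  have "Bseq (\<lambda>k. x (\<phi> (\<psi> k)) a)"
    by (rule BseqI'[of _ B]) (use insert.prems in auto)
  then obtain m where m: "(\<lambda>k. x (\<phi> (\<psi> k)) a) \<longlonglongrightarrow> m"
    using Bseq_monoseq_convergent[OF _ mono] by (auto simp: convergent_def)
  have "(\<lambda>k. x (\<phi> (\<psi> k)) i) \<longlonglongrightarrow> l i" if "i \<in> F" for i
    using LIMSEQ_subseq_LIMSEQ[OF _ \<psi>, of "\<lambda>k. x (\<phi> k) i"] l that by (auto simp: o_def)
  then have "\<forall>i\<in>insert a F. (\<lambda>k. x ((\<phi> \<circ> \<psi>) k) i) \<longlonglongrightarrow> (l(a := m)) i"
    using m insert.hyps by auto
  moreover have "strict_mono (\<phi> \<circ> \<psi>)"
    by (rule strict_mono_o) (use \<phi> \<psi> in auto)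
  ultimately show ?case by blast
qed

text \<open>Compactness is used through the entries of matrices and vectors: a point is a function, of which
  only the finitely many coordinates in \<open>I\<close> matter to \<open>C\<close> and \<open>f\<close> by the closedness and
  continuity assumptions.\<close>

lemma minimum_attained:
  fixes f :: "('i \<Rightarrow> real) \<Rightarrow> real"
  assumes "finite I" and "x0 \<in> C"
    and lower: "\<And>x. x \<in> C \<Longrightarrow> b \<le> f x"
    and bounded: "\<And>x i. x \<in> C \<Longrightarrow> f x \<le> f x0 + 1 \<Longrightarrow> i \<in> I \<Longrightarrow> \<bar>x i\<bar> \<le> B"
    and closed: "\<And>x l. (\<And>k. x k \<in> C) \<Longrightarrow> (\<And>i. i \<in> I \<Longrightarrow> (\<lambda>k. x k i) \<longlonglongrightarrow> l i) \<Longrightarrow> l \<in> C"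
    and cont: "\<And>x l. (\<And>i. i \<in> I \<Longrightarrow> (\<lambda>k. x k i) \<longlonglongrightarrow> l i) \<Longrightarrow> (\<lambda>k. f (x k)) \<longlonglongrightarrow> f l"
  shows "\<exists>x\<in>C. \<forall>y\<in>C. f x \<le> f y"
proof -
  define m where "m = Inf (f ` C)"
  have bdd: "bdd_below (f ` C)"
    using lower by (auto simp: bdd_below_def)
  have m_le: "m \<le> f y" if "y \<in> C" for y
    unfolding m_def using bdd that by (intro cInf_lower) auto
  have "\<exists>y\<in>C. f y < m + inverse (real (Suc k))" for k
  proof -
    have "m < m + inverse (real (Suc k))" by simp
    then show ?thesis
      unfolding m_def using assms(2) bdd by (subst (asm) cInf_less_iff) auto
  qed
  then obtain x where x: "\<And>k. x k \<in> C" "\<And>k. f (x k) < m + inverse (real (Suc k))"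
    by metis
  have "f (x k) \<le> f x0 + 1" for k
  proof -
    have "inverse (real (Suc k)) \<le> 1"
      by (simp add: inverse_le_1_iff)
    then show ?thesis
      using x(2)[of k] m_le[OF assms(2)] by linarith
  qed
  then have bd: "\<And>i k. i \<in> I \<Longrightarrow> \<bar>x k i\<bar> \<le> B"
    using bounded x(1) by blast
  obtain \<phi> l where \<phi>: "strict_mono (\<phi> :: nat \<Rightarrow> nat)"
    and l: "\<And>i. i \<in> I \<Longrightarrow> (\<lambda>k. x (\<phi> k) i) \<longlonglongrightarrow> l i"
    using bounded_coordinates_subseq[of I x B, OF assms(1) bd] by blast
  have "l \<in> C"
    using closed[of "\<lambda>k. x (\<phi> k)"] x(1) l by blast
  moreover have "(\<lambda>k. f (x (\<phi> k))) \<longlonglongrightarrow> f l"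
    using l by (rule cont)
  moreover have "(\<lambda>k. m + inverse (real (Suc (\<phi> k)))) \<longlonglongrightarrow> m"
  proof -
    have "(\<lambda>k. m + inverse (real (Suc k))) \<longlonglongrightarrow> m + 0"
      by (intro tendsto_intros LIMSEQ_inverse_real_of_nat)
    from LIMSEQ_subseq_LIMSEQ[OF this \<phi>] show ?thesis by (simp add: o_def)
  qed
  ultimately have "f l \<le> m"
    using LIMSEQ_le[of "\<lambda>k. f (x (\<phi> k))" "f l"] x(2) less_imp_le by blast
  then show ?thesis
    using \<open>l \<in> C\<close> m_le by (meson order_trans)
qed


section \<open>Symmetric matrices commuting with \<open>J\<close>\<close>

text \<open>Projecting a unit vector onto an orthonormal family leaves a residual. That its squared norm is
  nonnegative is Bessel's inequality; that it is nonzero for some unit vector, when the family is too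
  small to span, gives a vector orthogonal to the family.\<close>

lemma unit_vector_residual:
  fixes q :: "'k \<Rightarrow> 'l \<Rightarrow> real"
  assumes "finite K" and "finite L" and "l \<in> L"
    and orth: "\<And>k k'. k \<in> K \<Longrightarrow> k' \<in> K \<Longrightarrow> (\<Sum>j\<in>L. q k j * q k' j) = (if k = k' then 1 else 0)"
  defines "r \<equiv> \<lambda>j. (if j = l then 1 else 0) - (\<Sum>k\<in>K. q k l * q k j)"
  shows "k \<in> K \<Longrightarrow> (\<Sum>j\<in>L. r j * q k j) = 0"
    and "(\<Sum>j\<in>L. r j * r j) = 1 - (\<Sum>k\<in>K. (q k l)\<^sup>2)"
proof -
  have delta: "(\<Sum>j\<in>L. (if j = l then 1 else 0) * a j) = a l" for a :: "'l \<Rightarrow> real"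
    using assms(2,3) by (simp add: if_distribR[of _ "(*) 1"] if_distrib[of "\<lambda>t. t * _"] cong: if_cong)
  show perp: "(\<Sum>j\<in>L. r j * q k j) = 0" if "k \<in> K" for k
  proof -
    have "(\<Sum>j\<in>L. r j * q k j) =
        (\<Sum>j\<in>L. (if j = l then 1 else 0) * q k j) - (\<Sum>j\<in>L. \<Sum>k'\<in>K. q k' l * (q k' j * q k j))"
      unfolding r_def left_diff_distrib sum_subtractf by (simp only: sum_distrib_right mult.assoc)
    also have "(\<Sum>j\<in>L. \<Sum>k'\<in>K. q k' l * (q k' j * q k j)) =
        (\<Sum>k'\<in>K. q k' l * (\<Sum>j\<in>L. q k' j * q k j))"
      by (subst sum.swap) (simp add: sum_distrib_left)
    also have "\<dots> = (\<Sum>k'\<in>K. if k' = k then q k' l else 0)"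
      using that by (intro sum.cong) (auto simp: orth)
    finally show ?thesis
      using assms(1) that by (simp add: delta)
  qed
  have "(\<Sum>j\<in>L. r j * r j) = (\<Sum>j\<in>L. (if j = l then 1 else 0) * r j - (\<Sum>k\<in>K. q k l * q k j) * r j)"
    by (intro sum.cong refl) (simp only: r_def left_diff_distrib)
  also have "\<dots> = r l - (\<Sum>j\<in>L. \<Sum>k\<in>K. q k l * (r j * q k j))"
    unfolding sum_subtractf delta by (simp add: sum_distrib_left mult_ac)
  also have "(\<Sum>j\<in>L. \<Sum>k\<in>K. q k l * (r j * q k j)) = (\<Sum>k\<in>K. q k l * (\<Sum>j\<in>L. r j * q k j))"
    by (subst sum.swap) (simp add: sum_distrib_left)
  also have "\<dots> = 0"
    using perp by simp
  finally show "(\<Sum>j\<in>L. r j * r j) = 1 - (\<Sum>k\<in>K. (q k l)\<^sup>2)"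
    by (simp add: r_def power2_eq_square)
qed

lemma bessel_unit_vector:
  fixes q :: "'k \<Rightarrow> 'l \<Rightarrow> real"
  assumes "finite K" and "finite L" and "l \<in> L"
    and "\<And>k k'. k \<in> K \<Longrightarrow> k' \<in> K \<Longrightarrow> (\<Sum>j\<in>L. q k j * q k' j) = (if k = k' then 1 else 0)"
  shows "(\<Sum>k\<in>K. (q k l)\<^sup>2) \<le> 1"
proof -
  have "0 \<le> 1 - (\<Sum>k\<in>K. (q k l)\<^sup>2)"
    by (subst unit_vector_residual(2)[OF assms, symmetric]) (auto intro: sum_nonneg)
  then show ?thesis by simp
qed

lemma orthonormal_sum_squares:
  fixes q :: "'k \<Rightarrow> 'l \<Rightarrow> real"
  assumes "\<And>k k'. k \<in> K \<Longrightarrow> k' \<in> K \<Longrightarrow> (\<Sum>j\<in>L. q k j * q k' j) = (if k = k' then 1 else 0)"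
  shows "(\<Sum>l\<in>L. \<Sum>k\<in>K. (q k l)\<^sup>2) = real (card K)"
proof -
  have "(\<Sum>l\<in>L. \<Sum>k\<in>K. (q k l)\<^sup>2) = (\<Sum>k\<in>K. \<Sum>l\<in>L. q k l * q k l)"
    by (subst sum.swap) (simp add: power2_eq_square)
  also have "\<dots> = (\<Sum>k\<in>K. 1)"
    using assms by (intro sum.cong) auto
  finally show ?thesis by simp
qed

lemma orthonormal_card_le:
  fixes q :: "'k \<Rightarrow> 'l \<Rightarrow> real"
  assumes "finite K" and "finite L"
    and "\<And>k k'. k \<in> K \<Longrightarrow> k' \<in> K \<Longrightarrow> (\<Sum>j\<in>L. q k j * q k' j) = (if k = k' then 1 else 0)"
  shows "card K \<le> card L"
proof -
  have "real (card K) = (\<Sum>l\<in>L. \<Sum>k\<in>K. (q k l)\<^sup>2)"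
    using orthonormal_sum_squares[OF assms(3)] by simp
  also have "\<dots> \<le> (\<Sum>l\<in>L. 1)"
    using bessel_unit_vector[OF assms(1,2) _ assms(3)] by (intro sum_mono) auto
  finally show ?thesis by simp
qed

lemma orthonormal_complement_nonzero:
  fixes q :: "'k \<Rightarrow> 'l \<Rightarrow> real"
  assumes "finite K" and "finite L" and "card K < card L"
    and orth: "\<And>k k'. k \<in> K \<Longrightarrow> k' \<in> K \<Longrightarrow> (\<Sum>j\<in>L. q k j * q k' j) = (if k = k' then 1 else 0)"
  shows "\<exists>r. (\<forall>k\<in>K. (\<Sum>j\<in>L. r j * q k j) = 0) \<and> (\<Sum>j\<in>L. r j * r j) > 0"
proof -
  have "\<exists>l\<in>L. (\<Sum>k\<in>K. (q k l)\<^sup>2) < 1"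
  proof (rule ccontr)
    assume "\<not> ?thesis"
    then have "(\<Sum>l\<in>L. 1) \<le> (\<Sum>l\<in>L. \<Sum>k\<in>K. (q k l)\<^sup>2)"
      by (intro sum_mono) auto
    then show False
      using orthonormal_sum_squares[OF orth] assms(3) by simp
  qed
  then obtain l where l: "l \<in> L" "(\<Sum>k\<in>K. (q k l)\<^sup>2) < 1" by blast
  show ?thesis
    using unit_vector_residual[OF assms(1,2) l(1) orth] l(2)
    by (intro exI[of _ "\<lambda>j. (if j = l then 1 else 0) - (\<Sum>k\<in>K. q k l * q k j)"]) auto
qed

lemma symmetric_scalar_prod:
  fixes G :: "real mat"
  assumes "G \<in> carrier_mat m m" and "G\<^sup>T = G" and "u \<in> carrier_vec m" and "v \<in> carrier_vec m"
  shows "(G *\<^sub>v u) \<bullet> v = u \<bullet> (G *\<^sub>v v)"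
  using transpose_vec_mult_scalar[of G m m v u] assms by simp

lemma linear_term_zero:
  fixes a b \<delta> :: real
  assumes "0 < \<delta>" and nonneg: "\<And>s. s \<noteq> 0 \<Longrightarrow> \<bar>s\<bar> \<le> \<delta> \<Longrightarrow> 0 \<le> a * s + b * s\<^sup>2"
  shows "a = 0"
proof (rule ccontr)
  assume a: "a \<noteq> 0"
  define d where "d = \<bar>b\<bar> + 1"
  have d: "0 < d" "b \<le> d" by (auto simp: d_def)
  define r where "r = min \<delta> (\<bar>a\<bar> / (2 * d))"
  have r: "0 < r" "r \<le> \<delta>" "r \<le> \<bar>a\<bar> / (2 * d)"
    using a d assms(1) by (auto simp: r_def)
  have "0 \<le> a * (- sgn a * r) + b * (- sgn a * r)\<^sup>2"
    using r a by (intro nonneg) (auto simp: abs_mult sgn_if)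
  also have "\<dots> = - \<bar>a\<bar> * r + b * r\<^sup>2"
    using a by (simp add: sgn_if power2_eq_square)
  also have "\<dots> \<le> - \<bar>a\<bar> * r + d * r\<^sup>2"
    using d by (simp add: mult_right_mono)
  also have "\<dots> = r * (d * r - \<bar>a\<bar>)"
    by (simp add: power2_eq_square algebra_simps)
  also have "\<dots> < 0"
  proof (rule mult_pos_neg)
    have "d * r \<le> \<bar>a\<bar> / 2"
      using r(3) d by (simp add: field_simps)
    then show "d * r - \<bar>a\<bar> < 0"
      using a by linarith
  qed (rule r(1))
  finally show False by simp
qed

text \<open>Let \<open>v\<close> minimise the Rayleigh quotient over an invariant subspace, given here as the orthogonal
  complement of a family \<open>w\<close>, and let \<open>\<mu>\<close> be the minimum. The residual \<open>G v - \<mu> v\<close> lies in the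
  subspace and is orthogonal to \<open>v\<close>. Along it the quotient has slope twice the squared norm of the
  residual, which must therefore vanish.\<close>

lemma constrained_eigenvector:
  fixes G :: "real mat" and w :: "'k \<Rightarrow> real vec"
  assumes G: "G \<in> carrier_mat m m" "G\<^sup>T = G" and w: "\<And>k. k \<in> K \<Longrightarrow> w k \<in> carrier_vec m"
    and v0: "v0 \<in> carrier_vec m" "v0 \<bullet> v0 = 1" "\<And>k. k \<in> K \<Longrightarrow> v0 \<bullet> w k = 0"
    and inv: "\<And>v k. v \<in> carrier_vec m \<Longrightarrow> (\<And>k. k \<in> K \<Longrightarrow> v \<bullet> w k = 0) \<Longrightarrow> k \<in> K \<Longrightarrow> (G *\<^sub>v v) \<bullet> w k = 0"
  shows "\<exists>v \<mu>. v \<in> carrier_vec m \<and> v \<bullet> v = 1 \<and> (\<forall>k\<in>K. v \<bullet> w k = 0) \<and> G *\<^sub>v v = \<mu> \<cdot>\<^sub>v v \<and>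
    (\<forall>u\<in>carrier_vec m. (\<forall>k\<in>K. u \<bullet> w k = 0) \<longrightarrow> \<mu> * (u \<bullet> u) \<le> u \<bullet> (G *\<^sub>v u))"
proof -
  define C where "C = {x. vec m x \<bullet> vec m x = (1::real) \<and> (\<forall>k\<in>K. vec m x \<bullet> w k = 0)}"
  define f where "f x = vec m x \<bullet> (G *\<^sub>v vec m x)" for x
  have f_sum: "f x = (\<Sum>i<m. \<Sum>j<m. x i * (G $$ (i, j) * x j))" for x
    using G by (simp add: f_def scalar_prod_def sum_distrib_left atLeast0LessThan)
  have sq: "vec m x \<bullet> vec m x = (\<Sum>i<m. (x i)\<^sup>2)" for x :: "nat \<Rightarrow> real"
    by (auto simp: scalar_prod_def power2_eq_square atLeast0LessThan intro!: sum.cong)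
  have vec_id: "vec m (\<lambda>i. v $ i) = v" if "v \<in> carrier_vec m" for v :: "real vec"
    using that by auto
  have entry: "\<bar>x i\<bar> \<le> 1" if "x \<in> C" "i < m" for x i
  proof -
    have "(x i)\<^sup>2 \<le> (\<Sum>i<m. (x i)\<^sup>2)"
      using that by (intro member_le_sum) auto
    then show ?thesis
      using that by (simp add: C_def sq abs_square_le_1)
  qed
  have "\<exists>x\<in>C. \<forall>y\<in>C. f x \<le> f y"
  proof (rule minimum_attained[where I = "{..<m}" and B = 1 and b = "- (\<Sum>i<m. \<Sum>j<m. \<bar>G $$ (i, j)\<bar>)"])
    show "(\<lambda>i. v0 $ i) \<in> C"
      using v0 by (simp add: C_def vec_id)
    fix x assume x: "x \<in> C"
    have "x i * (G $$ (i, j) * x j) \<ge> - \<bar>G $$ (i, j)\<bar>" if "i < m" "j < m" for i j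
    proof -
      have "\<bar>x i\<bar> * \<bar>x j\<bar> \<le> 1"
        using entry[OF x] that by (intro mult_le_one) auto
      then have "\<bar>G $$ (i, j)\<bar> * (\<bar>x i\<bar> * \<bar>x j\<bar>) \<le> \<bar>G $$ (i, j)\<bar>"
        by (rule mult_left_le) simp
      moreover have "\<bar>x i * (G $$ (i, j) * x j)\<bar> = \<bar>G $$ (i, j)\<bar> * (\<bar>x i\<bar> * \<bar>x j\<bar>)"
        by (simp add: abs_mult)
      ultimately show ?thesis by linarith
    qed
    then show "- (\<Sum>i<m. \<Sum>j<m. \<bar>G $$ (i, j)\<bar>) \<le> f x"
      unfolding f_sum sum_negf[symmetric] by (intro sum_mono) auto
  next
    fix x :: "nat \<Rightarrow> nat \<Rightarrow> real" and l assume x: "\<And>k. x k \<in> C" and lim: "\<And>i. i \<in> {..<m} \<Longrightarrow> (\<lambda>k. x k i) \<longlonglongrightarrow> l i"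
    have "(\<lambda>k. \<Sum>i<m. (x k i)\<^sup>2) \<longlonglongrightarrow> (\<Sum>i<m. (l i)\<^sup>2)"
      by (intro tendsto_intros lim) auto
    then have "(\<lambda>k. 1) \<longlonglongrightarrow> (\<Sum>i<m. (l i)\<^sup>2)"
      using x by (simp add: C_def sq)
    then have 1: "(\<Sum>i<m. (l i)\<^sup>2) = 1"
      by (simp add: LIMSEQ_const_iff)
    have "vec m l \<bullet> w k = 0" if k: "k \<in> K" for k
    proof -
      have prod: "vec m x \<bullet> w k = (\<Sum>i<m. x i * w k $ i)" for x :: "nat \<Rightarrow> real"
        using w[OF k] by (simp add: scalar_prod_def atLeast0LessThan)
      have "(\<lambda>j. \<Sum>i<m. x j i * w k $ i) \<longlonglongrightarrow> (\<Sum>i<m. l i * w k $ i)"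
        by (intro tendsto_intros lim) auto
      moreover have "(\<Sum>i<m. x j i * w k $ i) = 0" for j
        using x[of j] k by (simp add: C_def flip: prod)
      ultimately have "(\<lambda>j. 0) \<longlonglongrightarrow> (\<Sum>i<m. l i * w k $ i)"
        by simp
      then show ?thesis
        by (simp add: LIMSEQ_const_iff prod)
    qed
    with 1 show "l \<in> C"
      by (simp add: C_def sq)
  next
    fix x :: "nat \<Rightarrow> nat \<Rightarrow> real" and l assume lim: "\<And>i. i \<in> {..<m} \<Longrightarrow> (\<lambda>k. x k i) \<longlonglongrightarrow> l i"
    show "(\<lambda>k. f (x k)) \<longlonglongrightarrow> f l"
      unfolding f_sum by (intro tendsto_intros lim) auto
  qed (use entry in auto)
  then obtain x where x: "x \<in> C" and min: "\<And>y. y \<in> C \<Longrightarrow> f x \<le> f y" by blast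
  define v where "v = vec m x"
  define \<mu> where "\<mu> = f x"
  have v: "v \<in> carrier_vec m" "v \<bullet> v = 1" "\<And>k. k \<in> K \<Longrightarrow> v \<bullet> w k = 0"
    using x by (auto simp: v_def C_def)
  have ray: "\<mu> * (u \<bullet> u) \<le> u \<bullet> (G *\<^sub>v u)"
    if u: "u \<in> carrier_vec m" "\<And>k. k \<in> K \<Longrightarrow> u \<bullet> w k = 0" for u
  proof (cases "u \<bullet> u = 0")
    case True
    then have "u = 0\<^sub>v m"
      using sq[of "\<lambda>i. u $ i"] u(1) by (auto simp: vec_id sum_nonneg_eq_0_iff)
    then show ?thesis
      using G by simp
  next
    case False
    have nn: "0 \<le> u \<bullet> u"
      using sq[of "\<lambda>i. u $ i"] u(1) by (simp add: vec_id sum_nonneg)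
    define c where "c = 1 / sqrt (u \<bullet> u)"
    have cc: "c * c * (u \<bullet> u) = 1"
      using False nn by (simp add: c_def)
    have cu: "c \<cdot>\<^sub>v u \<in> carrier_vec m"
      using u by simp
    have "(\<lambda>i. (c \<cdot>\<^sub>v u) $ i) \<in> C"
      using u w cc by (simp add: C_def vec_id[OF cu] mult.assoc)
    from min[OF this] have "\<mu> \<le> (c \<cdot>\<^sub>v u) \<bullet> (G *\<^sub>v (c \<cdot>\<^sub>v u))"
      by (simp add: \<mu>_def f_def vec_id[OF cu])
    also have "\<dots> = c * c * (u \<bullet> (G *\<^sub>v u))"
      using u G by (simp add: mult_mat_vec)
    finally have "\<mu> * (u \<bullet> u) \<le> c * c * (u \<bullet> (G *\<^sub>v u)) * (u \<bullet> u)"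
      using nn by (rule mult_right_mono)
    also have "\<dots> = u \<bullet> (G *\<^sub>v u)"
      using cc by (simp add: mult_ac)
    finally show ?thesis .
  qed
  define r where "r = G *\<^sub>v v - \<mu> \<cdot>\<^sub>v v"
  have Gv: "G *\<^sub>v v \<in> carrier_vec m" and r: "r \<in> carrier_vec m"
    using G v by (auto simp: r_def)
  have vGv: "v \<bullet> (G *\<^sub>v v) = \<mu>"
    by (simp add: \<mu>_def f_def v_def)
  have rw: "r \<bullet> w k = 0" if "k \<in> K" for k
    using inv[OF v(1,3) that] v that w[OF that] Gv
    by (simp add: r_def minus_scalar_prod_distrib[of _ m])
  have rv: "r \<bullet> v = 0"
    using Gv v vGv by (simp add: r_def minus_scalar_prod_distrib[of _ m] comm_scalar_prod[of "G *\<^sub>v v" m v])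
  have rGv: "r \<bullet> (G *\<^sub>v v) = r \<bullet> r"
  proof -
    have "r \<bullet> r = r \<bullet> (G *\<^sub>v v) - r \<bullet> (\<mu> \<cdot>\<^sub>v v)"
      unfolding r_def by (rule scalar_prod_minus_distrib[of _ m]) (use Gv v in auto)
    then show ?thesis
      using rv v r by simp
  qed
  have "0 \<le> (2 * (r \<bullet> r)) * s + (r \<bullet> (G *\<^sub>v r) - \<mu> * (r \<bullet> r)) * s\<^sup>2" for s
  proof -
    define u where "u = v + s \<cdot>\<^sub>v r"
    have u: "u \<in> carrier_vec m"
      using v r by (simp add: u_def)
    have "u \<bullet> w k = 0" if "k \<in> K" for k
      using v r w[OF that] rw[OF that] that by (simp add: u_def add_scalar_prod_distrib[of _ m])
    from ray[OF u this] have "\<mu> * (u \<bullet> u) \<le> u \<bullet> (G *\<^sub>v u)" .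
    moreover have "u \<bullet> u = 1 + s\<^sup>2 * (r \<bullet> r)"
      using v r rv comm_scalar_prod[of r m v]
      by (simp add: u_def add_scalar_prod_distrib[of _ m] scalar_prod_add_distrib[of _ m] power2_eq_square)
    moreover have "u \<bullet> (G *\<^sub>v u) = \<mu> + 2 * s * (r \<bullet> r) + s\<^sup>2 * (r \<bullet> (G *\<^sub>v r))"
    proof -
      have Gr: "G *\<^sub>v r \<in> carrier_vec m"
        using G r by simp
      have vGr: "v \<bullet> (G *\<^sub>v r) = r \<bullet> r"
        using symmetric_scalar_prod[OF G v(1) r] rGv comm_scalar_prod[OF Gv r] by simp
      have "G *\<^sub>v u = G *\<^sub>v v + s \<cdot>\<^sub>v (G *\<^sub>v r)"
        using G v r by (simp add: u_def mult_add_distrib_mat_vec[of _ m m] mult_mat_vec)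
      then show ?thesis
        using v r Gv Gr vGv rGv vGr
        by (simp add: u_def add_scalar_prod_distrib[of _ m] scalar_prod_add_distrib[of _ m]
            power2_eq_square algebra_simps)
    qed
    ultimately show ?thesis
      by (simp add: algebra_simps)
  qed
  then have "2 * (r \<bullet> r) = 0"
    by (rule linear_term_zero[where \<delta> = 1, rotated]) simp
  then have "r = 0\<^sub>v m"
    using sq[of "\<lambda>i. r $ i"] r by (auto simp: vec_id sum_nonneg_eq_0_iff)
  have "G *\<^sub>v v = \<mu> \<cdot>\<^sub>v v"
  proof (rule eq_vecI)
    fix i assume "i < dim_vec (\<mu> \<cdot>\<^sub>v v)"
    then have i: "i < m" using v by simp
    then have "r $ i = 0" using \<open>r = 0\<^sub>v m\<close> by simp
    then show "(G *\<^sub>v v) $ i = (\<mu> \<cdot>\<^sub>v v) $ i"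
      using i v G by (simp add: r_def)
  qed (use G v in simp)
  with v ray show ?thesis by blast
qed

lemma mult_mat_vec_uminus:
  assumes "A \<in> carrier_mat m k" and "v \<in> carrier_vec k"
  shows "A *\<^sub>v (- v) = - (A *\<^sub>v (v :: real vec))"
  by (rule eq_vecI) (use assms in auto)

lemma assoc_mult_mat_vec_dim:
  "dim_col A = dim_row B \<Longrightarrow> dim_col B = dim_vec v \<Longrightarrow> (A * B) *\<^sub>v v = A *\<^sub>v (B *\<^sub>v (v :: real vec))"
  by (rule assoc_mult_mat_vec[of _ "dim_row A" "dim_row B" _ "dim_col B"]) (auto intro: carrier_vecI)

lemma scalar_prod_symp_J:
  assumes "u \<in> carrier_vec (2 * p)" and "v \<in> carrier_vec (2 * p)"
  shows "(symp_J p *\<^sub>v u) \<bullet> v = - (u \<bullet> (symp_J p *\<^sub>v v))"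
proof -
  have "(symp_J p *\<^sub>v u) \<bullet> v = - ((- symp_J p *\<^sub>v u) \<bullet> v)"
    using assms by (simp add: uminus_mult_mat_vec)
  also have "(- symp_J p *\<^sub>v u) \<bullet> v = u \<bullet> (symp_J p *\<^sub>v v)"
    using transpose_vec_mult_scalar[of "symp_J p" "2 * p" "2 * p" v u] assms
    by (simp add: symp_J_transpose)
  finally show ?thesis .
qed

lemma symp_J_vec_carrier [simp]: "symp_J p *\<^sub>v v \<in> carrier_vec (2 * p)"
  by (rule carrier_vecI) simp

lemma symp_J_symp_J_vec:
  assumes "v \<in> carrier_vec (2 * p)"
  shows "symp_J p *\<^sub>v (symp_J p *\<^sub>v v) = - v"
proof -
  have "symp_J p *\<^sub>v (symp_J p *\<^sub>v v) = (symp_J p * symp_J p) *\<^sub>v v"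
    using assms by (simp add: assoc_mult_mat_vec_dim)
  then show ?thesis
    using assms by (simp add: symp_J_square uminus_mult_mat_vec)
qed

text \<open>Eigenvectors of a symmetric matrix that commutes with \<open>J\<close> come in pairs \<open>t, J t\<close>. Taking
  them one pair at a time, each minimising the Rayleigh quotient on the orthogonal complement of the
  earlier pairs, lists the eigenvalues in increasing order.\<close>

definition paired_eigenvectors ::
    "nat \<Rightarrow> real mat \<Rightarrow> nat \<Rightarrow> (nat \<Rightarrow> real vec) \<Rightarrow> (nat \<Rightarrow> real) \<Rightarrow> bool" where
  "paired_eigenvectors p G k t \<mu> \<longleftrightarrow>
    (\<forall>i<k. t i \<in> carrier_vec (2 * p) \<and> G *\<^sub>v t i = \<mu> i \<cdot>\<^sub>v t i \<and>
      (\<forall>u\<in>carrier_vec (2 * p). (\<forall>j<i. u \<bullet> t j = 0 \<and> u \<bullet> (symp_J p *\<^sub>v t j) = 0) \<longrightarrow>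
        \<mu> i * (u \<bullet> u) \<le> u \<bullet> (G *\<^sub>v u))) \<and>
    (\<forall>i<k. \<forall>j<k. t i \<bullet> t j = (if i = j then 1 else 0) \<and> t i \<bullet> (symp_J p *\<^sub>v t j) = 0)"

lemma paired_eigenvectors_exist:
  fixes G :: "real mat"
  assumes G: "G \<in> carrier_mat (2 * p) (2 * p)" "G\<^sup>T = G" "G * symp_J p = symp_J p * G" and "k \<le> p"
  shows "\<exists>t \<mu>. paired_eigenvectors p G k t \<mu>"
  using \<open>k \<le> p\<close>
proof (induction k)
  case 0
  show ?case by (simp add: paired_eigenvectors_def)
next
  case (Suc k)
  let ?J = "symp_J p"
  let ?V = "carrier_vec (2 * p) :: real vec set"
  from Suc obtain t \<mu> where "paired_eigenvectors p G k t \<mu>" by auto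
  then have t: "\<And>i. i < k \<Longrightarrow> t i \<in> ?V" "\<And>i. i < k \<Longrightarrow> G *\<^sub>v t i = \<mu> i \<cdot>\<^sub>v t i"
    and ray: "\<And>i u. i < k \<Longrightarrow> u \<in> ?V \<Longrightarrow> (\<forall>j<i. u \<bullet> t j = 0 \<and> u \<bullet> (?J *\<^sub>v t j) = 0) \<Longrightarrow>
      \<mu> i * (u \<bullet> u) \<le> u \<bullet> (G *\<^sub>v u)"
    and orth: "\<And>i j. i < k \<Longrightarrow> j < k \<Longrightarrow> t i \<bullet> t j = (if i = j then 1 else 0)"
      "\<And>i j. i < k \<Longrightarrow> j < k \<Longrightarrow> t i \<bullet> (?J *\<^sub>v t j) = 0"
    by (simp_all add: paired_eigenvectors_def)
  have [simp]: "dim_vec (t i) = 2 * p" if "i < k" for i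
    using t(1)[OF that] by simp
  define K where "K = {..<k} \<times> (UNIV :: bool set)"
  define w where "w x = (if snd x then t (fst x) else ?J *\<^sub>v t (fst x))" for x :: "nat \<times> bool"
  have w: "w x \<in> ?V" if "x \<in> K" for x
    using that t by (auto simp: K_def w_def)
  have JJ: "(?J *\<^sub>v t i) \<bullet> (?J *\<^sub>v t j) = t i \<bullet> t j" if "i < k" "j < k" for i j
    using that t(1) by (simp add: scalar_prod_symp_J symp_J_symp_J_vec)
  have w_orth: "w x \<bullet> w y = (if x = y then 1 else 0)" if "x \<in> K" "y \<in> K" for x y
  proof (cases x; cases y)
    fix i a j b assume [simp]: "x = (i, a)" "y = (j, b)"
    then have ij: "i < k" "j < k" using that by (auto simp: K_def)
    then show ?thesis
      using t orth[OF ij] orth[OF ij(2,1)] JJ[OF ij]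
      by (auto simp: w_def scalar_prod_symp_J)
  qed
  have Jw: "\<exists>y s. y \<in> K \<and> ?J *\<^sub>v w x = s \<cdot>\<^sub>v w y" if "x \<in> K" for x
  proof (cases "snd x")
    case True
    then show ?thesis
      using that t by (intro exI[of _ "(fst x, False)"] exI[of _ 1]) (auto simp: K_def w_def)
  next
    case False
    have "- t (fst x) = -1 \<cdot>\<^sub>v t (fst x)"
      by auto
    then show ?thesis
      using False that t
      by (intro exI[of _ "(fst x, True)"] exI[of _ "-1"]) (auto simp: K_def w_def symp_J_symp_J_vec)
  qed
  have Gw: "\<exists>s. G *\<^sub>v w x = s \<cdot>\<^sub>v w x" if "x \<in> K" for x
  proof (cases "snd x")
    case True
    then show ?thesis
      using that t by (auto simp: K_def w_def)
  next
    case False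
    have tx: "t (fst x) \<in> ?V" "G *\<^sub>v t (fst x) = \<mu> (fst x) \<cdot>\<^sub>v t (fst x)"
      using that t by (auto simp: K_def)
    have "G *\<^sub>v (?J *\<^sub>v t (fst x)) = (G * ?J) *\<^sub>v t (fst x)"
      using G(1) tx(1) by (simp add: assoc_mult_mat_vec_dim)
    also have "\<dots> = ?J *\<^sub>v (G *\<^sub>v t (fst x))"
      unfolding G(3) using G(1) tx(1) by (simp add: assoc_mult_mat_vec_dim)
    also have "\<dots> = \<mu> (fst x) \<cdot>\<^sub>v (?J *\<^sub>v t (fst x))"
      using tx by (simp add: mult_mat_vec[OF symp_J_carrier])
    finally show ?thesis
      using False by (auto simp: w_def)
  qed
  have "\<exists>r. (\<forall>x\<in>K. (\<Sum>j\<in>{..<2 * p}. r j * w x $ j) = 0) \<and> (\<Sum>j\<in>{..<2 * p}. r j * r j) > (0::real)"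
  proof (rule orthonormal_complement_nonzero)
    show "card K < card {..<2 * p}"
      using Suc.prems by (simp add: K_def card_cartesian_product)
    show "(\<Sum>j\<in>{..<2 * p}. w x $ j * w y $ j) = (if x = y then 1 else 0)" if "x \<in> K" "y \<in> K" for x y
      using w_orth[OF that] w[OF that(2)] by (simp add: scalar_prod_def atLeast0LessThan)
  qed (auto simp: K_def)
  then obtain r where r: "\<And>x. x \<in> K \<Longrightarrow> (\<Sum>j<2 * p. r j * w x $ j) = 0" "(\<Sum>j<2 * p. r j * r j) > (0::real)"
    by auto
  define v0 where "v0 = 1 / sqrt (\<Sum>j<2 * p. r j * r j) \<cdot>\<^sub>v vec (2 * p) r"
  have "\<exists>v \<nu>. v \<in> ?V \<and> v \<bullet> v = 1 \<and> (\<forall>x\<in>K. v \<bullet> w x = 0) \<and> G *\<^sub>v v = \<nu> \<cdot>\<^sub>v v \<and>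
    (\<forall>u\<in>?V. (\<forall>x\<in>K. u \<bullet> w x = 0) \<longrightarrow> \<nu> * (u \<bullet> u) \<le> u \<bullet> (G *\<^sub>v u))"
  proof (rule constrained_eigenvector[OF G(1,2) w])
    have "vec (2 * p) r \<bullet> vec (2 * p) r = (\<Sum>j<2 * p. r j * r j)"
      by (simp add: scalar_prod_def atLeast0LessThan)
    then show "v0 \<bullet> v0 = 1"
      using r(2) by (simp add: v0_def)
    show "v0 \<bullet> w x = 0" if "x \<in> K" for x
    proof -
      have "vec (2 * p) r \<bullet> w x = (\<Sum>j<2 * p. r j * w x $ j)"
        using w[OF that] by (simp add: scalar_prod_def atLeast0LessThan)
      then show ?thesis
        using r(1)[OF that] w[OF that] by (simp add: v0_def)
    qed
    show "(G *\<^sub>v v) \<bullet> w x = 0" if v: "v \<in> ?V" "\<And>x. x \<in> K \<Longrightarrow> v \<bullet> w x = 0" and x: "x \<in> K" for v x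
    proof -
      obtain s where s: "G *\<^sub>v w x = s \<cdot>\<^sub>v w x" using Gw[OF x] by blast
      have "(G *\<^sub>v v) \<bullet> w x = v \<bullet> (G *\<^sub>v w x)"
        by (rule symmetric_scalar_prod[OF G(1,2)]) (use v w[OF x] in auto)
      then show ?thesis
        using v x w[OF x] by (simp add: s)
    qed
  qed (auto simp: v0_def)
  then obtain v \<nu> where v: "v \<in> ?V" "v \<bullet> v = 1" "\<And>x. x \<in> K \<Longrightarrow> v \<bullet> w x = 0" "G *\<^sub>v v = \<nu> \<cdot>\<^sub>v v"
    and v_ray: "\<And>u. u \<in> ?V \<Longrightarrow> (\<And>x. x \<in> K \<Longrightarrow> u \<bullet> w x = 0) \<Longrightarrow> \<nu> * (u \<bullet> u) \<le> u \<bullet> (G *\<^sub>v u)"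
    by blast
  have vt: "v \<bullet> t j = 0" "v \<bullet> (?J *\<^sub>v t j) = 0" if "j < k" for j
    using v(3)[of "(j, True)"] v(3)[of "(j, False)"] that by (auto simp: K_def w_def)
  have tv: "t j \<bullet> v = 0" "t j \<bullet> (?J *\<^sub>v v) = 0" if "j < k" for j
    using vt[OF that] t(1)[OF that] v(1) comm_scalar_prod[of v "2 * p" "t j"]
      comm_scalar_prod[of "?J *\<^sub>v t j" "2 * p" v] scalar_prod_symp_J[of "t j" p v]
    by auto
  have vJv: "v \<bullet> (?J *\<^sub>v v) = 0"
    using scalar_prod_symp_J[OF v(1) v(1)] comm_scalar_prod[of v "2 * p" "?J *\<^sub>v v"] v(1) by auto
  have v_ray': "\<nu> * (u \<bullet> u) \<le> u \<bullet> (G *\<^sub>v u)"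
    if "u \<in> ?V" "\<forall>j<k. u \<bullet> t j = 0 \<and> u \<bullet> (?J *\<^sub>v t j) = 0" for u
    by (rule v_ray[OF that(1)]) (use that(2) in \<open>auto simp: K_def w_def\<close>)
  show ?case unfolding paired_eigenvectors_def
    by (rule exI[of _ "t(k := v)"], rule exI[of _ "\<mu>(k := \<nu>)"])
      (use t ray orth v vt tv vJv v_ray' in \<open>auto simp: less_Suc_eq\<close>)
qed

text \<open>The eigenvector pairs \<open>t, -J t\<close> are the columns of an orthogonal matrix commuting with \<open>J\<close>,
  that is, of an orthogonal symplectic matrix.\<close>

lemma symp_J_commuting_diagonalisation:
  fixes G :: "real mat"
  assumes G: "G \<in> carrier_mat (2 * p) (2 * p)" "G\<^sup>T = G" "G * symp_J p = symp_J p * G"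
  shows "\<exists>T\<in>or_symp_set p. \<exists>c. mono_on {1..p} c \<and> T\<^sup>T * G * T = double_diag p c"
proof -
  let ?J = "symp_J p"
  let ?V = "carrier_vec (2 * p) :: real vec set"
  obtain t \<mu> where "paired_eigenvectors p G p t \<mu>"
    using paired_eigenvectors_exist[OF G order_refl] by blast
  then have t: "\<And>i. i < p \<Longrightarrow> t i \<in> ?V" "\<And>i. i < p \<Longrightarrow> G *\<^sub>v t i = \<mu> i \<cdot>\<^sub>v t i"
    and ray: "\<And>i u. i < p \<Longrightarrow> u \<in> ?V \<Longrightarrow> (\<forall>j<i. u \<bullet> t j = 0 \<and> u \<bullet> (?J *\<^sub>v t j) = 0) \<Longrightarrow>
      \<mu> i * (u \<bullet> u) \<le> u \<bullet> (G *\<^sub>v u)"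
    and orth: "\<And>i j. i < p \<Longrightarrow> j < p \<Longrightarrow> t i \<bullet> t j = (if i = j then 1 else 0)"
      "\<And>i j. i < p \<Longrightarrow> j < p \<Longrightarrow> t i \<bullet> (?J *\<^sub>v t j) = 0"
    by (simp_all add: paired_eigenvectors_def)
  have t_dim [simp]: "dim_vec (t i) = 2 * p" if "i < p" for i
    using t(1)[OF that] by simp
  define c where "c i = \<mu> (i - 1)" for i
  have "mono_on {1..p} c"
  proof (rule mono_onI)
    fix i j assume ij: "i \<in> {1..p}" "j \<in> {1..p}" "i \<le> j"
    then have "i - 1 < p" "j - 1 < p" by auto
    then have "\<mu> (i - 1) * (t (j - 1) \<bullet> t (j - 1)) \<le> t (j - 1) \<bullet> (G *\<^sub>v t (j - 1))"
      using ij t(1) orth by (intro ray) auto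
    then show "c i \<le> c j"
      using \<open>j - 1 < p\<close> t orth by (simp add: c_def)
  qed
  define T where "T = mat (2 * p) (2 * p)
    (\<lambda>(r, k). if k < p then t k $ r else - (?J *\<^sub>v t (k - p)) $ r)"
  have T [simp]: "dim_row T = 2 * p" "dim_col T = 2 * p" "T \<in> carrier_mat (2 * p) (2 * p)"
    by (simp_all add: T_def)
  have col1: "col T k = t k" if "k < p" for k
    using that by (auto simp: T_def)
  have col2: "col T k = - (?J *\<^sub>v t (k - p))" if "p \<le> k" "k < 2 * p" for k
    using that by (auto simp: T_def)
  have entry: "T $$ (r, k) = (if k < p then t k $ r else - (?J *\<^sub>v t (k - p)) $ r)"
    if "r < 2 * p" "k < 2 * p" for r k
    using that by (simp add: T_def)
  have JJ: "t i \<bullet> (?J *\<^sub>v (?J *\<^sub>v t j)) = (if i = j then -1 else 0)" if "i < p" "j < p" for i j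
    using that t(1) orth by (simp add: symp_J_symp_J_vec)
  have TT: "T\<^sup>T * T = 1\<^sub>m (2 * p)"
  proof (rule eq_matI)
    fix i j assume "i < dim_row (1\<^sub>m (2 * p))" "j < dim_col (1\<^sub>m (2 * p))"
    then have ij: "i < 2 * p" "j < 2 * p" by auto
    then have "(T\<^sup>T * T) $$ (i, j) = col T i \<bullet> col T j" by simp
    also have "\<dots> = (if i = j then 1 else 0)"
      using ij t(1) orth
      by (cases "i < p"; cases "j < p")
        (auto simp: col1 col2 JJ scalar_prod_symp_J)
    finally show "(T\<^sup>T * T) $$ (i, j) = 1\<^sub>m (2 * p) $$ (i, j)"
      using ij by simp
  qed simp_all
  have JT: "?J * T = T * ?J"
  proof (rule eq_matI)
    fix i j assume "i < dim_row (T * ?J)" "j < dim_col (T * ?J)"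
    then have ij: "i < 2 * p" "j < 2 * p" by auto
    have "(?J * T) $$ (i, j) = (?J *\<^sub>v col T j) $ i"
      using ij by simp
    also have "\<dots> = (T * ?J) $$ (i, j)"
    proof (cases "j < p")
      case True
      then show ?thesis
        using ij by (simp add: col1 mult_symp_J_index conj_sign_def conj_index_def entry del: index_mult_mat(1))
    next
      case False
      have "?J *\<^sub>v (- (?J *\<^sub>v t (j - p))) = t (j - p)"
        using ij False t(1)[of "j - p"]
        by (subst mult_mat_vec_uminus) (auto simp: symp_J_symp_J_vec)
      moreover have "j - p < p"
        using ij False by simp
      ultimately show ?thesis
        using ij False
        by (simp add: col2 mult_symp_J_index conj_sign_def conj_index_def entry del: index_mult_mat(1))
    qed
    finally show "(?J * T) $$ (i, j) = (T * ?J) $$ (i, j)" .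
  qed simp_all
  have GT: "G * T = T * double_diag p c"
  proof (rule eq_matI)
    fix i j assume "i < dim_row (T * double_diag p c)" "j < dim_col (T * double_diag p c)"
    then have ij: "i < 2 * p" "j < 2 * p" by auto
    have "G *\<^sub>v col T j = dbl p c j \<cdot>\<^sub>v col T j"
    proof (cases "j < p")
      case True
      then show ?thesis
        using t by (simp add: col1 dbl_def c_def)
    next
      case False
      let ?u = "t (j - p)"
      have u: "?u \<in> ?V" "G *\<^sub>v ?u = \<mu> (j - p) \<cdot>\<^sub>v ?u"
        using t False ij by auto
      have "G *\<^sub>v (?J *\<^sub>v ?u) = (G * ?J) *\<^sub>v ?u"
        using G(1) u(1) by (simp add: assoc_mult_mat_vec_dim)
      also have "\<dots> = ?J *\<^sub>v (G *\<^sub>v ?u)"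
        unfolding G(3) using G(1) u(1) by (simp add: assoc_mult_mat_vec_dim)
      also have "\<dots> = \<mu> (j - p) \<cdot>\<^sub>v (?J *\<^sub>v ?u)"
        using u by (simp add: mult_mat_vec[OF symp_J_carrier])
      finally have "G *\<^sub>v (- (?J *\<^sub>v ?u)) = - (\<mu> (j - p) \<cdot>\<^sub>v (?J *\<^sub>v ?u))"
        using G u by (subst mult_mat_vec_uminus) auto
      also have "\<dots> = \<mu> (j - p) \<cdot>\<^sub>v - (?J *\<^sub>v ?u)"
        by auto
      finally show ?thesis
        using False ij by (simp add: col2 dbl_def c_def)
    qed
    moreover have "(G * T) $$ (i, j) = (G *\<^sub>v col T j) $ i"
      using ij G by simp
    ultimately show "(G * T) $$ (i, j) = (T * double_diag p c) $$ (i, j)"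
      using ij by (simp add: mult_double_diag_index del: index_mult_mat(1))
  qed (use G in simp_all)
  have "T\<^sup>T * ?J * T = ?J"
    using JT TT by (simp add: mult_assoc_dim) (simp add: TT flip: mult_assoc_dim)
  then have "T \<in> or_symp_set p"
    using TT by (simp add: or_symp_set_def symp_set_def)
  moreover have "T\<^sup>T * G * T = double_diag p c"
    using GT TT G by (simp add: mult_assoc_dim) (simp add: TT flip: mult_assoc_dim)
  ultimately show ?thesis
    using \<open>mono_on {1..p} c\<close> by blast
qed

section \<open>Scaled symplectic eigenvector pairs\<close>

text \<open>Columns \<open>i\<close> and \<open>i + p\<close> of \<open>Y\<close> form a symplectic eigenvector pair of \<open>A\<close> for \<open>c\<^sub>i\<close>, scaled so
  that the symplectic form takes the value \<open>h\<^sub>i\<close> on it instead of \<open>1\<close>. The minus sign stands for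
  the transpose of the second \<open>J\<close>, and products are associated to the right to suit rewriting.
  Critical points of both problems have this form up to an orthogonal symplectic factor, with
  \<open>h = 1\<close> for the constrained problem and \<open>c = \<beta> (1 - h)\<close> for the penalty problem.\<close>

definition scaled_eigenpairs ::
    "nat \<Rightarrow> nat \<Rightarrow> real mat \<Rightarrow> real mat \<Rightarrow> (nat \<Rightarrow> real) \<Rightarrow> (nat \<Rightarrow> real) \<Rightarrow> bool" where
  "scaled_eigenpairs n p A Y c h \<longleftrightarrow> Y \<in> carrier_mat (2 * n) (2 * p) \<and>
     A * Y = - (symp_J n * (Y * (symp_J p * double_diag p c))) \<and>
     Y\<^sup>T * (symp_J n * Y) = symp_J p * double_diag p h"

lemma scaled_eigenpairs_cong:
  assumes "scaled_eigenpairs n p A Y c h"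
    and "\<And>i. i \<in> {1..p} \<Longrightarrow> c i = c' i" and "\<And>i. i \<in> {1..p} \<Longrightarrow> h i = h' i"
  shows "scaled_eigenpairs n p A Y c' h'"
  using assms double_diag_cong[of p c c'] double_diag_cong[of p h h']
  by (simp add: scaled_eigenpairs_def)

lemma scaled_eigenpairs_gram:
  assumes "scaled_eigenpairs n p A Y c h"
  shows "Y\<^sup>T * (A * Y) = double_diag p (\<lambda>i. c i * h i)"
proof -
  have [simp]: "dim_row Y = 2 * n" "dim_col Y = 2 * p"
    using assms by (auto simp: scaled_eigenpairs_def)
  have "A * Y = - (symp_J n * (Y * (symp_J p * double_diag p c)))"
    using assms by (simp add: scaled_eigenpairs_def)
  then have "Y\<^sup>T * (A * Y) = - ((Y\<^sup>T * (symp_J n * Y)) * (symp_J p * double_diag p c))"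
    by (simp add: mat_dist)
  also have "Y\<^sup>T * (symp_J n * Y) = symp_J p * double_diag p h"
    using assms by (simp add: scaled_eigenpairs_def)
  also have "- ((symp_J p * double_diag p h) * (symp_J p * double_diag p c)) =
      double_diag p (\<lambda>i. c i * h i)"
    by (simp add: mat_dist double_diag_symp_J_mult symp_J_symp_J_mult double_diag_mult mult.commute)
  finally show ?thesis .
qed

lemma scaled_eigenpairs_mult_double_diag:
  assumes "scaled_eigenpairs n p A Y c h" and "A \<in> carrier_mat (2 * n) (2 * n)"
  shows "scaled_eigenpairs n p A (Y * double_diag p r) c (\<lambda>i. (r i)\<^sup>2 * h i)"
proof -
  have [simp]: "dim_row Y = 2 * n" "dim_col Y = 2 * p" "dim_row A = 2 * n" "dim_col A = 2 * n"
    using assms by (auto simp: scaled_eigenpairs_def)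
  have "A * (Y * double_diag p r) = (A * Y) * double_diag p r"
    by (simp add: mult_assoc_dim)
  also have "\<dots> = - (symp_J n * (Y * (symp_J p * double_diag p c))) * double_diag p r"
    using assms by (simp add: scaled_eigenpairs_def)
  also have "\<dots> = - (symp_J n * ((Y * double_diag p r) * (symp_J p * double_diag p c)))"
    by (simp add: mat_dist double_diag_symp_J_mult double_diag_mult mult.commute)
  finally have 1: "A * (Y * double_diag p r) =
    - (symp_J n * ((Y * double_diag p r) * (symp_J p * double_diag p c)))" .
  have "(Y * double_diag p r)\<^sup>T * (symp_J n * (Y * double_diag p r)) =
      double_diag p r * ((Y\<^sup>T * (symp_J n * Y)) * double_diag p r)"
    by (simp add: mat_dist double_diag_transpose)
  also have "\<dots> = double_diag p r * ((symp_J p * double_diag p h) * double_diag p r)"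
    using assms by (simp add: scaled_eigenpairs_def)
  also have "\<dots> = symp_J p * double_diag p (\<lambda>i. (r i)\<^sup>2 * h i)"
    by (simp add: mat_dist double_diag_symp_J_mult double_diag_mult power2_eq_square mult_ac)
  finally show ?thesis
    using 1 by (simp add: scaled_eigenpairs_def carrier_matI)
qed

lemma mat_inner_symp_J_mult:
  assumes "dim_row B = 2 * p"
  shows "mat_inner (symp_J p * B) (symp_J p * B) = mat_inner B B"
  using assms by (simp add: mat_inner_mult_left symp_J_transpose symp_J_symp_J_mult uminus_uminus_real_mat)

lemma mat_inner_gram:
  assumes "dim_row Y = dim_row B" and "dim_col Y = q" and "dim_col B = q"
  shows "mat_inner Y B = mat_inner (1\<^sub>m q) (Y\<^sup>T * B)"
  using mat_inner_mult_left[of Y "1\<^sub>m q" B] assms by simp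

lemma cop_objective_scaled_eigenpairs:
  assumes "scaled_eigenpairs n p A Y c h" and "A \<in> carrier_mat (2 * n) (2 * n)"
  shows "cop_objective A Y = (\<Sum>i=1..p. c i * h i)"
proof -
  have Y: "Y \<in> carrier_mat (2 * n) (2 * p)"
    using assms by (simp add: scaled_eigenpairs_def)
  have "mat_inner Y (A * Y) = mat_inner (double_diag p (\<lambda>_. 1)) (double_diag p (\<lambda>i. c i * h i))"
    using Y assms(2) scaled_eigenpairs_gram[OF assms(1)]
    by (simp add: mat_inner_gram[of Y "A * Y" "2 * p"] double_diag_one)
  then show ?thesis
    using cop_objective_inner[OF assms(2) Y] by (simp add: mat_inner_double_diag)
qed

lemma tpm_objective_scaled_eigenpairs:
  assumes "scaled_eigenpairs n p A Y c h" and "A \<in> carrier_mat (2 * n) (2 * n)"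
  shows "tpm_objective n p A \<beta> Y = (\<Sum>i=1..p. c i * h i + \<beta> / 2 * (h i - 1)\<^sup>2)"
proof -
  have Y: "Y \<in> carrier_mat (2 * n) (2 * p)"
    using assms by (simp add: scaled_eigenpairs_def)
  have "Y\<^sup>T * symp_J n * Y - symp_J p = symp_J p * double_diag p h - symp_J p * double_diag p (\<lambda>_. 1)"
    using Y assms(1) by (simp add: mult_assoc_dim scaled_eigenpairs_def double_diag_one)
  also have "\<dots> = symp_J p * double_diag p (\<lambda>i. h i - 1)"
    by (simp add: double_diag_diff flip: mult_minus_dim)
  finally have "mat_inner (Y\<^sup>T * symp_J n * Y - symp_J p) (Y\<^sup>T * symp_J n * Y - symp_J p) =
      2 * (\<Sum>i=1..p. (h i - 1)\<^sup>2)"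
    by (simp add: mat_inner_symp_J_mult mat_inner_double_diag power2_eq_square)
  then show ?thesis
    using tpm_objective_inner[OF assms(2) Y, of \<beta>] cop_objective_inner[OF assms(2) Y]
      cop_objective_scaled_eigenpairs[OF assms]
    by (simp add: sum.distrib sum_distrib_left)
qed

lemma or_symp_setD:
  assumes "T \<in> or_symp_set p"
  shows "T \<in> carrier_mat (2 * p) (2 * p)" and "T\<^sup>T * T = 1\<^sub>m (2 * p)" and "T * T\<^sup>T = 1\<^sub>m (2 * p)"
    and "symp_J p * T = T * symp_J p" and "T\<^sup>T * symp_J p = symp_J p * T\<^sup>T"
proof -
  show T: "T \<in> carrier_mat (2 * p) (2 * p)" and TT: "T\<^sup>T * T = 1\<^sub>m (2 * p)"
    using assms by (auto simp: or_symp_set_def symp_set_def)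
  then show TT': "T * T\<^sup>T = 1\<^sub>m (2 * p)"
    using mat_mult_left_right_inverse[of "T\<^sup>T" "2 * p" T] by simp
  have J: "T\<^sup>T * (symp_J p * T) = symp_J p"
    using assms T by (simp add: or_symp_set_def symp_set_def mult_assoc_dim)
  have "symp_J p * T = (T * T\<^sup>T) * (symp_J p * T)"
    using T by (simp add: TT')
  also have "\<dots> = T * symp_J p"
    using T J by (simp add: mult_assoc_dim)
  finally show JT: "symp_J p * T = T * symp_J p" .
  have "T\<^sup>T * symp_J p = T\<^sup>T * (symp_J p * (T * T\<^sup>T))"
    using T by (simp add: TT')
  also have "\<dots> = (T\<^sup>T * (symp_J p * T)) * T\<^sup>T"
    using T by (simp add: mult_assoc_dim)
  finally show "T\<^sup>T * symp_J p = symp_J p * T\<^sup>T"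
    by (simp add: J)
qed

lemma objective_or_symp_invariant:
  assumes T: "T \<in> or_symp_set p" and X: "X \<in> carrier_mat (2 * n) (2 * p)"
    and A: "A \<in> carrier_mat (2 * n) (2 * n)"
  shows "cop_objective A (X * T) = cop_objective A X"
    and "tpm_objective n p A \<beta> (X * T) = tpm_objective n p A \<beta> X"
proof -
  note T' = or_symp_setD[OF T]
  have [simp]: "dim_row T = 2 * p" "dim_col T = 2 * p" "dim_row X = 2 * n" "dim_col X = 2 * p"
    "dim_row A = 2 * n" "dim_col A = 2 * n"
    using T' X A by auto
  have inner: "mat_inner (B * T) (C * T) = mat_inner B C"
    if "dim_row B = dim_row C" "dim_col B = 2 * p" "dim_col C = 2 * p" for B C
    using that T'(3) by (simp add: mat_inner_mult_right mult_assoc_dim)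
  have inner': "mat_inner (T\<^sup>T * B) (T\<^sup>T * C) = mat_inner B C"
    if "dim_row B = 2 * p" "dim_row C = 2 * p" "dim_col C = dim_col B" for B C
  proof -
    have "mat_inner (T\<^sup>T * B) (T\<^sup>T * C) = mat_inner B (T * (T\<^sup>T * C))"
      using that by (simp add: mat_inner_mult_left)
    then show ?thesis
      using that by (simp add: T'(3) flip: mult_assoc_dim)
  qed
  have XT: "X * T \<in> carrier_mat (2 * n) (2 * p)"
    using X T' by auto
  have "A * (X * T) = (A * X) * T"
    by (simp add: mult_assoc_dim)
  then have quad: "mat_inner (X * T) (A * (X * T)) = mat_inner X (A * X)"
    by (simp add: inner)
  then show "cop_objective A (X * T) = cop_objective A X"
    by (simp add: cop_objective_inner[OF A XT] cop_objective_inner[OF A X])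
  define N where "N = X\<^sup>T * symp_J n * X - symp_J p"
  have [simp]: "dim_row N = 2 * p" "dim_col N = 2 * p"
    by (simp_all add: N_def)
  have "T\<^sup>T * (symp_J p * T) = symp_J p"
    using T by (simp add: or_symp_set_def symp_set_def mult_assoc_dim)
  then have "(X * T)\<^sup>T * symp_J n * (X * T) - symp_J p = T\<^sup>T * (N * T)"
    by (simp add: N_def mat_ring)
  then show "tpm_objective n p A \<beta> (X * T) = tpm_objective n p A \<beta> X"
    using quad unfolding tpm_objective_inner[OF A XT] tpm_objective_inner[OF A X]
    by (simp add: inner inner' N_def[symmetric])
qed


section \<open>Williamson coordinates\<close>

text \<open>The relation \<open>S\<^sup>T J S = J\<close> says that \<open>- J S\<^sup>T J\<close> is a left inverse of \<open>S\<close>.\<close>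

lemma symp_set_inverse:
  assumes "S \<in> symp_set n n"
  shows "(- (symp_J n * (S\<^sup>T * symp_J n))) * S = 1\<^sub>m (2 * n)"
    and "S * (- (symp_J n * (S\<^sup>T * symp_J n))) = 1\<^sub>m (2 * n)"
proof -
  have S: "S \<in> carrier_mat (2 * n) (2 * n)" "S\<^sup>T * (symp_J n * S) = symp_J n"
    using assms by (auto simp: symp_set_def mult_assoc_dim)
  then show 1: "(- (symp_J n * (S\<^sup>T * symp_J n))) * S = 1\<^sub>m (2 * n)"
    by (simp add: mat_dist symp_J_square)
  show "S * (- (symp_J n * (S\<^sup>T * symp_J n))) = 1\<^sub>m (2 * n)"
    by (rule mat_mult_left_right_inverse[OF _ _ 1]) (use S in auto)
qed

lemma williamson_eigenpairs:
  assumes S: "S \<in> symp_set n n" and D: "S\<^sup>T * A * S = double_diag n d"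
    and A: "A \<in> carrier_mat (2 * n) (2 * n)"
  shows "scaled_eigenpairs n n A S d (\<lambda>_. 1)"
proof -
  have S': "S \<in> carrier_mat (2 * n) (2 * n)" "S\<^sup>T * (symp_J n * S) = symp_J n"
    using S by (auto simp: symp_set_def mult_assoc_dim)
  have [simp]: "dim_row S = 2 * n" "dim_col S = 2 * n" "dim_row A = 2 * n" "dim_col A = 2 * n"
    using S' A by auto
  have inv: "- (symp_J n * (S * (symp_J n * S\<^sup>T))) = 1\<^sub>m (2 * n)"
  proof -
    have "- (symp_J n * (S * (symp_J n * S\<^sup>T))) = (S * - (symp_J n * (S\<^sup>T * symp_J n)))\<^sup>T"
      by (simp add: mat_dist symp_J_transpose)
    then show ?thesis
      using symp_set_inverse(2)[OF S] by simp
  qed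
  have "A * S = - (symp_J n * (S * (symp_J n * S\<^sup>T))) * (A * S)"
    by (simp only: inv) simp
  also have "\<dots> = - (symp_J n * (S * (symp_J n * double_diag n d)))"
    using D by (simp add: mat_dist)
  finally show ?thesis
    using S' by (simp add: scaled_eigenpairs_def double_diag_one)
qed

text \<open>Substituting \<open>Y = S B\<close> preserves the symplectic form and turns \<open>A\<close> into its Williamson
  diagonal form.\<close>

lemma scaled_eigenpairs_williamson_iff:
  assumes S: "S \<in> symp_set n n" and D: "S\<^sup>T * A * S = double_diag n d"
    and A: "A \<in> carrier_mat (2 * n) (2 * n)" and B: "B \<in> carrier_mat (2 * n) (2 * p)"
  shows "scaled_eigenpairs n p A (S * B) c h \<longleftrightarrow> scaled_eigenpairs n p (double_diag n d) B c h"
proof -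
  have S': "S \<in> carrier_mat (2 * n) (2 * n)" "S\<^sup>T * (symp_J n * S) = symp_J n"
    using S by (auto simp: symp_set_def mult_assoc_dim)
  have [simp]: "dim_row S = 2 * n" "dim_col S = 2 * n" "dim_row A = 2 * n" "dim_col A = 2 * n"
    "dim_row B = 2 * n" "dim_col B = 2 * p"
    using S' A B by auto
  have SJS: "S\<^sup>T * (symp_J n * (S * C)) = symp_J n * C" if "dim_row C = 2 * n" for C
  proof -
    have "S\<^sup>T * (symp_J n * (S * C)) = (S\<^sup>T * (symp_J n * S)) * C"
      using that by (simp add: mult_assoc_dim)
    then show ?thesis by (simp add: S')
  qed
  have form: "(S * B)\<^sup>T * (symp_J n * (S * B)) = B\<^sup>T * (symp_J n * B)"
    by (simp add: mat_dist SJS)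
  have "A * (S * B) = - (symp_J n * ((S * B) * (symp_J p * double_diag p c))) \<longleftrightarrow>
      double_diag n d * B = - (symp_J n * (B * (symp_J p * double_diag p c)))" (is "?L \<longleftrightarrow> ?R")
  proof
    assume L: ?L
    have "double_diag n d * B = S\<^sup>T * (A * (S * B))"
      by (simp add: mult_assoc_dim flip: D)
    also have "\<dots> = - (symp_J n * (B * (symp_J p * double_diag p c)))"
      unfolding L by (simp add: mat_dist SJS)
    finally show ?R .
  next
    assume R: ?R
    have "A * (S * B) = (A * S) * B"
      by (simp add: mult_assoc_dim)
    also have "\<dots> = - (symp_J n * (S * (symp_J n * (double_diag n d * B))))"
      using williamson_eigenpairs[OF S D A] by (simp add: scaled_eigenpairs_def mat_dist)
    also have "\<dots> = - (symp_J n * ((S * B) * (symp_J p * double_diag p c)))"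
      unfolding R by (simp add: mat_dist symp_J_symp_J_mult)
    finally show ?L .
  qed
  then show ?thesis
    using S' B form by (auto simp: scaled_eigenpairs_def)
qed

lemma first_eigenpairs_exist:
  assumes S: "S \<in> symp_set n n" and D: "S\<^sup>T * A * S = double_diag n d"
    and A: "A \<in> carrier_mat (2 * n) (2 * n)" and "p \<le> n"
  shows "\<exists>Y. scaled_eigenpairs n p A Y d (\<lambda>_. 1)"
proof -
  (* In Williamson coordinates the pairs for the first p values are the unit vectors i and n + i,
     for i < p; E selects them. *)
  define E where "E = mat (2 * n) (2 * p)
    (\<lambda>(i, j). if i = (if j < p then j else j - p + n) then 1 else (0::real))"
  have [simp]: "dim_row E = 2 * n" "dim_col E = 2 * p" and E: "E \<in> carrier_mat (2 * n) (2 * p)"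
    by (simp_all add: E_def)
  have index: "E $$ (i, j) = (if i = (if j < p then j else j - p + n) then 1 else 0)"
    if "i < 2 * n" "j < 2 * p" for i j
    using that by (simp add: E_def)
  have JE: "symp_J n * E = E * symp_J p"
    by (rule eq_matI)
      (use \<open>p \<le> n\<close> in \<open>auto simp: symp_J_mult_index mult_symp_J_index index conj_index_def conj_sign_def
        simp del: index_mult_mat(1)\<close>)
  have DE: "double_diag n d * E = E * double_diag p d"
    by (rule eq_matI)
      (use \<open>p \<le> n\<close> in \<open>auto simp: double_diag_mult_index mult_double_diag_index index dbl_def
        simp del: index_mult_mat(1)\<close>)
  have EE: "E\<^sup>T * E = 1\<^sub>m (2 * p)"
  proof (rule eq_matI)
    fix i j assume "i < dim_row (1\<^sub>m (2 * p))" "j < dim_col (1\<^sub>m (2 * p))"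
    then have ij: "i < 2 * p" "j < 2 * p" by auto
    define i' where "i' = (if i < p then i else i - p + n)"
    have i': "i' < 2 * n" using ij \<open>p \<le> n\<close> by (auto simp: i'_def)
    have "(E\<^sup>T * E) $$ (i, j) = (\<Sum>k<2 * n. E $$ (k, i) * E $$ (k, j))"
      using ij by (simp add: mult_index_sum del: index_mult_mat(1))
    also have "\<dots> = (\<Sum>k<2 * n. if k = i' then E $$ (k, j) else 0)"
      using ij by (intro sum.cong) (auto simp: index i'_def)
    also have "\<dots> = E $$ (i', j)"
      using i' by simp
    also have "\<dots> = 1\<^sub>m (2 * p) $$ (i, j)"
      using ij i' \<open>p \<le> n\<close> by (auto simp: index i'_def)
    finally show "(E\<^sup>T * E) $$ (i, j) = 1\<^sub>m (2 * p) $$ (i, j)" .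
  qed simp_all
  have "- (symp_J n * (E * (symp_J p * double_diag p d))) =
      - ((symp_J n * E) * (symp_J p * double_diag p d))"
    by (simp add: mult_assoc_dim)
  also have "\<dots> = double_diag n d * E"
    unfolding JE DE by (simp add: mat_dist symp_J_symp_J_mult)
  finally have "double_diag n d * E = - (symp_J n * (E * (symp_J p * double_diag p d)))" ..
  moreover have "E\<^sup>T * (symp_J n * E) = symp_J p"
    unfolding JE by (simp add: EE flip: mult_assoc_dim)
  ultimately have "scaled_eigenpairs n p (double_diag n d) E d (\<lambda>_. 1)"
    by (simp add: scaled_eigenpairs_def E double_diag_one)
  then show ?thesis
    using scaled_eigenpairs_williamson_iff[OF S D A E] by blast
qed

text \<open>In Williamson coordinates the columns of a scaled eigenvector pair with \<open>h\<^sub>k > 0\<close> are supported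
  on the coordinates whose diagonal entry equals \<open>c\<^sub>k\<close>, and different such columns are orthogonal. The
  \<open>2 i\<close> columns of the first \<open>i\<close> pairs therefore lie in the space of the coordinates with diagonal
  entry at most \<open>c\<^sub>i\<close>, of which there are fewer than \<open>2 i\<close> if \<open>c\<^sub>i < d\<^sub>i\<close>.\<close>

lemma eigenpairs_interlace_diag:
  assumes B: "scaled_eigenpairs n p (double_diag n d) B c h"
    and d_pos: "\<And>j. j \<in> {1..n} \<Longrightarrow> 0 < d j" and d_mono: "mono_on {1..n} d" and c_mono: "mono_on {1..p} c"
    and i: "i \<in> {1..p}" "i \<le> n" and h: "\<And>k. k \<in> {1..i} \<Longrightarrow> 0 < h k"
  shows "d i \<le> c i"
proof (rule ccontr)
  assume less: "\<not> d i \<le> c i"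
  let ?D = "double_diag n d"
  have [simp]: "dim_row B = 2 * n" "dim_col B = 2 * p"
    using B by (auto simp: scaled_eigenpairs_def)
  have DB: "?D * B = - (symp_J n * (B * (symp_J p * double_diag p c)))"
    and form: "B\<^sup>T * (symp_J n * B) = symp_J p * double_diag p h"
    using B by (auto simp: scaled_eigenpairs_def)
  define K where "K = {..<i} \<union> {p..<p + i}"
  have K: "k < 2 * p" "0 < dbl p h k" "dbl p c k \<le> c i" if k: "k \<in> K" for k
  proof -
    obtain m where m: "m \<in> {1..i}" "dbl p h k = h m" "dbl p c k = c m"
      using k i by (cases "k < p") (force simp: K_def dbl_def)+
    show "k < 2 * p" "0 < dbl p h k" "dbl p c k \<le> c i"
      using k m h i c_mono by (auto simp: K_def mono_on_def)
  qed
  have d_dbl: "0 < dbl n d j" if "j < 2 * n" for j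
    using that d_pos by (auto simp: dbl_def)
  (* Applying the pair equation twice removes J and leaves a relation between single entries of B. *)
  have sq: "?D * (?D * B) = B * (double_diag p c * double_diag p c)"
  proof -
    have "?D * (?D * B) = ?D * - (symp_J n * (B * (symp_J p * double_diag p c)))"
      by (simp only: DB)
    also have "\<dots> = - (symp_J n * ((?D * B) * (symp_J p * double_diag p c)))"
      by (simp add: mat_dist double_diag_symp_J_mult)
    also have "\<dots> = B * (double_diag p c * double_diag p c)"
      unfolding DB by (simp add: mat_dist symp_J_symp_J_mult double_diag_symp_J_mult)
    finally show ?thesis .
  qed
  have c_pos: "0 < dbl p c k" if k: "k \<in> K" for k
  proof -
    have nonneg: "0 \<le> dbl n d j * (B $$ (j, k))\<^sup>2" if "j < 2 * n" for j
      using d_dbl[OF that] by simp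
    then have "0 \<le> (\<Sum>j<2 * n. dbl n d j * (B $$ (j, k))\<^sup>2)"
      by (intro sum_nonneg) simp
    also have gram: "(\<Sum>j<2 * n. dbl n d j * (B $$ (j, k))\<^sup>2) = dbl p c k * dbl p h k"
    proof -
      have "(B\<^sup>T * (?D * B)) $$ (k, k) = (\<Sum>j<2 * n. dbl n d j * (B $$ (j, k))\<^sup>2)"
        using K(1)[OF k]
        by (subst mult_index_sum)
          (simp_all add: double_diag_mult_index power2_eq_square mult_ac del: index_mult_mat(1))
      then show ?thesis
        using K(1)[OF k] scaled_eigenpairs_gram[OF B] by (simp add: double_diag_index dbl_mult)
    qed
    finally have "0 \<le> dbl p c k"
      using K(2)[OF k] by (simp add: zero_le_mult_iff)
    moreover have "dbl p c k \<noteq> 0"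
    proof
      assume "dbl p c k = 0"
      then have "(\<Sum>j<2 * n. dbl n d j * (B $$ (j, k))\<^sup>2) = 0"
        using gram by simp
      then have "\<forall>j<2 * n. dbl n d j * (B $$ (j, k))\<^sup>2 = 0"
        by (subst (asm) sum_nonneg_eq_0_iff) (auto simp: nonneg)
      then have zero: "B $$ (j, k) = 0" if "j < 2 * n" for j
        using d_dbl[OF that] that by auto
      have conj: "conj_index p k < 2 * p" "conj_index p (conj_index p k) = k"
        using K(1)[OF k] by (auto simp: conj_index_def)
      have "(B\<^sup>T * (symp_J n * B)) $$ (conj_index p k, k) = 0"
        using K(1)[OF k] zero conj(1)
        by (subst mult_index_sum)
          (auto simp: symp_J_mult_index conj_index_def[of n] simp del: index_mult_mat(1) intro!: sum.neutral)
      moreover have "(symp_J p * double_diag p h) $$ (conj_index p k, k) \<noteq> 0"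
        using K(1,2)[OF k] conj
        by (simp add: symp_J_mult_index double_diag_index conj_sign_def del: index_mult_mat(1))
      ultimately show False
        using form by simp
    qed
    ultimately show ?thesis by simp
  qed
  have supp: "dbl n d j = dbl p c k" if k: "k \<in> K" and j: "j < 2 * n" and nz: "B $$ (j, k) \<noteq> 0" for j k
  proof -
    have "(?D * (?D * B)) $$ (j, k) = dbl n d j * (dbl n d j * B $$ (j, k))"
      using j K(1)[OF k] by (simp add: double_diag_mult_index del: index_mult_mat(1))
    moreover have "(B * (double_diag p c * double_diag p c)) $$ (j, k) =
        B $$ (j, k) * (dbl p c k * dbl p c k)"
      using j K(1)[OF k] by (simp add: double_diag_mult mult_double_diag_index dbl_mult del: index_mult_mat(1))
    ultimately have "(dbl n d j)\<^sup>2 = (dbl p c k)\<^sup>2"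
      using nz sq by (simp add: power2_eq_square)
    then show ?thesis
      using d_dbl[OF j] c_pos[OF k] by (simp add: power2_eq_iff)
  qed
  (* On the support of column k the factors d and c of the pair equation agree and cancel, so the
     column is, up to sign, J applied to its partner. This turns the symplectic form into the inner product. *)
  have rot: "B $$ (j, k) = - ((symp_J n * (B * symp_J p)) $$ (j, k))" if k: "k \<in> K" and j: "j < 2 * n" for j k
  proof -
    have "dbl p c k * B $$ (j, k) = dbl n d j * B $$ (j, k)"
      using supp[OF k j] by (cases "B $$ (j, k) = 0") auto
    also have "\<dots> = (?D * B) $$ (j, k)"
      using j K(1)[OF k] by (simp add: double_diag_mult_index del: index_mult_mat(1))
    also have "?D * B = - ((symp_J n * (B * symp_J p)) * double_diag p c)"
      unfolding DB by (simp add: mat_dist)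
    also have "(- ((symp_J n * (B * symp_J p)) * double_diag p c)) $$ (j, k) =
        - ((symp_J n * (B * symp_J p)) $$ (j, k) * dbl p c k)"
      using j K(1)[OF k] by (subst index_uminus_mat) (simp_all add: mult_double_diag_index del: index_mult_mat(1))
    finally have "dbl p c k * B $$ (j, k) = dbl p c k * - ((symp_J n * (B * symp_J p)) $$ (j, k))"
      by simp
    moreover have "dbl p c k \<noteq> 0"
      using c_pos[OF k] by simp
    ultimately show ?thesis
      using mult_left_cancel by blast
  qed
  have orth: "(\<Sum>j<2 * n. B $$ (j, k) * B $$ (j, l)) = (if k = l then dbl p h k else 0)"
    if k: "k \<in> K" and l: "l \<in> K" for k l
  proof -
    have "(\<Sum>j<2 * n. B $$ (j, k) * B $$ (j, l)) =
        - (\<Sum>j<2 * n. B $$ (j, k) * (symp_J n * (B * symp_J p)) $$ (j, l))"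
      unfolding sum_negf[symmetric]
    proof (rule sum.cong[OF refl])
      fix j assume "j \<in> {..<2 * n}"
      then have "B $$ (j, l) = - ((symp_J n * (B * symp_J p)) $$ (j, l))"
        using rot[OF l] by blast
      then show "B $$ (j, k) * B $$ (j, l) = - (B $$ (j, k) * (symp_J n * (B * symp_J p)) $$ (j, l))"
        by (metis mult_minus_right)
    qed
    also have "\<dots> = - ((B\<^sup>T * (symp_J n * (B * symp_J p))) $$ (k, l))"
      using K(1)[OF k] K(1)[OF l] by (simp add: mult_index_sum[of k "B\<^sup>T"] del: index_mult_mat(1))
    also have "B\<^sup>T * (symp_J n * (B * symp_J p)) = (B\<^sup>T * (symp_J n * B)) * symp_J p"
      by (simp add: mult_assoc_dim)
    also have "\<dots> = - double_diag p h"
      unfolding form by (simp add: mat_dist double_diag_symp_J symp_J_symp_J_mult)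
    finally show ?thesis
      using K(1)[OF k] K(1)[OF l] by (simp add: double_diag_index)
  qed
  define L where "L = {j. j < 2 * n \<and> dbl n d j \<le> c i}"
  define q where "q k j = B $$ (j, k) / sqrt (dbl p h k)" for k j
  have "card K \<le> card L"
  proof (rule orthonormal_card_le)
    fix k l assume k: "k \<in> K" and l: "l \<in> K"
    have "(\<Sum>j\<in>L. q k j * q l j) = (\<Sum>j<2 * n. q k j * q l j)"
    proof (rule sum.mono_neutral_left)
      show "\<forall>j\<in>{..<2 * n} - L. q k j * q l j = 0"
        using supp[OF k] K(3)[OF k] by (fastforce simp: L_def q_def)
    qed (auto simp: L_def)
    also have "\<dots> = (\<Sum>j<2 * n. B $$ (j, k) * B $$ (j, l)) / (sqrt (dbl p h k) * sqrt (dbl p h l))"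
      by (simp add: q_def sum_divide_distrib)
    also have "\<dots> = (if k = l then 1 else 0)"
      using orth[OF k l] K(2)[OF k] by (cases "k = l") auto
    finally show "(\<Sum>j\<in>L. q k j * q l j) = (if k = l then 1 else 0)" .
  qed (auto simp: K_def L_def)
  moreover have "card K = 2 * i"
    unfolding K_def using i by (subst card_Un_disjoint) auto
  moreover have "card L \<le> 2 * (i - 1)"
  proof -
    have bound: "j \<in> {..<i - 1} \<union> {n..<n + (i - 1)}" if j: "j < 2 * n" "dbl n d j \<le> c i" for j
    proof (rule ccontr)
      assume neg: "\<not> ?thesis"
      define m where "m = (if j < n then j + 1 else j - n + 1)"
      have "i \<le> m" "m \<in> {1..n}"
        using neg j i by (auto simp: m_def)
      then have "d i \<le> d m"
        using i d_mono by (auto simp: mono_on_def)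
      moreover have "dbl n d j = d m"
        by (simp add: dbl_def m_def)
      ultimately show False
        using j less by simp
    qed
    then have "L \<subseteq> {..<i - 1} \<union> {n..<n + (i - 1)}"
      unfolding L_def by blast
    then have "card L \<le> card ({..<i - 1} \<union> {n..<n + (i - 1)})"
      by (intro card_mono) auto
    also have "\<dots> \<le> card {..<i - 1} + card {n..<n + (i - 1)}"
      by (rule card_Un_le)
    finally show ?thesis by simp
  qed
  ultimately show False
    using i by auto
qed

lemma eigenpairs_interlace:
  assumes S: "S \<in> symp_set n n" and D: "S\<^sup>T * A * S = double_diag n d"
    and A: "A \<in> carrier_mat (2 * n) (2 * n)" and Y: "scaled_eigenpairs n p A Y c h"
    and d_pos: "\<And>j. j \<in> {1..n} \<Longrightarrow> 0 < d j" and d_mono: "mono_on {1..n} d" and c_mono: "mono_on {1..p} c"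
    and i: "i \<in> {1..p}" "i \<le> n" and h: "\<And>k. k \<in> {1..i} \<Longrightarrow> 0 < h k"
  shows "d i \<le> c i"
proof -
  define B where "B = (- (symp_J n * (S\<^sup>T * symp_J n))) * Y"
  have S': "S \<in> carrier_mat (2 * n) (2 * n)"
    using S by (auto simp: symp_set_def)
  have Y': "Y \<in> carrier_mat (2 * n) (2 * p)"
    using Y by (simp add: scaled_eigenpairs_def)
  have B: "B \<in> carrier_mat (2 * n) (2 * p)"
    using S' Y' by (auto simp: B_def)
  have "S * B = (S * (- (symp_J n * (S\<^sup>T * symp_J n)))) * Y"
    unfolding B_def by (rule mult_assoc_dim[symmetric]) (use S' Y' in auto)
  then have "S * B = Y"
    using Y' by (simp add: symp_set_inverse(2)[OF S])
  then have "scaled_eigenpairs n p (double_diag n d) B c h"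
    using scaled_eigenpairs_williamson_iff[OF S D A B] Y by simp
  from eigenpairs_interlace_diag[OF this d_pos d_mono c_mono i h] show ?thesis .
qed

section \<open>Existence of minimisers of the penalty problem\<close>

lemma tpm_objective_coordinates:
  fixes x :: "nat \<times> nat \<Rightarrow> real"
  shows "tpm_objective n p (double_diag n d) \<beta> (mat (2 * n) (2 * p) x) =
    1 / 2 * (\<Sum>i<2 * n. \<Sum>j<2 * p. dbl n d i * (x (i, j))\<^sup>2) +
    \<beta> / 4 * (\<Sum>i<2 * p. \<Sum>j<2 * p.
      ((\<Sum>k<2 * n. x (k, i) * (conj_sign n k * x (conj_index n k, j))) - symp_J p $$ (i, j))\<^sup>2)"
proof -
  let ?X = "mat (2 * n) (2 * p) x"
  have conj: "conj_index n k < 2 * n" if "k < 2 * n" for k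
    using that by (auto simp: conj_index_def)
  have "mat_inner ?X (double_diag n d * ?X) = (\<Sum>i<2 * n. \<Sum>j<2 * p. dbl n d i * (x (i, j))\<^sup>2)"
    by (simp add: mat_inner_def double_diag_mult_index power2_eq_square mult_ac del: index_mult_mat(1))
  moreover have "(?X\<^sup>T * symp_J n * ?X - symp_J p) $$ (i, j) =
      (\<Sum>k<2 * n. x (k, i) * (conj_sign n k * x (conj_index n k, j))) - symp_J p $$ (i, j)"
    if "i < 2 * p" "j < 2 * p" for i j
  proof -
    have "(?X\<^sup>T * (symp_J n * ?X)) $$ (i, j) =
        (\<Sum>k<2 * n. x (k, i) * (conj_sign n k * x (conj_index n k, j)))"
      using that conj by (subst mult_index_sum) (simp_all add: symp_J_mult_index del: index_mult_mat(1))
    then show ?thesis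
      using that by (simp add: mult_assoc_dim del: index_mult_mat(1))
  qed
  ultimately show ?thesis
    using tpm_objective_inner[of "double_diag n d" n ?X p \<beta>]
    by (simp add: mat_inner_def[of "_ - _"] power2_eq_square)
qed

text \<open>In Williamson coordinates the quadratic term dominates \<open>d\<^sub>1\<close> times the square of every entry, so
  sublevel sets are bounded.\<close>

lemma tpm_minimum_exists_diag:
  assumes "0 < n" and d_pos: "\<And>j. j \<in> {1..n} \<Longrightarrow> 0 < d j" and d_mono: "mono_on {1..n} d" and "0 < \<beta>"
  shows "\<exists>Y\<in>carrier_mat (2 * n) (2 * p). \<forall>Z\<in>carrier_mat (2 * n) (2 * p).
    tpm_objective n p (double_diag n d) \<beta> Y \<le> tpm_objective n p (double_diag n d) \<beta> Z"
proof -
  define f where "f x = tpm_objective n p (double_diag n d) \<beta> (mat (2 * n) (2 * p) x)"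
    for x :: "nat \<times> nat \<Rightarrow> real"
  define quad where "quad x = (\<Sum>i<2 * n. \<Sum>j<2 * p. dbl n d i * (x (i, j))\<^sup>2)" for x :: "nat \<times> nat \<Rightarrow> real"
  define pen where "pen x = (\<Sum>i<2 * p. \<Sum>j<2 * p.
      ((\<Sum>k<2 * n. x (k, i) * (conj_sign n k * x (conj_index n k, j))) - symp_J p $$ (i, j))\<^sup>2)"
    for x :: "nat \<times> nat \<Rightarrow> real"
  have f: "f x = 1 / 2 * quad x + \<beta> / 4 * pen x" for x
    by (simp add: f_def quad_def pen_def tpm_objective_coordinates)
  have d1: "0 < d 1" "d 1 \<le> dbl n d i" if "i < 2 * n" for i
  proof -
    show "0 < d 1" using assms(1) d_pos by simp
    show "d 1 \<le> dbl n d i"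
      unfolding dbl_def using that assms(1) by (auto intro!: mono_onD[OF d_mono])
  qed
  have term_nonneg: "0 \<le> dbl n d i * (x (i, j))\<^sup>2" if "i < 2 * n" for i j and x :: "nat \<times> nat \<Rightarrow> real"
    using d1[OF that] by simp
  have pen: "0 \<le> \<beta> / 4 * pen x" for x
    using \<open>0 < \<beta>\<close> by (simp add: pen_def sum_nonneg)
  have "\<exists>x\<in>UNIV. \<forall>y\<in>UNIV. f x \<le> f y"
  proof (rule minimum_attained[where I = "{..<2 * n} \<times> {..<2 * p}" and b = 0 and ?x0.0 = "\<lambda>_. 0"
        and B = "2 * (f (\<lambda>_. 0) + 1) / d 1 + 1"])
    fix x :: "nat \<times> nat \<Rightarrow> real"
    have "0 \<le> quad x"
      unfolding quad_def using term_nonneg by (intro sum_nonneg) auto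
    then show "0 \<le> f x"
      using pen[of x] by (simp add: f)
  next
    fix x :: "nat \<times> nat \<Rightarrow> real" and ij
    assume le: "f x \<le> f (\<lambda>_. 0) + 1" and "ij \<in> {..<2 * n} \<times> {..<2 * p}"
    then obtain i j where ij: "ij = (i, j)" "i < 2 * n" "j < 2 * p" by auto
    have "d 1 * (x ij)\<^sup>2 \<le> dbl n d i * (x (i, j))\<^sup>2"
      using d1[OF ij(2)] by (simp add: ij mult_right_mono)
    also have "\<dots> \<le> (\<Sum>j<2 * p. dbl n d i * (x (i, j))\<^sup>2)"
      using ij term_nonneg by (intro member_le_sum[where f = "\<lambda>j. dbl n d i * (x (i, j))\<^sup>2"]) auto
    also have "\<dots> \<le> quad x"
      unfolding quad_def using ij term_nonneg
      by (intro member_le_sum[where f = "\<lambda>i. \<Sum>j<2 * p. dbl n d i * (x (i, j))\<^sup>2"]) (auto intro!: sum_nonneg)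
    also have "\<dots> \<le> 2 * (f (\<lambda>_. 0) + 1)"
      using le pen[of x] by (simp add: f)
    finally have "(x ij)\<^sup>2 \<le> 2 * (f (\<lambda>_. 0) + 1) / d 1"
      using d1[OF ij(2)] by (simp add: field_simps)
    moreover have "\<bar>x ij\<bar> \<le> (x ij)\<^sup>2 + 1"
    proof -
      have "0 \<le> (\<bar>x ij\<bar> - 1)\<^sup>2 + \<bar>x ij\<bar>" by simp
      then show ?thesis by (simp add: power2_eq_square algebra_simps)
    qed
    ultimately show "\<bar>x ij\<bar> \<le> 2 * (f (\<lambda>_. 0) + 1) / d 1 + 1" by linarith
  next
    fix x :: "nat \<Rightarrow> nat \<times> nat \<Rightarrow> real" and l
    assume lim: "\<And>i. i \<in> {..<2 * n} \<times> {..<2 * p} \<Longrightarrow> (\<lambda>k. x k i) \<longlonglongrightarrow> l i"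
    show "(\<lambda>k. f (x k)) \<longlonglongrightarrow> f l"
      unfolding f quad_def pen_def by (intro tendsto_intros lim) (auto simp: conj_index_def)
  qed auto
  then obtain x where x: "\<And>y. f x \<le> f y" by auto
  have "tpm_objective n p (double_diag n d) \<beta> (mat (2 * n) (2 * p) x) \<le> tpm_objective n p (double_diag n d) \<beta> Z"
    if "Z \<in> carrier_mat (2 * n) (2 * p)" for Z
  proof -
    have "mat (2 * n) (2 * p) (\<lambda>ij. Z $$ ij) = Z"
      by (rule eq_matI) (use that in auto)
    then show ?thesis
      using x[of "\<lambda>ij. Z $$ ij"] by (simp add: f_def)
  qed
  then show ?thesis
    by (intro bexI[of _ "mat (2 * n) (2 * p) x"]) auto
qed

lemma tpm_objective_williamson:
  assumes S: "S \<in> symp_set n n" and D: "S\<^sup>T * A * S = double_diag n d"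
    and A: "A \<in> carrier_mat (2 * n) (2 * n)" and B: "B \<in> carrier_mat (2 * n) (2 * p)"
  shows "tpm_objective n p A \<beta> (S * B) = tpm_objective n p (double_diag n d) \<beta> B"
proof -
  have S': "S \<in> carrier_mat (2 * n) (2 * n)" "S\<^sup>T * (symp_J n * S) = symp_J n"
    using S by (auto simp: symp_set_def mult_assoc_dim)
  have [simp]: "dim_row S = 2 * n" "dim_col S = 2 * n" "dim_row A = 2 * n" "dim_col A = 2 * n"
    "dim_row B = 2 * n" "dim_col B = 2 * p"
    using S' A B by auto
  have "mat_inner (S * B) (A * (S * B)) = mat_inner B ((S\<^sup>T * A * S) * B)"
    by (simp add: mat_inner_mult_left mult_assoc_dim)
  moreover have "(S * B)\<^sup>T * symp_J n * (S * B) = B\<^sup>T * ((S\<^sup>T * (symp_J n * S)) * B)"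
    by (simp add: mat_dist)
  ultimately show ?thesis
    using tpm_objective_inner[of "double_diag n d" n B p \<beta>] tpm_objective_inner[OF A, of "S * B" p \<beta>]
      S' A B
    by (simp add: D mult_assoc_dim)
qed

lemma tpm_minimizerD:
  assumes "tpm_minimizer n p A \<beta> X"
  shows "X \<in> carrier_mat (2 * n) (2 * p)"
    and "Z \<in> carrier_mat (2 * n) (2 * p) \<Longrightarrow> tpm_objective n p A \<beta> X \<le> tpm_objective n p A \<beta> Z"
  using assms by (auto simp: tpm_minimizer_def is_arg_min_def not_less)

lemma tpm_minimizerI:
  assumes "X \<in> carrier_mat (2 * n) (2 * p)"
    and "\<And>Z. Z \<in> carrier_mat (2 * n) (2 * p) \<Longrightarrow> tpm_objective n p A \<beta> X \<le> tpm_objective n p A \<beta> Z"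
  shows "tpm_minimizer n p A \<beta> X"
  using assms by (auto simp: tpm_minimizer_def is_arg_min_def not_less)

lemma tpm_minimizer_exists:
  assumes "0 < n" and S: "S \<in> symp_set n n" and D: "S\<^sup>T * A * S = double_diag n d"
    and A: "A \<in> carrier_mat (2 * n) (2 * n)"
    and "\<And>j. j \<in> {1..n} \<Longrightarrow> 0 < d j" and "mono_on {1..n} d" and "0 < \<beta>"
  shows "\<exists>X. tpm_minimizer n p A \<beta> X"
proof -
  obtain Y where Y: "Y \<in> carrier_mat (2 * n) (2 * p)"
    and min: "\<And>Z. Z \<in> carrier_mat (2 * n) (2 * p) \<Longrightarrow>
      tpm_objective n p (double_diag n d) \<beta> Y \<le> tpm_objective n p (double_diag n d) \<beta> Z"
    using tpm_minimum_exists_diag[of n d \<beta> p] assms by blast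
  have S': "S \<in> carrier_mat (2 * n) (2 * n)"
    using S by (auto simp: symp_set_def)
  have "tpm_minimizer n p A \<beta> (S * Y)"
  proof (rule tpm_minimizerI)
    fix Z :: "real mat" assume Z: "Z \<in> carrier_mat (2 * n) (2 * p)"
    define B where "B = (- (symp_J n * (S\<^sup>T * symp_J n))) * Z"
    have B: "B \<in> carrier_mat (2 * n) (2 * p)"
      using S' Z by (auto simp: B_def)
    have "S * B = (S * (- (symp_J n * (S\<^sup>T * symp_J n)))) * Z"
      unfolding B_def by (rule mult_assoc_dim[symmetric]) (use S' Z in auto)
    then have "S * B = Z"
      using Z by (simp add: symp_set_inverse(2)[OF S])
    then show "tpm_objective n p A \<beta> (S * Y) \<le> tpm_objective n p A \<beta> Z"
      using min[OF B] tpm_objective_williamson[OF S D A, of _ p \<beta>] Y B by metis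
  qed (use S' Y in auto)
  then show ?thesis by blast
qed


section \<open>Critical points\<close>

lemma tpm_objective_expansion:
  assumes A: "A \<in> carrier_mat (2 * n) (2 * n)" "A\<^sup>T = A"
    and X: "X \<in> carrier_mat (2 * n) (2 * p)" and V: "V \<in> carrier_mat (2 * n) (2 * p)"
  defines "N \<equiv> X\<^sup>T * (symp_J n * X) - symp_J p"
    and "L \<equiv> V\<^sup>T * (symp_J n * X) + X\<^sup>T * (symp_J n * V)" and "Q \<equiv> V\<^sup>T * (symp_J n * V)"
  shows "tpm_objective n p A \<beta> (X + s \<cdot>\<^sub>m V) = tpm_objective n p A \<beta> X +
    (mat_inner V (A * X) + \<beta> / 2 * mat_inner N L) * s +
    (1 / 2 * mat_inner V (A * V) + \<beta> / 4 * (mat_inner L L + 2 * mat_inner N Q)) * s\<^sup>2 +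
    \<beta> / 2 * mat_inner L Q * s ^ 3 + \<beta> / 4 * mat_inner Q Q * s ^ 4"
proof -
  have [simp]: "dim_row X = 2 * n" "dim_col X = 2 * p" "dim_row V = 2 * n" "dim_col V = 2 * p"
    "dim_row A = 2 * n" "dim_col A = 2 * n"
    using A X V by auto
  have [simp]: "dim_row N = 2 * p" "dim_col N = 2 * p" "dim_row L = 2 * p" "dim_col L = 2 * p"
    "dim_row Q = 2 * p" "dim_col Q = 2 * p"
    by (simp_all add: N_def L_def Q_def)
  have XV: "X + s \<cdot>\<^sub>m V \<in> carrier_mat (2 * n) (2 * p)"
    using X V by simp
  have "mat_inner X (A * V) = mat_inner V (A * X)"
    using A(2) mat_inner_mult_left[of A X V] by (simp add: mat_inner_commute)
  then have quad: "mat_inner (X + s \<cdot>\<^sub>m V) (A * (X + s \<cdot>\<^sub>m V)) =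
      mat_inner X (A * X) + 2 * mat_inner V (A * X) * s + mat_inner V (A * V) * s\<^sup>2"
    by (simp add: mat_ring mat_inner_linear power2_eq_square algebra_simps)
  have "(X + s \<cdot>\<^sub>m V)\<^sup>T * symp_J n * (X + s \<cdot>\<^sub>m V) - symp_J p = (N + s \<cdot>\<^sub>m L) + s\<^sup>2 \<cdot>\<^sub>m Q"
    by (rule eq_matI)
      (simp_all add: N_def L_def Q_def mat_ring power2_eq_square algebra_simps del: index_mult_mat(1))
  moreover have "mat_inner ((N + s \<cdot>\<^sub>m L) + s\<^sup>2 \<cdot>\<^sub>m Q) ((N + s \<cdot>\<^sub>m L) + s\<^sup>2 \<cdot>\<^sub>m Q) =
      mat_inner N N + 2 * mat_inner N L * s + (mat_inner L L + 2 * mat_inner N Q) * s\<^sup>2 +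
      2 * mat_inner L Q * s ^ 3 + mat_inner Q Q * s ^ 4"
    by (simp add: mat_inner_linear mat_inner_commute[of L N] mat_inner_commute[of Q N]
        mat_inner_commute[of Q L] power2_eq_square power3_eq_cube power4_eq_xxxx algebra_simps)
  ultimately show ?thesis
    using quad unfolding tpm_objective_inner[OF A(1) XV] tpm_objective_inner[OF A(1) X]
    by (simp add: N_def mult_assoc_dim algebra_simps)
qed

text \<open>Moving along the gradient \<open>A X - \<beta> J X (X\<^sup>T J X - J)\<close> itself changes the objective at the
  rate of its squared norm.\<close>

lemma tpm_minimizer_critical:
  assumes A: "A \<in> carrier_mat (2 * n) (2 * n)" "A\<^sup>T = A" and min: "tpm_minimizer n p A \<beta> X"
  shows "A * X = \<beta> \<cdot>\<^sub>m (symp_J n * (X * (X\<^sup>T * (symp_J n * X) - symp_J p)))"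
proof -
  have X: "X \<in> carrier_mat (2 * n) (2 * p)"
    using tpm_minimizerD[OF min] by blast
  define N where "N = X\<^sup>T * (symp_J n * X) - symp_J p"
  define V where "V = A * X - \<beta> \<cdot>\<^sub>m (symp_J n * (X * N))"
  define L where "L = V\<^sup>T * (symp_J n * X) + X\<^sup>T * (symp_J n * V)"
  define Q where "Q = V\<^sup>T * (symp_J n * V)"
  have [simp]: "dim_row X = 2 * n" "dim_col X = 2 * p" "dim_row A = 2 * n" "dim_col A = 2 * n"
    using A X by auto
  have [simp]: "dim_row N = 2 * p" "dim_col N = 2 * p" "dim_row V = 2 * n" "dim_col V = 2 * p"
    by (simp_all add: N_def V_def)
  have V: "V \<in> carrier_mat (2 * n) (2 * p)"
    by (rule carrier_matI) simp_all
  have skew: "N\<^sup>T = - N"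
    by (rule eq_matI) (simp_all add: N_def mat_dist symp_J_transpose del: index_mult_mat(1))
  have "mat_inner N (V\<^sup>T * (symp_J n * X)) = mat_inner (V * N) (symp_J n * X)"
    by (simp add: mat_inner_mult_left mat_inner_commute[of N])
  also have "\<dots> = - mat_inner V (symp_J n * (X * N))"
    by (simp add: mat_inner_mult_right skew mat_dist mat_inner_linear)
  finally have 1: "mat_inner N (V\<^sup>T * (symp_J n * X)) = - mat_inner V (symp_J n * (X * N))" .
  have "mat_inner N (X\<^sup>T * (symp_J n * V)) = mat_inner (symp_J n * V) (X * N)"
    by (simp add: mat_inner_commute[of N] mat_inner_mult_left[of "X\<^sup>T"])
  also have "\<dots> = - mat_inner V (symp_J n * (X * N))"
    by (simp add: mat_inner_mult_left symp_J_transpose mat_inner_linear)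
  finally have 2: "mat_inner N (X\<^sup>T * (symp_J n * V)) = - mat_inner V (symp_J n * (X * N))" .
  have slope: "mat_inner V (A * X) + \<beta> / 2 * mat_inner N L = mat_inner V V"
  proof -
    have "mat_inner V V = mat_inner V (A * X) - \<beta> * mat_inner V (symp_J n * (X * N))"
      by (subst (2) V_def) (simp add: mat_inner_linear)
    moreover have "mat_inner N L = - 2 * mat_inner V (symp_J n * (X * N))"
      using 1 2 by (simp add: L_def mat_inner_linear)
    ultimately show ?thesis by simp
  qed
  define a2 where "a2 = 1 / 2 * mat_inner V (A * V) + \<beta> / 4 * (mat_inner L L + 2 * mat_inner N Q)"
  define a3 where "a3 = \<beta> / 2 * mat_inner L Q"
  define a4 where "a4 = \<beta> / 4 * mat_inner Q Q"
  have "mat_inner V V = 0"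
  proof (rule linear_term_zero[of 1 _ "a2 + \<bar>a3\<bar> + \<bar>a4\<bar>"])
    fix s :: real assume s: "\<bar>s\<bar> \<le> 1"
    have "tpm_objective n p A \<beta> X \<le> tpm_objective n p A \<beta> (X + s \<cdot>\<^sub>m V)"
      using tpm_minimizerD(2)[OF min] X V by simp
    then have "0 \<le> mat_inner V V * s + a2 * s\<^sup>2 + a3 * s ^ 3 + a4 * s ^ 4"
      using tpm_objective_expansion[OF A X V, of \<beta> s] slope
      by (simp add: N_def L_def Q_def a2_def a3_def a4_def)
    moreover have "a3 * s ^ 3 \<le> \<bar>a3\<bar> * s\<^sup>2"
    proof -
      have "a3 * s ^ 3 \<le> \<bar>a3\<bar> * \<bar>s ^ 3\<bar>"
        by (metis abs_ge_self abs_mult)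
      also have "\<bar>s ^ 3\<bar> = \<bar>s\<bar> * s\<^sup>2"
        by (simp add: power3_eq_cube power2_eq_square abs_mult)
      also have "\<dots> \<le> s\<^sup>2"
        using s by (simp add: mult_left_le_one_le)
      finally show ?thesis by (simp add: mult_left_mono)
    qed
    moreover have "a4 * s ^ 4 \<le> \<bar>a4\<bar> * s\<^sup>2"
    proof -
      have "s ^ 4 \<le> s\<^sup>2"
        using s power_decreasing[of 2 4 "\<bar>s\<bar>"] by simp
      moreover have "a4 * s ^ 4 \<le> \<bar>a4\<bar> * s ^ 4"
        by (intro mult_right_mono) auto
      ultimately show ?thesis
        by (meson abs_ge_zero mult_left_mono order_trans)
    qed
    ultimately show "0 \<le> mat_inner V V * s + (a2 + \<bar>a3\<bar> + \<bar>a4\<bar>) * s\<^sup>2"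
      by (simp add: algebra_simps)
  qed simp
  then have V0: "V = 0\<^sub>m (2 * n) (2 * p)"
    using mat_inner_self_eq_0[of V] by simp
  show ?thesis
  proof (rule eq_matI)
    fix i j
    assume "i < dim_row (\<beta> \<cdot>\<^sub>m (symp_J n * (X * (X\<^sup>T * (symp_J n * X) - symp_J p))))"
      and "j < dim_col (\<beta> \<cdot>\<^sub>m (symp_J n * (X * (X\<^sup>T * (symp_J n * X) - symp_J p))))"
    then have ij: "i < 2 * n" "j < 2 * p" by auto
    have "V $$ (i, j) = 0"
      using ij by (simp add: V0)
    then show "(A * X) $$ (i, j) = (\<beta> \<cdot>\<^sub>m (symp_J n * (X * (X\<^sup>T * (symp_J n * X) - symp_J p)))) $$ (i, j)"
      using ij by (simp add: V_def N_def del: index_mult_mat(1))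
  qed simp_all
qed

text \<open>Both problems have a first-order condition \<open>A X = J X J\<^sup>T G\<close> with a symmetric multiplier \<open>G\<close>
  commuting with \<open>J\<close>, where \<open>\<gamma> = 1 / \<beta>\<close> for the penalty problem and \<open>\<gamma> = 0\<close> for the constrained
  one. An orthogonal symplectic change of columns diagonalises \<open>G\<close>.\<close>

lemma symmetric_multiplier_diagonalisation:
  assumes A: "A \<in> carrier_mat (2 * n) (2 * n)" and X: "X \<in> carrier_mat (2 * n) (2 * p)"
    and G: "G \<in> carrier_mat (2 * p) (2 * p)" "G\<^sup>T = G" "G * symp_J p = symp_J p * G"
    and AX: "A * X = - (symp_J n * (X * (symp_J p * G)))"
    and form: "X\<^sup>T * (symp_J n * X) = symp_J p * (1\<^sub>m (2 * p) - \<gamma> \<cdot>\<^sub>m G)"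
  shows "\<exists>T\<in>or_symp_set p. \<exists>c. mono_on {1..p} c \<and> scaled_eigenpairs n p A (X * T) c (\<lambda>i. 1 - \<gamma> * c i)"
proof -
  obtain T c where T: "T \<in> or_symp_set p" and c: "mono_on {1..p} c" and diag: "T\<^sup>T * G * T = double_diag p c"
    using symp_J_commuting_diagonalisation[OF G] by blast
  note T' = or_symp_setD[OF T]
  have [simp]: "dim_row X = 2 * n" "dim_col X = 2 * p" "dim_row A = 2 * n" "dim_col A = 2 * n"
    "dim_row T = 2 * p" "dim_col T = 2 * p" "dim_row G = 2 * p" "dim_col G = 2 * p"
    using A X T' G by auto
  have GT: "G * T = T * double_diag p c"
  proof -
    have "T * double_diag p c = (T * T\<^sup>T) * (G * T)"
      by (simp add: mult_assoc_dim flip: diag)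
    then show ?thesis by (simp add: T'(3))
  qed
  have JTC: "symp_J p * (T * C) = T * (symp_J p * C)" if "dim_row C = 2 * p" for C
    using that T'(4) by (simp flip: mult_assoc_dim)
  have "A * (X * T) = (A * X) * T"
    by (simp add: mult_assoc_dim)
  also have "\<dots> = - (symp_J n * ((X * T) * (symp_J p * double_diag p c)))"
    unfolding AX by (simp add: mat_dist GT JTC)
  finally have 1: "A * (X * T) = - (symp_J n * ((X * T) * (symp_J p * double_diag p c)))" .
  have "(X * T)\<^sup>T * (symp_J n * (X * T)) = T\<^sup>T * ((X\<^sup>T * (symp_J n * X)) * T)"
    by (simp add: mat_dist)
  also have "\<dots> = T\<^sup>T * (symp_J p * (T - \<gamma> \<cdot>\<^sub>m (G * T)))"
    unfolding form by (simp add: mat_ring)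
  also have "T - \<gamma> \<cdot>\<^sub>m (G * T) = T * (1\<^sub>m (2 * p) - \<gamma> \<cdot>\<^sub>m double_diag p c)"
    by (simp add: GT mat_ring)
  also have "T\<^sup>T * (symp_J p * (T * (1\<^sub>m (2 * p) - \<gamma> \<cdot>\<^sub>m double_diag p c))) =
      (T\<^sup>T * T) * (symp_J p * (1\<^sub>m (2 * p) - \<gamma> \<cdot>\<^sub>m double_diag p c))"
    by (simp add: JTC mult_assoc_dim)
  also have "1\<^sub>m (2 * p) - \<gamma> \<cdot>\<^sub>m double_diag p c = double_diag p (\<lambda>i. 1 - \<gamma> * c i)"
    by (simp add: double_diag_smult double_diag_diff flip: double_diag_one)
  also have "(T\<^sup>T * T) * (symp_J p * double_diag p (\<lambda>i. 1 - \<gamma> * c i)) =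
      symp_J p * double_diag p (\<lambda>i. 1 - \<gamma> * c i)"
    by (simp add: T'(2))
  finally have "scaled_eigenpairs n p A (X * T) c (\<lambda>i. 1 - \<gamma> * c i)"
    using 1 by (simp add: scaled_eigenpairs_def carrier_matI)
  with T c show ?thesis by blast
qed

text \<open>At a critical point \<open>X\<^sup>T A X = \<beta> M (M - J)\<close> with \<open>M = X\<^sup>T J X\<close> skew-symmetric. The left-hand
  side is symmetric, which forces \<open>M\<close> to commute with \<open>J\<close>.\<close>

lemma tpm_minimizer_eigenpairs:
  assumes A: "A \<in> carrier_mat (2 * n) (2 * n)" "A\<^sup>T = A" and min: "tpm_minimizer n p A \<beta> X" and "0 < \<beta>"
  shows "\<exists>T\<in>or_symp_set p. \<exists>c. mono_on {1..p} c \<and> scaled_eigenpairs n p A (X * T) c (\<lambda>i. 1 - c i / \<beta>)"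
proof -
  have X: "X \<in> carrier_mat (2 * n) (2 * p)"
    using tpm_minimizerD[OF min] by blast
  define M where "M = X\<^sup>T * (symp_J n * X)"
  define N where "N = M - symp_J p"
  define G where "G = \<beta> \<cdot>\<^sub>m (symp_J p * N)"
  have [simp]: "dim_row X = 2 * n" "dim_col X = 2 * p" "dim_row A = 2 * n" "dim_col A = 2 * n"
    using A X by auto
  have [simp]: "dim_row M = 2 * p" "dim_col M = 2 * p" "dim_row N = 2 * p" "dim_col N = 2 * p"
    "dim_row G = 2 * p" "dim_col G = 2 * p"
    by (simp_all add: M_def N_def G_def)
  have AX: "A * X = \<beta> \<cdot>\<^sub>m (symp_J n * (X * N))"
    using tpm_minimizer_critical[OF A min] by (simp add: N_def M_def)
  have M_skew: "M\<^sup>T = - M"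
    by (simp add: M_def mat_dist symp_J_transpose)
  have N_skew: "N\<^sup>T = - N"
    by (rule eq_matI) (simp_all add: N_def transpose_minus_dim M_skew symp_J_transpose)
  have gram: "X\<^sup>T * (A * X) = \<beta> \<cdot>\<^sub>m (M * N)"
    unfolding AX by (simp add: M_def mat_dist)
  have "(X\<^sup>T * (A * X))\<^sup>T = X\<^sup>T * (A * X)"
    using A(2) by (simp add: mat_dist)
  then have sym: "\<beta> \<cdot>\<^sub>m (N * M) = \<beta> \<cdot>\<^sub>m (M * N)"
    unfolding gram by (simp add: mat_dist M_skew N_skew)
  have MJ: "M * symp_J p = symp_J p * M"
  proof (rule eq_matI)
    fix i j assume "i < dim_row (symp_J p * M)" "j < dim_col (symp_J p * M)"
    then have ij: "i < 2 * p" "j < 2 * p" by auto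
    have "(\<beta> \<cdot>\<^sub>m (N * M)) $$ (i, j) = (\<beta> \<cdot>\<^sub>m (M * N)) $$ (i, j)"
      by (simp only: sym)
    then have "(N * M) $$ (i, j) = (M * N) $$ (i, j)"
      using ij \<open>0 < \<beta>\<close> by (simp del: index_mult_mat(1))
    then show "(M * symp_J p) $$ (i, j) = (symp_J p * M) $$ (i, j)"
      using ij by (simp add: N_def mat_ring del: index_mult_mat(1))
  qed simp_all
  have NJ: "N * symp_J p = symp_J p * N"
    by (simp add: N_def mat_ring MJ)
  have G_sym: "G\<^sup>T = G"
    by (simp add: G_def mat_dist N_skew symp_J_transpose NJ)
  have GJ: "G * symp_J p = symp_J p * G"
    by (simp add: G_def mat_dist NJ)
  have JG: "symp_J p * G = - (\<beta> \<cdot>\<^sub>m N)"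
    by (rule eq_matI) (simp_all add: G_def mat_dist symp_J_symp_J_mult)
  have "A * X = - (symp_J n * (X * (symp_J p * G)))"
    unfolding JG AX by (rule eq_matI) (simp_all add: mat_dist del: index_mult_mat(1))
  moreover have "X\<^sup>T * (symp_J n * X) = symp_J p * (1\<^sub>m (2 * p) - (1 / \<beta>) \<cdot>\<^sub>m G)"
  proof -
    have "symp_J p * (1\<^sub>m (2 * p) - (1 / \<beta>) \<cdot>\<^sub>m G) = symp_J p - (1 / \<beta>) \<cdot>\<^sub>m (symp_J p * G)"
      by (simp add: mat_ring)
    also have "\<dots> = M"
      unfolding JG using \<open>0 < \<beta>\<close> by (intro eq_matI) (simp_all add: N_def)
    finally show ?thesis by (simp add: M_def)
  qed
  ultimately show ?thesis
    using symmetric_multiplier_diagonalisation[OF A(1) X _ G_sym GJ, of "1 / \<beta>"]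
    by (simp add: carrier_matI)
qed

section \<open>Global minimisers of the penalty problem\<close>

locale williamson_form =
  fixes n :: nat and A :: "real mat" and d :: "nat \<Rightarrow> real" and S :: "real mat"
  assumes A_pos_def: "positive_definite (2 * n) A"
    and S_symp: "S \<in> symp_set n n" and S_diag: "S\<^sup>T * A * S = double_diag n d"
    and d_pos: "\<And>j. j \<in> {1..n} \<Longrightarrow> 0 < d j" and d_mono: "mono_on {1..n} d"
begin

lemma A_carrier: "A \<in> carrier_mat (2 * n) (2 * n)" and A_sym: "A\<^sup>T = A"
  using A_pos_def by (auto simp: positive_definite_def)

lemma A_dim [simp]: "dim_row A = 2 * n" "dim_col A = 2 * n"
  using A_carrier by auto

lemma gram_diag_nonneg:
  assumes "Y \<in> carrier_mat (2 * n) q" and "k < q"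
  shows "0 \<le> (Y\<^sup>T * (A * Y)) $$ (k, k)"
proof -
  have "(Y\<^sup>T * (A * Y)) $$ (k, k) = col Y k \<bullet> (A *\<^sub>v col Y k)"
  proof -
    have "col (A * Y) k = A *\<^sub>v col Y k"
      using assms A_carrier by (intro col_mult2) auto
    then show ?thesis
      using assms by simp
  qed
  moreover have "0 \<le> v \<bullet> (A *\<^sub>v v)" if "v \<in> carrier_vec (2 * n)" for v
    using A_pos_def that A_carrier
    by (cases "v = 0\<^sub>v (2 * n)") (auto simp: positive_definite_def less_imp_le)
  ultimately show ?thesis
    using assms by simp
qed

text \<open>The diagonal of \<open>X\<^sup>T A X\<close> consists of the values \<open>\<beta> (1 - h\<^sub>i) h\<^sub>i\<close>, so \<open>0 \<le> h\<^sub>i \<le> 1\<close>. If \<open>h\<^sub>i > 0\<close>,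
  then also \<open>h\<^sub>k > 0\<close> for \<open>k \<le> i\<close> because \<open>c\<close> is increasing, and the interlacing inequality
  \<open>d\<^sub>i \<le> c\<^sub>i = \<beta> (1 - h\<^sub>i)\<close> applies. The upper bound is the minimiser of
  \<open>d\<^sub>i h + \<beta> / 2 (h - 1)\<^sup>2\<close> over \<open>h \<ge> 0\<close>.\<close>

lemma tpm_minimizer_weights:
  assumes min: "tpm_minimizer n p A \<beta> X" and "0 < \<beta>" and "p \<le> n"
  shows "\<exists>T\<in>or_symp_set p. \<exists>h. scaled_eigenpairs n p A (X * T) (\<lambda>i. \<beta> * (1 - h i)) h \<and>
    (\<forall>i\<in>{1..p}. 0 \<le> h i \<and> h i \<le> max 0 (1 - d i / \<beta>))"
proof -
  obtain T c where T: "T \<in> or_symp_set p" and c_mono: "mono_on {1..p} c"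
    and pairs: "scaled_eigenpairs n p A (X * T) c (\<lambda>i. 1 - c i / \<beta>)"
    using tpm_minimizer_eigenpairs[OF A_carrier A_sym min \<open>0 < \<beta>\<close>] by blast
  define h where "h i = 1 - c i / \<beta>" for i
  have c: "c i = \<beta> * (1 - h i)" for i
    using \<open>0 < \<beta>\<close> by (simp add: h_def)
  have pairs': "scaled_eigenpairs n p A (X * T) c h"
    using pairs by (simp add: h_def[abs_def])
  have "0 \<le> h i \<and> h i \<le> max 0 (1 - d i / \<beta>)" if i: "i \<in> {1..p}" for i
  proof
    have "0 \<le> ((X * T)\<^sup>T * (A * (X * T))) $$ (i - 1, i - 1)"
      by (rule gram_diag_nonneg[where q = "2 * p"])
        (use i pairs' in \<open>auto simp: scaled_eigenpairs_def\<close>)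
    also have "\<dots> = c i * h i"
      using i unfolding scaled_eigenpairs_gram[OF pairs'] by (subst double_diag_index) (auto simp: dbl_def)
    finally have "0 \<le> (1 - h i) * h i"
      using \<open>0 < \<beta>\<close> by (simp add: c zero_le_mult_iff mult_le_0_iff)
    then show h_nonneg: "0 \<le> h i"
      by (auto simp: zero_le_mult_iff)
    show "h i \<le> max 0 (1 - d i / \<beta>)"
    proof (cases "h i = 0")
      case False
      have "0 < h k" if "k \<in> {1..i}" for k
      proof -
        have "c k \<le> c i"
          using that i by (intro mono_onD[OF c_mono]) auto
        then have "h i \<le> h k"
          using \<open>0 < \<beta>\<close> by (simp add: h_def divide_right_mono)
        then show ?thesis
          using False h_nonneg by simp
      qed
      then have "d i \<le> c i"
        using i \<open>p \<le> n\<close>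
        by (intro eigenpairs_interlace[OF S_symp S_diag A_carrier pairs' d_pos d_mono c_mono]) auto
      then have "d i / \<beta> \<le> c i / \<beta>"
        using \<open>0 < \<beta>\<close> by (simp add: divide_right_mono)
      then show ?thesis
        by (simp add: h_def)
    qed simp
  qed
  moreover have "scaled_eigenpairs n p A (X * T) (\<lambda>i. \<beta> * (1 - h i)) h"
    by (rule scaled_eigenpairs_cong[OF pairs']) (simp_all add: c)
  ultimately show ?thesis
    using T by blast
qed

lemma tpm_value:
  assumes "scaled_eigenpairs n p A Y d (\<lambda>i. 1 - d i / \<beta>)" and "0 < \<beta>"
  shows "tpm_objective n p A \<beta> Y = (\<Sum>i=1..p. d i) - (\<Sum>i=1..p. (d i)\<^sup>2) / (2 * \<beta>)"
proof -
  have "tpm_objective n p A \<beta> Y = (\<Sum>i=1..p. d i - (d i)\<^sup>2 / (2 * \<beta>))"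
    unfolding tpm_objective_scaled_eigenpairs[OF assms(1) A_carrier]
    using \<open>0 < \<beta>\<close> by (intro sum.cong) (auto simp: field_simps power2_eq_square)
  then show ?thesis
    by (simp add: sum_subtractf sum_divide_distrib)
qed

lemma d_le: "i \<in> {1..p} \<Longrightarrow> p \<le> n \<Longrightarrow> d i \<le> d p"
  by (rule mono_onD[OF d_mono]) auto

text \<open>The value at a critical point is \<open>\<beta> / 2\<close> times the sum of \<open>1 - h\<^sub>i\<^sup>2\<close>. The scaled pairs of the
  Williamson basis attain the upper bounds for all \<open>h\<^sub>i\<close> at once, so a minimiser must attain them
  too.\<close>

lemma tpm_minimizer_form:
  assumes min: "tpm_minimizer n p A \<beta> X" and "0 < p" and "p \<le> n" and \<beta>: "d p < \<beta>"
  shows "\<exists>T\<in>or_symp_set p. scaled_eigenpairs n p A (X * T) d (\<lambda>i. 1 - d i / \<beta>)"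
proof -
  have "0 < d p"
    using d_pos assms by simp
  then have "0 < \<beta>"
    using \<beta> by simp
  obtain T h where T: "T \<in> or_symp_set p"
    and pairs: "scaled_eigenpairs n p A (X * T) (\<lambda>i. \<beta> * (1 - h i)) h"
    and h: "\<And>i. i \<in> {1..p} \<Longrightarrow> 0 \<le> h i" "\<And>i. i \<in> {1..p} \<Longrightarrow> h i \<le> max 0 (1 - d i / \<beta>)"
    using tpm_minimizer_weights[OF min \<open>0 < \<beta>\<close> \<open>p \<le> n\<close>] by blast
  define g where "g i = 1 - d i / \<beta>" for i
  have g: "0 < g i" if "i \<in> {1..p}" for i
    using d_le[OF that \<open>p \<le> n\<close>] \<beta> \<open>0 < \<beta>\<close> by (simp add: g_def)
  have hg: "h i \<le> g i" if "i \<in> {1..p}" for i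
    using h(2)[OF that] g[OF that] by (simp add: g_def)
  have sq: "(h i)\<^sup>2 \<le> (g i)\<^sup>2" if "i \<in> {1..p}" for i
    using h(1)[OF that] hg[OF that] by (rule power_mono[rotated])
  obtain E where E: "scaled_eigenpairs n p A E d (\<lambda>_. 1)"
    using first_eigenpairs_exist[OF S_symp S_diag A_carrier \<open>p \<le> n\<close>] by blast
  have Y: "scaled_eigenpairs n p A (E * double_diag p (\<lambda>i. sqrt (g i))) d g"
    by (rule scaled_eigenpairs_cong[OF scaled_eigenpairs_mult_double_diag[OF E A_carrier, of "\<lambda>i. sqrt (g i)"]])
      (use g in \<open>auto simp: less_imp_le\<close>)
  have X: "X \<in> carrier_mat (2 * n) (2 * p)"
    using tpm_minimizerD(1)[OF min] .
  have "(\<Sum>i=1..p. \<beta> / 2 * (1 - (h i)\<^sup>2)) = tpm_objective n p A \<beta> (X * T)"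
    unfolding tpm_objective_scaled_eigenpairs[OF pairs A_carrier]
    by (intro sum.cong) (auto simp: algebra_simps power2_eq_square)
  also have "\<dots> = tpm_objective n p A \<beta> X"
    by (rule objective_or_symp_invariant(2)[OF T X A_carrier])
  also have "\<dots> \<le> tpm_objective n p A \<beta> (E * double_diag p (\<lambda>i. sqrt (g i)))"
    using Y by (intro tpm_minimizerD(2)[OF min]) (simp add: scaled_eigenpairs_def)
  also have "\<dots> = (\<Sum>i=1..p. \<beta> / 2 * (1 - (g i)\<^sup>2))"
    unfolding tpm_objective_scaled_eigenpairs[OF Y A_carrier]
    using \<open>0 < \<beta>\<close> by (intro sum.cong) (auto simp: g_def field_simps power2_eq_square)
  finally have "(\<Sum>i=1..p. \<beta> / 2 * ((g i)\<^sup>2 - (h i)\<^sup>2)) \<le> 0"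
    by (simp add: right_diff_distrib sum_subtractf)
  then have "(\<Sum>i=1..p. \<beta> / 2 * ((g i)\<^sup>2 - (h i)\<^sup>2)) = 0"
    using sq \<open>0 < \<beta>\<close> by (intro antisym sum_nonneg) auto
  then have "\<forall>i\<in>{1..p}. \<beta> / 2 * ((g i)\<^sup>2 - (h i)\<^sup>2) = 0"
    using sq \<open>0 < \<beta>\<close> by (subst (asm) sum_nonneg_eq_0_iff) auto
  then have "(g i)\<^sup>2 = (h i)\<^sup>2" if "i \<in> {1..p}" for i
    using that \<open>0 < \<beta>\<close> by auto
  then have "h i = g i" if "i \<in> {1..p}" for i
    using that h(1)[OF that] g[OF that] by (metis less_imp_le power2_eq_imp_eq)
  then have "scaled_eigenpairs n p A (X * T) d (\<lambda>i. 1 - d i / \<beta>)"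
    using \<open>0 < \<beta>\<close> by (intro scaled_eigenpairs_cong[OF pairs]) (auto simp: g_def)
  with T show ?thesis by blast
qed

lemma tpm_minimum:
  assumes "0 < p" and "p \<le> n" and "d p < \<beta>" and Z: "Z \<in> carrier_mat (2 * n) (2 * p)"
  shows "(\<Sum>i=1..p. d i) - (\<Sum>i=1..p. (d i)\<^sup>2) / (2 * \<beta>) \<le> tpm_objective n p A \<beta> Z"
proof -
  have "0 < d p"
    using d_pos assms by simp
  then have "0 < \<beta>"
    using assms by simp
  obtain X where X: "tpm_minimizer n p A \<beta> X"
    using tpm_minimizer_exists[OF _ S_symp S_diag A_carrier d_pos d_mono \<open>0 < \<beta>\<close>, of p] assms by auto
  obtain T where T: "T \<in> or_symp_set p" "scaled_eigenpairs n p A (X * T) d (\<lambda>i. 1 - d i / \<beta>)"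
    using tpm_minimizer_form[OF X assms(1-3)] by blast
  show ?thesis
    using tpm_value[OF T(2) \<open>0 < \<beta>\<close>] tpm_minimizerD(2)[OF X Z]
      objective_or_symp_invariant(2)[OF T(1) tpm_minimizerD(1)[OF X] A_carrier, of \<beta>]
    by simp
qed

lemma scaled_eigenpairs_tpm_minimizer:
  assumes "scaled_eigenpairs n p A Y d (\<lambda>i. 1 - d i / \<beta>)" and "0 < p" and "p \<le> n" and "d p < \<beta>"
  shows "tpm_minimizer n p A \<beta> Y"
proof (rule tpm_minimizerI)
  have "0 < \<beta>"
    using d_pos[of p] assms by simp
  show "tpm_objective n p A \<beta> Y \<le> tpm_objective n p A \<beta> Z" if "Z \<in> carrier_mat (2 * n) (2 * p)" for Z
    using tpm_minimum[OF assms(2-4) that] tpm_value[OF assms(1) \<open>0 < \<beta>\<close>] by simp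
qed (use assms in \<open>simp add: scaled_eigenpairs_def\<close>)


section \<open>Global minimisers of the constrained problem\<close>

text \<open>A feasible point has no penalty, so its value bounds the minimum of the penalty problem from
  above for every \<open>\<beta>\<close>, and these minima tend to the sum of the \<open>d\<^sub>i\<close> as \<open>\<beta>\<close> grows.\<close>

lemma cop_minimum:
  assumes "0 < p" and "p \<le> n" and X: "X \<in> symp_set p n"
  shows "(\<Sum>i=1..p. d i) \<le> cop_objective A X"
proof (rule ccontr)
  let ?s = "\<Sum>i=1..p. d i" and ?q = "\<Sum>i=1..p. (d i)\<^sup>2"
  assume "\<not> ?s \<le> cop_objective A X"
  define \<delta> where "\<delta> = ?s - cop_objective A X"
  have \<delta>: "0 < \<delta>"
    using \<open>\<not> ?s \<le> cop_objective A X\<close> by (simp add: \<delta>_def)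
  define \<beta> where "\<beta> = d p + ?q / \<delta> + 1"
  have "0 < d p"
    using d_pos assms by simp
  moreover have q: "0 \<le> ?q / \<delta>"
    using \<delta> by (simp add: sum_nonneg)
  ultimately have \<beta>: "d p < \<beta>" "?q / \<delta> < \<beta>" "0 < \<beta>"
    by (auto simp: \<beta>_def)
  have X': "X \<in> carrier_mat (2 * n) (2 * p)" "X\<^sup>T * symp_J n * X = symp_J p"
    using X by (auto simp: symp_set_def)
  have "tpm_objective n p A \<beta> X = cop_objective A X"
    using tpm_objective_inner[OF A_carrier X'(1), of \<beta>] cop_objective_inner[OF A_carrier X'(1)]
    by (simp add: X'(2) mat_inner_def)
  then have "?s - ?q / (2 * \<beta>) \<le> cop_objective A X"
    using tpm_minimum[OF assms(1,2) \<beta>(1) X'(1)] by simp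
  then have "\<delta> \<le> ?q / (2 * \<beta>)"
    by (simp add: \<delta>_def)
  then have "2 * \<beta> * \<delta> \<le> ?q"
    using \<beta> by (simp add: field_simps)
  moreover have "?q < \<beta> * \<delta>"
    using \<beta>(2) \<delta> by (simp add: field_simps)
  moreover have "0 < \<beta> * \<delta>"
    using \<beta> \<delta> by simp
  ultimately show False
    by simp
qed

text \<open>A step of length \<open>s\<close> in a tangent direction of the constraint set violates the constraint only to
  order \<open>s\<^sup>2\<close>, so with \<open>\<beta> = 1 / s\<^sup>2\<close> the penalty is of order \<open>s\<^sup>2\<close>, as is the gap between the two
  minimal values. Hence the objective has no first-order decrease along tangent directions.\<close>

lemma cop_minimizer_stationary:
  assumes "0 < p" and "p \<le> n" and X: "X \<in> symp_set p n" and val: "cop_objective A X = (\<Sum>i=1..p. d i)"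
    and V: "V \<in> carrier_mat (2 * n) (2 * p)"
    and tangent: "V\<^sup>T * (symp_J n * X) + X\<^sup>T * (symp_J n * V) = 0\<^sub>m (2 * p) (2 * p)"
  shows "mat_inner V (A * X) = 0"
proof -
  let ?s = "\<Sum>i=1..p. d i" and ?q = "\<Sum>i=1..p. (d i)\<^sup>2"
  define Q where "Q = V\<^sup>T * (symp_J n * V)"
  have X': "X \<in> carrier_mat (2 * n) (2 * p)" "X\<^sup>T * (symp_J n * X) = symp_J p"
    using X by (auto simp: symp_set_def mult_assoc_dim)
  have Q: "dim_row Q = 2 * p" "dim_col Q = 2 * p"
    using V by (auto simp: Q_def)
  have zero: "mat_inner (0\<^sub>m k l) M = 0" "mat_inner M (0\<^sub>m k l) = 0"
    if "dim_row M = k" "dim_col M = l" for M k l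
    using that by (simp_all add: mat_inner_def)
  have dp: "0 < d p"
    using d_pos assms by simp
  show ?thesis
  proof (rule linear_term_zero[where \<delta> = "1 / (d p + 1)"
        and b = "1 / 2 * mat_inner V (A * V) + 1 / 4 * mat_inner Q Q + ?q / 2"])
    fix s :: real assume s: "s \<noteq> 0" "\<bar>s\<bar> \<le> 1 / (d p + 1)"
    define \<beta> where "\<beta> = 1 / s\<^sup>2"
    have \<beta>: "d p < \<beta>"
    proof -
      have "s\<^sup>2 \<le> (1 / (d p + 1))\<^sup>2"
        using s power_mono[of "\<bar>s\<bar>" "1 / (d p + 1)" 2] by simp
      moreover have "0 < s\<^sup>2" using s by simp
      ultimately have "1 / (1 / (d p + 1))\<^sup>2 \<le> \<beta>"
        unfolding \<beta>_def by (intro divide_left_mono) (use dp in auto)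
      moreover have "d p < (d p + 1)\<^sup>2"
        using dp by (simp add: power2_eq_square algebra_simps add_pos_pos)
      ultimately show ?thesis
        using dp by (simp add: power_one_over)
    qed
    have "tpm_objective n p A \<beta> (X + s \<cdot>\<^sub>m V) = tpm_objective n p A \<beta> X + mat_inner V (A * X) * s +
        1 / 2 * mat_inner V (A * V) * s\<^sup>2 + \<beta> / 4 * mat_inner Q Q * s ^ 4"
      using tpm_objective_expansion[OF A_carrier A_sym X'(1) V, of \<beta> s] X'(2) Q
      by (simp add: tangent zero minus_r_inv_mat[OF symp_J_carrier] flip: Q_def)
    moreover have "tpm_objective n p A \<beta> X = ?s"
      using tpm_objective_inner[OF A_carrier X'(1), of \<beta>] cop_objective_inner[OF A_carrier X'(1)] X' val
      by (simp add: mult_assoc_dim zero minus_r_inv_mat[OF symp_J_carrier])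
    moreover have "?s - ?q / (2 * \<beta>) \<le> tpm_objective n p A \<beta> (X + s \<cdot>\<^sub>m V)"
      using X' V by (intro tpm_minimum[OF assms(1,2) \<beta>]) auto
    moreover have "\<beta> / 4 * mat_inner Q Q * s ^ 4 = 1 / 4 * mat_inner Q Q * s\<^sup>2"
      using s by (simp add: \<beta>_def power2_eq_square power4_eq_xxxx)
    moreover have "?q / (2 * \<beta>) = ?q / 2 * s\<^sup>2"
      using s by (simp add: \<beta>_def)
    ultimately show "0 \<le> mat_inner V (A * X) * s +
        (1 / 2 * mat_inner V (A * V) + 1 / 4 * mat_inner Q Q + ?q / 2) * s\<^sup>2"
      unfolding distrib_right by linarith
  qed (use dp in simp)
qed

text \<open>The directions \<open>J K X\<close> with \<open>K\<close> symmetric are tangent to the constraint set. Testing with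
  \<open>K = W + W\<^sup>T\<close> for \<open>W = J A X X\<^sup>T\<close> gives \<open>W = - W\<^sup>T\<close>, and multiplying this by \<open>J X\<close> from the
  right gives the multiplier equation.\<close>

lemma cop_minimizer_critical:
  assumes "0 < p" and "p \<le> n" and X: "X \<in> symp_set p n" and val: "cop_objective A X = (\<Sum>i=1..p. d i)"
  shows "A * X = - (symp_J n * (X * (symp_J p * (X\<^sup>T * (A * X)))))"
    and "(X\<^sup>T * (A * X)) * symp_J p = symp_J p * (X\<^sup>T * (A * X))"
proof -
  have X': "X \<in> carrier_mat (2 * n) (2 * p)" "X\<^sup>T * (symp_J n * X) = symp_J p"
    using X by (auto simp: symp_set_def mult_assoc_dim)
  then have [simp]: "dim_row X = 2 * n" "dim_col X = 2 * p" by auto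
  define W where "W = symp_J n * (A * (X * X\<^sup>T))"
  define K where "K = W + W\<^sup>T"
  have [simp]: "dim_row W = 2 * n" "dim_col W = 2 * n" "dim_row K = 2 * n" "dim_col K = 2 * n"
    by (simp_all add: W_def K_def)
  have WT: "W\<^sup>T = - (X * (X\<^sup>T * (A * symp_J n)))"
    by (simp add: W_def mat_dist symp_J_transpose A_sym)
  have K_sym: "K\<^sup>T = K"
    by (rule eq_matI) (simp_all add: K_def transpose_add_dim)
  define V where "V = symp_J n * (K * X)"
  have V: "V \<in> carrier_mat (2 * n) (2 * p)"
    by (rule carrier_matI) (simp_all add: V_def)
  have "mat_inner V (A * X) = 0"
  proof (rule cop_minimizer_stationary[OF assms V])
    have "V\<^sup>T * (symp_J n * X) = X\<^sup>T * (K * X)"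
      by (simp add: V_def mat_dist K_sym symp_J_transpose symp_J_symp_J_mult)
    moreover have "X\<^sup>T * (symp_J n * V) = - (X\<^sup>T * (K * X))"
      by (simp add: V_def mat_dist symp_J_symp_J_mult)
    ultimately show "V\<^sup>T * (symp_J n * X) + X\<^sup>T * (symp_J n * V) = 0\<^sub>m (2 * p) (2 * p)"
      by (intro eq_matI) (simp_all del: index_mult_mat(1))
  qed
  moreover have "mat_inner V (A * X) = - mat_inner K W"
  proof -
    have "mat_inner V (A * X) = - mat_inner (K * X) (symp_J n * (A * X))"
      unfolding V_def by (subst mat_inner_mult_left) (simp_all add: symp_J_transpose mat_inner_linear)
    also have "\<dots> = - mat_inner K (symp_J n * (A * X) * X\<^sup>T)"
      by (subst mat_inner_mult_right) simp_all
    also have "symp_J n * (A * X) * X\<^sup>T = W"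
      by (simp add: W_def mult_assoc_dim)
    finally show ?thesis .
  qed
  ultimately have KW: "mat_inner K W = 0" by simp
  moreover have "mat_inner K W\<^sup>T = mat_inner K W"
    using mat_inner_transpose[of K W] K_sym by simp
  moreover have "mat_inner K K = mat_inner K W + mat_inner K W\<^sup>T"
    by (subst (2) K_def) (simp add: mat_inner_linear)
  ultimately have "mat_inner K K = 0" by simp
  then have K0: "K = 0\<^sub>m (2 * n) (2 * n)"
    using mat_inner_self_eq_0[of K] by simp
  have W: "W = X * (X\<^sup>T * (A * symp_J n))"
  proof (rule eq_matI)
    fix i j assume "i < dim_row (X * (X\<^sup>T * (A * symp_J n)))" "j < dim_col (X * (X\<^sup>T * (A * symp_J n)))"
    then have ij: "i < 2 * n" "j < 2 * n" by auto
    have "K $$ (i, j) = 0"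
      using ij K0 by simp
    then show "W $$ (i, j) = (X * (X\<^sup>T * (A * symp_J n))) $$ (i, j)"
      using ij by (simp add: K_def WT del: index_mult_mat(1) index_transpose_mat(1))
  qed simp_all
  define G where "G = X\<^sup>T * (A * X)"
  have [simp]: "dim_row G = 2 * p" "dim_col G = 2 * p"
    by (simp_all add: G_def)
  have "W * (symp_J n * X) = symp_J n * (A * (X * (X\<^sup>T * (symp_J n * X))))"
    by (simp add: W_def mat_dist)
  moreover have "(X * (X\<^sup>T * (A * symp_J n))) * (symp_J n * X) = - (X * G)"
    by (simp add: G_def mat_dist symp_J_symp_J_mult)
  ultimately have "symp_J n * (A * (X * symp_J p)) = - (X * G)"
    using W X'(2) by simp
  then have "symp_J n * (symp_J n * (A * (X * symp_J p))) = symp_J n * (- (X * G))"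
    by simp
  then have "- (A * (X * symp_J p)) = - (symp_J n * (X * G))"
    by (simp add: symp_J_symp_J_mult)
  then have "- (A * (X * symp_J p)) * symp_J p = - (symp_J n * (X * G)) * symp_J p"
    by (rule arg_cong)
  then have AX: "A * X = - (symp_J n * (X * (G * symp_J p)))"
    by (simp add: mat_dist symp_J_square)
  have "G = - ((X\<^sup>T * (symp_J n * X)) * (G * symp_J p))"
    by (subst G_def, subst AX) (simp add: mat_dist)
  then have "symp_J p * G = symp_J p * - (symp_J p * (G * symp_J p))"
    unfolding X'(2) by (rule arg_cong)
  then have comm: "G * symp_J p = symp_J p * G"
    by (simp add: symp_J_symp_J_mult uminus_uminus_real_mat)
  then show "(X\<^sup>T * (A * X)) * symp_J p = symp_J p * (X\<^sup>T * (A * X))"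
    by (simp add: G_def)
  show "A * X = - (symp_J n * (X * (symp_J p * (X\<^sup>T * (A * X)))))"
    using AX unfolding comm by (simp add: G_def)
qed

lemma scaled_eigenpairs_one_symp_set: "scaled_eigenpairs n p A Y c (\<lambda>_. 1) \<Longrightarrow> Y \<in> symp_set p n"
  by (auto simp: scaled_eigenpairs_def symp_set_def double_diag_one mult_assoc_dim)

lemma scaled_eigenpairs_cop_minimizer:
  assumes "scaled_eigenpairs n p A Y d (\<lambda>_. 1)" and "0 < p" and "p \<le> n"
  shows "cop_minimizer n p A Y"
  using cop_minimum[OF assms(2,3)] cop_objective_scaled_eigenpairs[OF assms(1) A_carrier]
    scaled_eigenpairs_one_symp_set[OF assms(1)]
  by (auto simp: cop_minimizer_def is_arg_min_def symp_set_def not_less)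

text \<open>Here \<open>h = 1\<close>, so interlacing gives \<open>d\<^sub>i \<le> c\<^sub>i\<close> for all \<open>i\<close>, while the sums of both agree.\<close>

lemma cop_minimizer_form:
  assumes min: "cop_minimizer n p A X" and "0 < p" and "p \<le> n"
  shows "\<exists>T\<in>or_symp_set p. scaled_eigenpairs n p A (X * T) d (\<lambda>_. 1)"
proof -
  have X: "X \<in> symp_set p n"
    using min by (auto simp: cop_minimizer_def is_arg_min_def symp_set_def)
  then have X': "X \<in> carrier_mat (2 * n) (2 * p)" "X\<^sup>T * (symp_J n * X) = symp_J p"
    by (auto simp: symp_set_def mult_assoc_dim)
  obtain E where E: "scaled_eigenpairs n p A E d (\<lambda>_. 1)"
    using first_eigenpairs_exist[OF S_symp S_diag A_carrier \<open>p \<le> n\<close>] by blast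
  have "cop_objective A X \<le> cop_objective A E"
    using min scaled_eigenpairs_one_symp_set[OF E]
    by (auto simp: cop_minimizer_def is_arg_min_def symp_set_def not_less)
  then have val: "cop_objective A X = (\<Sum>i=1..p. d i)"
    using cop_minimum[OF assms(2,3) X] cop_objective_scaled_eigenpairs[OF E A_carrier] by simp
  let ?G = "X\<^sup>T * (A * X)"
  have G: "?G \<in> carrier_mat (2 * p) (2 * p)" "?G\<^sup>T = ?G"
    using X' by (auto simp: mat_dist A_sym)
  have "X\<^sup>T * (symp_J n * X) = symp_J p * (1\<^sub>m (2 * p) - 0 \<cdot>\<^sub>m ?G)"
  proof -
    have "1\<^sub>m (2 * p) - 0 \<cdot>\<^sub>m ?G = 1\<^sub>m (2 * p)"
      using X'(1) by (intro eq_matI) (simp_all del: index_mult_mat(1))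
    then show ?thesis by (simp add: X'(2))
  qed
  from symmetric_multiplier_diagonalisation[OF A_carrier X'(1) G
      cop_minimizer_critical(2)[OF assms(2,3) X val] cop_minimizer_critical(1)[OF assms(2,3) X val] this]
  obtain T c where T: "T \<in> or_symp_set p" and c_mono: "mono_on {1..p} c"
    and pairs: "scaled_eigenpairs n p A (X * T) c (\<lambda>_. 1)"
    by auto
  have dc: "d i \<le> c i" if "i \<in> {1..p}" for i
    using that \<open>p \<le> n\<close>
    by (intro eigenpairs_interlace[OF S_symp S_diag A_carrier pairs d_pos d_mono c_mono]) auto
  have "(\<Sum>i=1..p. c i) = (\<Sum>i=1..p. d i)"
    using cop_objective_scaled_eigenpairs[OF pairs A_carrier] val
      objective_or_symp_invariant(1)[OF T X'(1) A_carrier] by simp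
  then have "\<forall>i\<in>{1..p}. c i - d i = 0"
    using dc by (subst sum_nonneg_eq_0_iff[symmetric]) (auto simp: sum_subtractf)
  then have "scaled_eigenpairs n p A (X * T) d (\<lambda>_. 1)"
    by (intro scaled_eigenpairs_cong[OF pairs]) auto
  with T show ?thesis by blast
qed

end

section \<open>Column spaces and the equivalence\<close>

lemma column_space_eq: "column_space X = {X *\<^sub>v x |x. x \<in> carrier_vec (dim_col X)}"
proof -
  have X: "X \<in> carrier_mat (dim_row X) (dim_col X)" by simp
  show ?thesis
    unfolding column_space_def vec_space.col_space_eq[OF X]
    by (auto intro: carrier_vecI)
qed

lemma column_space_mult_subset:
  assumes "dim_col X = dim_row Q"
  shows "column_space (X * Q) \<subseteq> column_space X"
proof
  fix y assume "y \<in> column_space (X * Q)"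
  then obtain x where x: "x \<in> carrier_vec (dim_col Q)" "y = (X * Q) *\<^sub>v x"
    by (auto simp: column_space_eq)
  then have "y = X *\<^sub>v (Q *\<^sub>v x)"
    using assms by (simp add: assoc_mult_mat_vec_dim)
  then show "y \<in> column_space X"
    using assms unfolding column_space_eq by (auto intro!: exI[of _ "Q *\<^sub>v x"] carrier_vecI)
qed

lemma column_space_mult_invertible:
  assumes "Q * R = 1\<^sub>m q" and "dim_col X = q" and "dim_row Q = q" and "dim_col Q = dim_row R"
  shows "column_space (X * Q) = column_space X"
proof
  show "column_space (X * Q) \<subseteq> column_space X"
    using assms by (intro column_space_mult_subset) simp
  have "(X * Q) * R = X"
    using assms by (simp add: mult_assoc_dim)
  then show "column_space X \<subseteq> column_space (X * Q)"
    using column_space_mult_subset[of "X * Q" R] assms by simp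
qed

lemma column_space_eq_imp_factor:
  assumes eq: "column_space Y = column_space X" and Y: "Y \<in> carrier_mat m k" and X: "X \<in> carrier_mat m q"
  shows "\<exists>Q\<in>carrier_mat q k. Y = X * Q"
proof -
  have "\<exists>x. x \<in> carrier_vec q \<and> col Y j = X *\<^sub>v x" if "j < k" for j
  proof -
    have "Y *\<^sub>v unit_vec k j = col Y j"
      using Y that by (intro eq_vecI) auto
    then have "col Y j \<in> column_space Y"
      using Y that unfolding column_space_eq by (auto intro!: exI[of _ "unit_vec k j"])
    then show ?thesis
      using X unfolding eq by (auto simp: column_space_eq)
  qed
  then obtain x where x: "\<And>j. j < k \<Longrightarrow> x j \<in> carrier_vec q" "\<And>j. j < k \<Longrightarrow> col Y j = X *\<^sub>v x j"
    by metis
  define Q where "Q = mat q k (\<lambda>(r, j). x j $ r)"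
  have Q: "Q \<in> carrier_mat q k" by (simp add: Q_def)
  have col_Q: "col Q j = x j" if "j < k" for j
    using that x(1)[OF that] by (auto simp: Q_def)
  have "Y = X * Q"
  proof (rule eq_matI)
    fix i j assume "i < dim_row (X * Q)" "j < dim_col (X * Q)"
    then have ij: "i < m" "j < k" using X Q by auto
    have "Y $$ (i, j) = col Y j $ i"
      using ij Y by simp
    also have "\<dots> = (X *\<^sub>v col Q j) $ i"
      using ij x(2) col_Q by simp
    also have "\<dots> = (X * Q) $$ (i, j)"
      using ij X Q by simp
    finally show "Y $$ (i, j) = (X * Q) $$ (i, j)" .
  qed (use X Y Q in auto)
  with Q show ?thesis by blast
qed

lemma col_pair_index:
  assumes "S \<in> carrier_mat m (2 * p)" and "i \<in> {1..p}"
  shows "dim_row (col_pair p S i) = m" and "dim_col (col_pair p S i) = 2"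
    and "r < m \<Longrightarrow> col_pair p S i $$ (r, 0) = S $$ (r, i - 1)"
    and "r < m \<Longrightarrow> col_pair p S i $$ (r, 1) = S $$ (r, i - 1 + p)"
proof -
  have "i - 1 < 2 * p" "i - 1 + p < 2 * p"
    using assms by auto
  then show "dim_row (col_pair p S i) = m" "dim_col (col_pair p S i) = 2"
    "r < m \<Longrightarrow> col_pair p S i $$ (r, 0) = S $$ (r, i - 1)"
    "r < m \<Longrightarrow> col_pair p S i $$ (r, 1) = S $$ (r, i - 1 + p)"
    using assms(1) by (simp_all add: col_pair_def mat_of_cols_index)
qed

lemma mult_col_pair:
  assumes "B \<in> carrier_mat k m" and "S \<in> carrier_mat m (2 * p)" and "i \<in> {1..p}"
  shows "B * col_pair p S i = col_pair p (B * S) i"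
proof (rule eq_matI)
  have BS: "B * S \<in> carrier_mat k (2 * p)"
    using assms by auto
  note cp = col_pair_index[OF assms(2,3)] and cp' = col_pair_index[OF BS assms(3)]
  have i: "i - 1 < 2 * p" "i - 1 + p < 2 * p"
    using assms(3) by auto
  fix r c assume "r < dim_row (col_pair p (B * S) i)" "c < dim_col (col_pair p (B * S) i)"
  then have rc: "r < k" "c = 0 \<or> c = 1"
    by (auto simp: cp'(1,2))
  then show "(B * col_pair p S i) $$ (r, c) = col_pair p (B * S) i $$ (r, c)"
    using assms(1,2) i
    by (elim disjE)
      (simp_all only: cp'(3) cp'(4), simp_all add: mult_index_sum cp[simplified] del: index_mult_mat(1))
qed (use assms in \<open>simp_all add: col_pair_def\<close>)

lemma eigenpair_iff:
  assumes A: "A \<in> carrier_mat (2 * n) (2 * n)" and S: "S \<in> carrier_mat (2 * n) (2 * p)"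
    and i: "i \<in> {1..p}"
  shows "A * col_pair p S i = c \<cdot>\<^sub>m (symp_J n * col_pair p S i * (symp_J 1)\<^sup>T) \<longleftrightarrow>
    (\<forall>r<2 * n. (A * S) $$ (r, i - 1) = c * (symp_J n * S) $$ (r, i - 1 + p) \<and>
      (A * S) $$ (r, i - 1 + p) = - c * (symp_J n * S) $$ (r, i - 1))"
proof -
  have AS: "A * S \<in> carrier_mat (2 * n) (2 * p)" and JS: "symp_J n * S \<in> carrier_mat (2 * n) (2 * p)"
    using A S by auto
  note a = col_pair_index[OF AS i] and j = col_pair_index[OF JS i]
  let ?R = "c \<cdot>\<^sub>m (col_pair p (symp_J n * S) i * (symp_J 1)\<^sup>T)"
  have R: "?R $$ (r, 0) = c * (symp_J n * S) $$ (r, i - 1 + p)"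
    "?R $$ (r, 1) = - c * (symp_J n * S) $$ (r, i - 1)" if "r < 2 * n" for r
    using that j
    by (simp_all add: symp_J_transpose mult_symp_J_index conj_index_def conj_sign_def
        del: index_mult_mat(1))
  have "A * col_pair p S i = c \<cdot>\<^sub>m (symp_J n * col_pair p S i * (symp_J 1)\<^sup>T) \<longleftrightarrow>
      col_pair p (A * S) i = ?R"
    by (simp only: mult_col_pair[OF A S i] mult_col_pair[OF symp_J_carrier S i])
  also have "\<dots> \<longleftrightarrow> (\<forall>r<2 * n. \<forall>k<2. col_pair p (A * S) i $$ (r, k) = ?R $$ (r, k))"
    using a(1,2) j(1,2) by (auto simp only: mat_eq_iff) (simp_all del: index_mult_mat(1))
  also have "\<dots> \<longleftrightarrow> (\<forall>r<2 * n. col_pair p (A * S) i $$ (r, 0) = ?R $$ (r, 0) \<and>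
      col_pair p (A * S) i $$ (r, 1) = ?R $$ (r, 1))"
    by (simp only: numeral_2_eq_2 less_Suc_eq less_Suc0 One_nat_def) blast
  also have "\<dots> \<longleftrightarrow> (\<forall>r<2 * n. (A * S) $$ (r, i - 1) = c * (symp_J n * S) $$ (r, i - 1 + p) \<and>
      (A * S) $$ (r, i - 1 + p) = - c * (symp_J n * S) $$ (r, i - 1))"
    by (rule all_cong) (simp only: a(3) a(4) R)
  finally show ?thesis .
qed

text \<open>The pairwise eigenvector equations defining the eigenspaces are the columns of a single matrix
  equation.\<close>

lemma scaled_eigenpairs_one_iff:
  assumes A: "A \<in> carrier_mat (2 * n) (2 * n)"
  shows "scaled_eigenpairs n p A S c (\<lambda>_. 1) \<longleftrightarrow> S \<in> symp_set p n \<and>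
    (\<forall>i\<in>{1..p}. A * col_pair p S i = c i \<cdot>\<^sub>m (symp_J n * col_pair p S i * (symp_J 1)\<^sup>T))"
proof (cases "S \<in> symp_set p n")
  case True
  then have S: "S \<in> carrier_mat (2 * n) (2 * p)" "S\<^sup>T * (symp_J n * S) = symp_J p"
    by (auto simp: symp_set_def mult_assoc_dim)
  then have [simp]: "dim_row S = 2 * n" "dim_col S = 2 * p" "dim_row A = 2 * n" "dim_col A = 2 * n"
    using A by auto
  let ?R = "- (symp_J n * (S * (symp_J p * double_diag p c)))"
  have R: "?R $$ (r, k) = conj_sign p k * (symp_J n * S) $$ (r, conj_index p k) * dbl p c k"
    if "r < 2 * n" "k < 2 * p" for r k
  proof -
    have "?R = - ((symp_J n * S) * symp_J p * double_diag p c)"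
      by (simp add: mult_assoc_dim)
    then show ?thesis
      using that
      by (simp add: mult_double_diag_index[of "symp_J n * S * symp_J p"]
          mult_symp_J_index[of "symp_J n * S"] del: index_mult_mat(1))
  qed
  have "A * S = ?R \<longleftrightarrow> (\<forall>r<2 * n. \<forall>k<2 * p. (A * S) $$ (r, k) = ?R $$ (r, k))"
    by (subst mat_eq_iff) simp
  also have "\<dots> \<longleftrightarrow> (\<forall>i\<in>{1..p}. \<forall>r<2 * n. (A * S) $$ (r, i - 1) = c i * (symp_J n * S) $$ (r, i - 1 + p) \<and>
      (A * S) $$ (r, i - 1 + p) = - c i * (symp_J n * S) $$ (r, i - 1))" (is "?L \<longleftrightarrow> ?M")
  proof
    assume L: ?L
    show ?M
    proof (intro ballI allI impI)
      fix i r assume i: "i \<in> {1..p}" and r: "r < 2 * n"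
      then have k: "i - 1 < 2 * p" "i - 1 + p < 2 * p" "i - 1 < p" by auto
      have "(A * S) $$ (r, i - 1) = ?R $$ (r, i - 1)" "(A * S) $$ (r, i - 1 + p) = ?R $$ (r, i - 1 + p)"
        using L r k by blast+
      then show "(A * S) $$ (r, i - 1) = c i * (symp_J n * S) $$ (r, i - 1 + p) \<and>
          (A * S) $$ (r, i - 1 + p) = - c i * (symp_J n * S) $$ (r, i - 1)"
        unfolding R[OF r k(1)] R[OF r k(2)] using i k(3)
        by (simp add: conj_sign_def conj_index_def dbl_def del: index_mult_mat(1))
    qed
  next
    assume M: ?M
    show ?L
    proof (intro allI impI)
      fix r k assume r: "r < 2 * n" and k: "k < 2 * p"
      define i where "i = (if k < p then k + 1 else k - p + 1)"
      have "i \<in> {1..p}" using k by (auto simp: i_def)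
      then have "(A * S) $$ (r, i - 1) = c i * (symp_J n * S) $$ (r, i - 1 + p)"
          "(A * S) $$ (r, i - 1 + p) = - c i * (symp_J n * S) $$ (r, i - 1)"
        using M r by blast+
      then show "(A * S) $$ (r, k) = ?R $$ (r, k)"
        unfolding R[OF r k] using k
        by (cases "k < p") (simp_all add: i_def conj_sign_def conj_index_def dbl_def del: index_mult_mat(1))
    qed
  qed
  also have "\<dots> \<longleftrightarrow> (\<forall>i\<in>{1..p}.
      A * col_pair p S i = c i \<cdot>\<^sub>m (symp_J n * col_pair p S i * (symp_J 1)\<^sup>T))"
    by (rule ball_cong[OF refl]) (simp only: eigenpair_iff[OF A S(1)])
  finally show ?thesis
    using S True by (simp add: scaled_eigenpairs_def double_diag_one)
next
  case False
  then show ?thesis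
    by (auto simp: scaled_eigenpairs_def symp_set_def double_diag_one mult_assoc_dim)
qed

lemma symplectic_eigenspaces_eq:
  assumes "A \<in> carrier_mat (2 * n) (2 * n)"
  shows "symplectic_eigenspaces n p A d = {column_space S |S. scaled_eigenpairs n p A S d (\<lambda>_. 1)}"
  by (simp add: symplectic_eigenspaces_def scaled_eigenpairs_one_iff[OF assms])

text \<open>If \<open>S = Y Q\<close> is symplectic, then \<open>J = Q\<^sup>T (J H) Q\<close> with \<open>H\<close> the doubled diagonal of \<open>h\<close>, and
  \<open>H\<close> has to be invertible.\<close>

lemma degenerate_column_space_not_symplectic:
  assumes "0 < p" and Y: "scaled_eigenpairs n p A Y c h" and "h p = 0" and S: "S \<in> symp_set p n"
  shows "column_space Y \<noteq> column_space S"
proof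
  assume eq: "column_space Y = column_space S"
  have S': "S \<in> carrier_mat (2 * n) (2 * p)" "S\<^sup>T * (symp_J n * S) = symp_J p"
    using S by (auto simp: symp_set_def mult_assoc_dim)
  have Y': "Y \<in> carrier_mat (2 * n) (2 * p)" "Y\<^sup>T * (symp_J n * Y) = symp_J p * double_diag p h"
    using Y by (auto simp: scaled_eigenpairs_def)
  obtain Q where Q: "Q \<in> carrier_mat (2 * p) (2 * p)" "S = Y * Q"
    using column_space_eq_imp_factor[OF eq[symmetric] S'(1) Y'(1)] by blast
  have [simp]: "dim_row Y = 2 * n" "dim_col Y = 2 * p" "dim_row Q = 2 * p" "dim_col Q = 2 * p"
    using Y' Q by auto
  let ?B = "- (symp_J p * (Q\<^sup>T * (symp_J p * double_diag p h)))"
  have "symp_J p = Q\<^sup>T * ((Y\<^sup>T * (symp_J n * Y)) * Q)"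
    using S'(2) Q(2) by (simp add: mat_dist)
  then have "symp_J p * symp_J p = symp_J p * (Q\<^sup>T * ((symp_J p * double_diag p h) * Q))"
    unfolding Y'(2) by (rule arg_cong)
  then have "?B * Q = - (- 1\<^sub>m (2 * p))"
    by (simp add: mat_dist symp_J_square)
  then have "?B * Q = 1\<^sub>m (2 * p)"
    by (simp add: uminus_uminus_real_mat)
  then have "Q * ?B = 1\<^sub>m (2 * p)"
    by (rule mat_mult_left_right_inverse[rotated 2]) (auto intro: carrier_matI)
  also have "Q * ?B = - (Q * (symp_J p * (Q\<^sup>T * symp_J p))) * double_diag p h"
    by (simp add: mat_dist)
  finally have "(- (Q * (symp_J p * (Q\<^sup>T * symp_J p))) * double_diag p h) $$ (p - 1, p - 1) = 1"
    using \<open>0 < p\<close> by simp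
  moreover have "dbl p h (p - 1) = 0"
    using assms by (simp add: dbl_def)
  ultimately show False
    using \<open>0 < p\<close> by (subst (asm) mult_double_diag_index) simp_all
qed

text \<open>For the uniqueness, let \<open>R\<close> be a positive semidefinite square root, \<open>e\<close> a unit vector and
  \<open>s\<^sup>2\<close> the diagonal entry at \<open>e\<close>, with \<open>s > 0\<close>. The vector \<open>u = R e - s e\<close> satisfies
  \<open>R u = - s u\<close>, which semidefiniteness allows only for \<open>u = 0\<close>.\<close>

lemma psd_sqrt_double_diag:
  assumes e: "\<And>i. i \<in> {1..p} \<Longrightarrow> 0 < e i"
  shows "psd_sqrt (double_diag p e) = double_diag p (\<lambda>i. sqrt (e i))"
  unfolding psd_sqrt_def
proof (rule the_equality)
  let ?E = "double_diag p (\<lambda>i. sqrt (e i))"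
  have dbl_sqrt: "dbl p (\<lambda>i. sqrt (e i)) k = sqrt (dbl p e k)" for k
    by (simp add: dbl_def)
  have e_pos: "0 < dbl p e k" if "k < 2 * p" for k
    using that e by (auto simp: dbl_def)
  have "0 \<le> v \<bullet> (?E *\<^sub>v v)" if v: "v \<in> carrier_vec (2 * p)" for v
  proof -
    have "(?E *\<^sub>v v) $ k = sqrt (dbl p e k) * v $ k" if k: "k < 2 * p" for k
    proof -
      have "(?E *\<^sub>v v) $ k = (\<Sum>l<2 * p. ?E $$ (k, l) * v $ l)"
        using k v by (simp add: scalar_prod_def atLeast0LessThan)
      also have "\<dots> = (\<Sum>l<2 * p. if l = k then sqrt (dbl p e k) * v $ l else 0)"
        using k by (intro sum.cong) (auto simp: double_diag_index dbl_sqrt)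
      finally show ?thesis using k by simp
    qed
    then have "v \<bullet> (?E *\<^sub>v v) = (\<Sum>k<2 * p. sqrt (dbl p e k) * (v $ k)\<^sup>2)"
      by (simp add: scalar_prod_def[of v] atLeast0LessThan power2_eq_square mult_ac
          del: index_mult_mat_vec)
    also have "\<dots> \<ge> 0"
      using e_pos by (intro sum_nonneg mult_nonneg_nonneg) (auto simp: less_imp_le)
    finally show ?thesis .
  qed
  moreover have "?E * ?E = double_diag p e"
    unfolding double_diag_mult using e by (intro double_diag_cong) (simp add: less_imp_le)
  ultimately show "positive_semidefinite (dim_row (double_diag p e)) ?E \<and> ?E * ?E = double_diag p e"
    by (simp add: positive_semidefinite_def double_diag_transpose)
  fix R assume R: "positive_semidefinite (dim_row (double_diag p e)) R \<and> R * R = double_diag p e"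
  then have R_carrier: "R \<in> carrier_mat (2 * p) (2 * p)" and RR: "R * R = double_diag p e"
    and psd: "\<And>v. v \<in> carrier_vec (2 * p) \<Longrightarrow> 0 \<le> v \<bullet> (R *\<^sub>v v)"
    by (auto simp: positive_semidefinite_def)
  have [simp]: "dim_row R = 2 * p" "dim_col R = 2 * p"
    using R_carrier by auto
  show "R = ?E"
  proof (rule eq_matI)
    fix i k assume "i < dim_row ?E" "k < dim_col ?E"
    then have ik: "i < 2 * p" "k < 2 * p" by auto
    define s where "s = sqrt (dbl p e k)"
    have s: "0 < s" "s * s = dbl p e k"
      using e_pos[OF ik(2)] by (auto simp: s_def)
    let ?e = "unit_vec (2 * p) k :: real vec"
    define u where "u = R *\<^sub>v ?e - s \<cdot>\<^sub>v ?e"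
    have Re: "R *\<^sub>v ?e \<in> carrier_vec (2 * p)"
      using R_carrier by simp
    have u: "u \<in> carrier_vec (2 * p)"
      using Re by (simp add: u_def)
    have "R *\<^sub>v (R *\<^sub>v ?e) = double_diag p e *\<^sub>v ?e"
      using RR by (simp flip: assoc_mult_mat_vec_dim)
    also have "\<dots> = (s * s) \<cdot>\<^sub>v ?e"
      using ik(2) by (intro eq_vecI) (auto simp: double_diag_index s(2))
    finally have RRe: "R *\<^sub>v (R *\<^sub>v ?e) = (s * s) \<cdot>\<^sub>v ?e" .
    have "R *\<^sub>v u = R *\<^sub>v (R *\<^sub>v ?e) - s \<cdot>\<^sub>v (R *\<^sub>v ?e)"
      unfolding u_def using R_carrier Re
      by (subst mult_minus_distrib_mat_vec[of _ "2 * p" "2 * p"]) (auto simp: mult_mat_vec)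
    also have "\<dots> = (- s) \<cdot>\<^sub>v u"
      unfolding RRe u_def using Re by (intro eq_vecI) (auto simp: algebra_simps)
    finally have "0 \<le> - s * (u \<bullet> u)"
      using psd[OF u] u by simp
    then have "u \<bullet> u \<le> 0"
      using s(1) by (simp add: mult_le_0_iff)
    moreover have uu: "u \<bullet> u = (\<Sum>l<2 * p. (u $ l)\<^sup>2)"
      using u by (simp add: scalar_prod_def atLeast0LessThan power2_eq_square)
    moreover have "(u $ i)\<^sup>2 \<le> (\<Sum>l<2 * p. (u $ l)\<^sup>2)"
      using ik by (intro member_le_sum) auto
    ultimately have "(u $ i)\<^sup>2 \<le> 0" by linarith
    then have "(R *\<^sub>v ?e) $ i = s * ?e $ i"
      using ik Re by (simp add: u_def)
    then show "R $$ (i, k) = ?E $$ (i, k)"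
      using ik by (auto simp: double_diag_index dbl_sqrt s_def)
  qed simp_all
qed

context williamson_form
begin

lemma column_space_mult_or_symp:
  assumes "T \<in> or_symp_set p" and "X \<in> carrier_mat (2 * n) (2 * p)"
  shows "column_space (X * T) = column_space X"
  using or_symp_setD[OF assms(1)] assms(2) by (intro column_space_mult_invertible[where R = "T\<^sup>T"]) auto

text \<open>This links the minimisers of the two problems, which for \<open>\<beta> > d\<^sub>p\<close> are pairs for the same \<open>d\<close>
  with different \<open>h\<close>.\<close>

lemma scaled_eigenpairs_column_space:
  assumes Y: "scaled_eigenpairs n p A Y d h" and h: "\<And>i. i \<in> {1..p} \<Longrightarrow> 0 < h i"
    and g: "\<And>i. i \<in> {1..p} \<Longrightarrow> 0 < g i"
  shows "\<exists>Z. scaled_eigenpairs n p A Z d g \<and> column_space Z = column_space Y \<and>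
    Y = Z * double_diag p (\<lambda>i. sqrt (h i / g i))"
proof (intro exI conjI)
  let ?r = "\<lambda>i. sqrt (g i / h i)" and ?r' = "\<lambda>i. sqrt (h i / g i)"
  have Y': "Y \<in> carrier_mat (2 * n) (2 * p)"
    using Y by (simp add: scaled_eigenpairs_def)
  have inv: "double_diag p ?r * double_diag p ?r' = 1\<^sub>m (2 * p)"
  proof -
    have "sqrt (g i / h i) * sqrt (h i / g i) = 1" if "i \<in> {1..p}" for i
      using h[OF that] g[OF that] by (simp flip: real_sqrt_mult)
    then show ?thesis
      unfolding double_diag_mult double_diag_one[symmetric] by (rule double_diag_cong)
  qed
  show "scaled_eigenpairs n p A (Y * double_diag p ?r) d g"
    by (rule scaled_eigenpairs_cong[OF scaled_eigenpairs_mult_double_diag[OF Y A_carrier, of ?r]])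
      (use h g in \<open>auto simp: less_imp_le divide_nonneg_pos less_le\<close>)
  show "column_space (Y * double_diag p ?r) = column_space Y"
    using inv Y' by (intro column_space_mult_invertible) auto
  show "Y = Y * double_diag p ?r * double_diag p ?r'"
    using Y' by (simp add: mult_assoc_dim inv)
qed

lemma cop_column_spaces:
  assumes "0 < p" and "p \<le> n"
  shows "column_space ` Collect (cop_minimizer n p A) = symplectic_eigenspaces n p A d"
proof -
  have "\<exists>S. column_space X = column_space S \<and> scaled_eigenpairs n p A S d (\<lambda>_. 1)"
    if min: "cop_minimizer n p A X" for X
  proof -
    obtain T where T: "T \<in> or_symp_set p" "scaled_eigenpairs n p A (X * T) d (\<lambda>_. 1)"
      using cop_minimizer_form[OF min assms] by blast
    have "X \<in> carrier_mat (2 * n) (2 * p)"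
      using min by (simp add: cop_minimizer_def is_arg_min_def)
    then show ?thesis
      using T column_space_mult_or_symp by metis
  qed
  moreover have "cop_minimizer n p A S" if "scaled_eigenpairs n p A S d (\<lambda>_. 1)" for S
    by (rule scaled_eigenpairs_cop_minimizer[OF that assms])
  ultimately show ?thesis
    unfolding symplectic_eigenspaces_eq[OF A_carrier] by (auto simp: image_iff)
qed

lemma tpm_column_spaces:
  assumes "0 < p" and "p \<le> n" and "d p < \<beta>"
  shows "column_space ` Collect (tpm_minimizer n p A \<beta>) = symplectic_eigenspaces n p A d"
proof -
  have "0 < \<beta>"
    using d_pos[of p] assms by simp
  have g: "0 < 1 - d i / \<beta>" if "i \<in> {1..p}" for i
    using d_le[OF that assms(2)] assms(3) \<open>0 < \<beta>\<close> by simp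
  have "\<exists>S. column_space X = column_space S \<and> scaled_eigenpairs n p A S d (\<lambda>_. 1)"
    if min: "tpm_minimizer n p A \<beta> X" for X
  proof -
    obtain T where T: "T \<in> or_symp_set p" "scaled_eigenpairs n p A (X * T) d (\<lambda>i. 1 - d i / \<beta>)"
      using tpm_minimizer_form[OF min assms] by blast
    show ?thesis
      using scaled_eigenpairs_column_space[OF T(2) g, of "\<lambda>_. 1"]
        column_space_mult_or_symp[OF T(1) tpm_minimizerD(1)[OF min]] by auto
  qed
  moreover have "\<exists>X. column_space X = column_space S \<and> tpm_minimizer n p A \<beta> X"
    if S: "scaled_eigenpairs n p A S d (\<lambda>_. 1)" for S
    using scaled_eigenpairs_column_space[OF S, of "\<lambda>i. 1 - d i / \<beta>"] g
      scaled_eigenpairs_tpm_minimizer[OF _ assms] by auto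
  ultimately show ?thesis
    unfolding symplectic_eigenspaces_eq[OF A_carrier] by (auto simp: image_iff) metis+
qed

lemma tpm_minimizer_factorisation:
  assumes min: "tpm_minimizer n p A \<beta> X" and "0 < p" and "p \<le> n" and "d p < \<beta>"
  shows "\<exists>S\<in>symp_set p n. \<exists>T\<in>or_symp_set p. S\<^sup>T * A * S = double_diag p d \<and>
    X = S * psd_sqrt (1\<^sub>m (2 * p) - (1 / \<beta>) \<cdot>\<^sub>m double_diag p d) * T\<^sup>T"
proof -
  have "0 < \<beta>"
    using d_pos[of p] assms by simp
  have g: "0 < 1 - d i / \<beta>" if "i \<in> {1..p}" for i
    using d_le[OF that assms(3)] assms(4) \<open>0 < \<beta>\<close> by simp
  obtain T where T: "T \<in> or_symp_set p" "scaled_eigenpairs n p A (X * T) d (\<lambda>i. 1 - d i / \<beta>)"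
    using tpm_minimizer_form[OF assms] by blast
  obtain Z where Z: "scaled_eigenpairs n p A Z d (\<lambda>_. 1)"
    and XT: "X * T = Z * double_diag p (\<lambda>i. sqrt (1 - d i / \<beta>))"
    using scaled_eigenpairs_column_space[OF T(2) g, of "\<lambda>_. 1"] by auto
  have X: "X \<in> carrier_mat (2 * n) (2 * p)"
    using tpm_minimizerD(1)[OF min] .
  have Z': "Z \<in> carrier_mat (2 * n) (2 * p)"
    using Z by (simp add: scaled_eigenpairs_def)
  have "1\<^sub>m (2 * p) - (1 / \<beta>) \<cdot>\<^sub>m double_diag p d = double_diag p (\<lambda>i. 1 - d i / \<beta>)"
    by (simp add: double_diag_smult double_diag_diff flip: double_diag_one)
  then have "psd_sqrt (1\<^sub>m (2 * p) - (1 / \<beta>) \<cdot>\<^sub>m double_diag p d) = double_diag p (\<lambda>i. sqrt (1 - d i / \<beta>))"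
    using psd_sqrt_double_diag[of p "\<lambda>i. 1 - d i / \<beta>", OF g] by simp
  moreover have "X = (X * T) * T\<^sup>T"
    using X or_symp_setD[OF T(1)] by (simp add: mult_assoc_dim)
  moreover have "Z\<^sup>T * A * Z = double_diag p d"
    using scaled_eigenpairs_gram[OF Z] Z' A_carrier by (simp add: mult_assoc_dim)
  ultimately show ?thesis
    using T(1) scaled_eigenpairs_one_symp_set[OF Z] XT by (intro bexI[of _ Z] bexI[of _ T]) auto
qed

text \<open>For \<open>\<beta> \<le> d\<^sub>p\<close> the upper bound on \<open>h\<^sub>p\<close> is \<open>0\<close>, so the last pair of columns degenerates.\<close>

lemma tpm_column_space_not_eigenspace:
  assumes min: "tpm_minimizer n p A \<beta> X" and "0 < \<beta>" and "0 < p" and "p \<le> n" and "\<beta> \<le> d p"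
  shows "column_space X \<notin> symplectic_eigenspaces n p A d"
proof
  assume "column_space X \<in> symplectic_eigenspaces n p A d"
  then obtain S where S: "S \<in> symp_set p n" "column_space X = column_space S"
    by (auto simp: symplectic_eigenspaces_def)
  obtain T h where T: "T \<in> or_symp_set p"
    and pairs: "scaled_eigenpairs n p A (X * T) (\<lambda>i. \<beta> * (1 - h i)) h"
    and h: "\<And>i. i \<in> {1..p} \<Longrightarrow> 0 \<le> h i \<and> h i \<le> max 0 (1 - d i / \<beta>)"
    using tpm_minimizer_weights[OF min assms(2,4)] by blast
  have "1 - d p / \<beta> \<le> 0"
    using assms by simp
  then have "h p = 0"
    using h[of p] assms(3) by auto
  then show False
    using degenerate_column_space_not_symplectic[OF assms(3) pairs _ S(1)] S(2)
      column_space_mult_or_symp[OF T tpm_minimizerD(1)[OF min]] by simp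
qed

end

theorem proposition6:
  fixes n p :: nat and A :: "real mat" and d :: "nat \<Rightarrow> real" and \<beta> :: real
  assumes "0 < p" and "p \<le> n"
    and "positive_definite (2 * n) A"
    and "symplectic_eigenvalues n A d"
    and "mono_on {1..n} d"
    and "0 < \<beta>"
  shows "(tpm_cop_equivalent n p A d \<beta> \<longleftrightarrow> d p < \<beta>) \<and>
    (d p < \<beta> \<longrightarrow>
      (\<forall>X. tpm_minimizer n p A \<beta> X \<longrightarrow>
        (\<exists>S\<in>symp_set p n. \<exists>T\<in>or_symp_set p.
          S\<^sup>T * A * S = double_diag p d \<and>
          X = S * psd_sqrt (1\<^sub>m (2 * p) - (1 / \<beta>) \<cdot>\<^sub>m double_diag p d) * T\<^sup>T)))"
proof -
  obtain S where S: "S \<in> symp_set n n" "S\<^sup>T * A * S = double_diag n d"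
    and d_pos: "\<And>j. j \<in> {1..n} \<Longrightarrow> 0 < d j"
    using assms(4) by (auto simp: symplectic_eigenvalues_def)
  interpret williamson_form n A d S
    by unfold_locales (use assms S d_pos in auto)
  have "tpm_cop_equivalent n p A d \<beta> \<longleftrightarrow> d p < \<beta>"
  proof
    assume equiv: "tpm_cop_equivalent n p A d \<beta>"
    obtain X where X: "tpm_minimizer n p A \<beta> X"
      using tpm_minimizer_exists[OF _ S A_carrier d_pos d_mono \<open>0 < \<beta>\<close>, of p] assms by auto
    then have "column_space X \<in> symplectic_eigenspaces n p A d"
      using equiv by (auto simp: tpm_cop_equivalent_def)
    then show "d p < \<beta>"
      using tpm_column_space_not_eigenspace[OF X \<open>0 < \<beta>\<close> assms(1,2)] by (meson not_le)
  next
    assume "d p < \<beta>"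
    then show "tpm_cop_equivalent n p A d \<beta>"
      by (simp add: tpm_cop_equivalent_def tpm_column_spaces[OF assms(1,2)]
          cop_column_spaces[OF assms(1,2)])
  qed
  then show ?thesis
    using tpm_minimizer_factorisation[OF _ assms(1,2)] by blast
qed

end
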